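(* Let $h \ge 3$ be an integer and let $H$ be a fixed graph with $h$ vertices. Let $G=(V,E)$ be a graph with $n$ vertices and let $w : V \rightarrow \mathbb{R}$ be a weight function. Then for every pair of vertices $u,v \in V$, an induced $H$-subgraph of $G$ containing $u$ and $v$ of maximum weight (if one exists) can be found, for all pairs simultaneously, in $O(n^{t(\omega,h)})$ total time. In particular, the MAX $H$-SUBGRAPH problem (find an $H$-subgraph of $G$ of maximum weight, if one exists) can be solved in $O(n^{t(\omega,h)})$ time.
   Context: $\omega$ denotes the exponent of square matrix multiplication (two $n\times n$ matrices can be multiplied in $O(n^\omega)$ arithmetic operations; currently $\omega<2.376$). The weight of a subgraph is the sum of the weights of its vertices. Computation is in the addition-comparison model: real numbers may only be added and compared. The function $t(\omega,h)$ is defined as follows: $b_1 = \max \{b \in \mathbb{N} : \frac{b}{4-\omega} \le \lfloor \frac{h-b}{2} \rfloor\}$; $s_1 = h-b_1+\frac{b_1}{4-\omega}$; for an integer $b$, $s_2(b) = \max \{h-b+\lfloor \frac{h-b}{2} \rfloor ,\ h-(3-\omega)\lfloor \frac{h-b}{2} \rfloor \}$; $s_2 = \min \{s_2(b) : \lfloor \frac{h-b}{2} \rfloor \le b \le h-2\}$ (minimum over integers $b$); and $t(\omega,h) = \min \{s_1,s_2\}$. *)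

theory Defs
  imports Complex_Main "HOL-Library.Landau_Symbols"
begin

section \<open>Graphs and H-subgraphs\<close>

type_synonym 'a graph = "'a set \<times> 'a set set"

abbreviation verts :: "'a graph \<Rightarrow> 'a set" where "verts \<equiv> fst"
abbreviation edges :: "'a graph \<Rightarrow> 'a set set" where "edges \<equiv> snd"

definition simple_graph :: "'a graph \<Rightarrow> bool" where
  "simple_graph G \<longleftrightarrow> finite (verts G) \<and> (\<forall>e\<in>edges G. e \<subseteq> verts G \<and> card e = 2)"

definition subgraph :: "'a graph \<Rightarrow> 'a graph \<Rightarrow> bool" where
  "subgraph K G \<longleftrightarrow> simple_graph K \<and> verts K \<subseteq> verts G \<and> edges K \<subseteq> edges G"

definition induced_subgraph :: "'a graph \<Rightarrow> 'a graph \<Rightarrow> bool" where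
  "induced_subgraph K G \<longleftrightarrow> subgraph K G \<and> edges K = {e \<in> edges G. e \<subseteq> verts K}"

definition graph_iso :: "'a graph \<Rightarrow> 'b graph \<Rightarrow> bool" where
  "graph_iso K H \<longleftrightarrow> (\<exists>f. bij_betw f (verts K) (verts H) \<and> edges H = (\<lambda>e. f ` e) ` edges K)"

definition H_subgraph :: "'a graph \<Rightarrow> 'b graph \<Rightarrow> 'b graph \<Rightarrow> bool" where
  "H_subgraph H G K \<longleftrightarrow> subgraph K G \<and> graph_iso K H"

definition induced_H_subgraph :: "'a graph \<Rightarrow> 'b graph \<Rightarrow> 'b graph \<Rightarrow> bool" where
  "induced_H_subgraph H G K \<longleftrightarrow> induced_subgraph K G \<and> graph_iso K H"

definition weight :: "('a \<Rightarrow> real) \<Rightarrow> 'a graph \<Rightarrow> real" where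
  "weight w K = (\<Sum>v\<in>verts K. w v)"

definition heaviest :: "('a \<Rightarrow> real) \<Rightarrow> ('a graph \<Rightarrow> bool) \<Rightarrow> 'a graph \<Rightarrow> bool" where
  "heaviest w P K \<longleftrightarrow> P K \<and> (\<forall>K'. P K' \<longrightarrow> weight w K' \<le> weight w K)"

section \<open>A word RAM with a separate memory for algebraic values\<close>

text \<open>
  The machine has two memories, each consisting of zero-initialised arrays. The arrays are named by
  natural numbers that are fixed in the program; only the index into an array is computed, so a
  program uses a fixed number of arrays. The word memory holds natural numbers and serves for
  indexing, control and combinatorial data. The value memory holds elements of an ordered ring,
  that is, the real weights or the matrix entries. Values are never converted to words: they can
  influence the control flow only through comparisons.

  Every operation, memory access and test costs one step. An execution is parametrised by a bound
  \<open>B\<close> and exists only as long as all words that occur, including all addresses and intermediate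
  results, are at most \<open>B\<close>. The bound will be polynomial in the input parameter \<open>n\<close>, that
  is, words have \<open>O(log n)\<close> bits.
\<close>

datatype wop = Add | Sub | Mul | Div | Mod

datatype wexp = Const nat | Cell nat wexp | Op wop wexp wexp

datatype vexp = VNum int | VCell nat wexp | VAdd vexp vexp | VSub vexp vexp | VMul vexp vexp

datatype test = WLess wexp wexp | VLess vexp vexp

datatype com =
    SetW nat wexp wexp
  | SetV nat wexp vexp
  | Seq com com
  | Cond test com com
  | While test com

type_synonym words = "nat \<Rightarrow> nat \<Rightarrow> nat"
type_synonym 'v vals = "nat \<Rightarrow> nat \<Rightarrow> 'v"
type_synonym 'v state = "words \<times> 'v vals"

text \<open>Subtraction of words is truncated, and division by zero yields zero.\<close>

primrec wop_val :: "wop \<Rightarrow> nat \<Rightarrow> nat \<Rightarrow> nat" where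
  "wop_val Add x y = x + y"
| "wop_val Sub x y = x - y"
| "wop_val Mul x y = x * y"
| "wop_val Div x y = x div y"
| "wop_val Mod x y = x mod y"

primrec wval :: "words \<Rightarrow> wexp \<Rightarrow> nat" where
  "wval W (Const k) = k"
| "wval W (Cell a e) = W a (wval W e)"
| "wval W (Op f d e) = wop_val f (wval W d) (wval W e)"

primrec wfits :: "nat \<Rightarrow> words \<Rightarrow> wexp \<Rightarrow> bool" where
  "wfits B W (Const k) \<longleftrightarrow> k \<le> B"
| "wfits B W (Cell a e) \<longleftrightarrow> wfits B W e \<and> W a (wval W e) \<le> B"
| "wfits B W (Op f d e) \<longleftrightarrow> wfits B W d \<and> wfits B W e \<and> wop_val f (wval W d) (wval W e) \<le> B"

primrec wcost :: "wexp \<Rightarrow> nat" where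
  "wcost (Const k) = 1"
| "wcost (Cell a e) = 1 + wcost e"
| "wcost (Op f d e) = 1 + wcost d + wcost e"

primrec vval :: "'v::linordered_idom state \<Rightarrow> vexp \<Rightarrow> 'v" where
  "vval s (VNum k) = of_int k"
| "vval s (VCell a e) = snd s a (wval (fst s) e)"
| "vval s (VAdd d e) = vval s d + vval s e"
| "vval s (VSub d e) = vval s d - vval s e"
| "vval s (VMul d e) = vval s d * vval s e"

primrec vfits :: "nat \<Rightarrow> words \<Rightarrow> vexp \<Rightarrow> bool" where
  "vfits B W (VNum k) \<longleftrightarrow> True"
| "vfits B W (VCell a e) \<longleftrightarrow> wfits B W e"
| "vfits B W (VAdd d e) \<longleftrightarrow> vfits B W d \<and> vfits B W e"
| "vfits B W (VSub d e) \<longleftrightarrow> vfits B W d \<and> vfits B W e"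
| "vfits B W (VMul d e) \<longleftrightarrow> vfits B W d \<and> vfits B W e"

primrec vcost :: "vexp \<Rightarrow> nat" where
  "vcost (VNum k) = 1"
| "vcost (VCell a e) = 1 + wcost e"
| "vcost (VAdd d e) = 1 + vcost d + vcost e"
| "vcost (VSub d e) = 1 + vcost d + vcost e"
| "vcost (VMul d e) = 1 + vcost d + vcost e"

primrec test_val :: "'v::linordered_idom state \<Rightarrow> test \<Rightarrow> bool" where
  "test_val s (WLess d e) \<longleftrightarrow> wval (fst s) d < wval (fst s) e"
| "test_val s (VLess d e) \<longleftrightarrow> vval s d < vval s e"

primrec test_fits :: "nat \<Rightarrow> words \<Rightarrow> test \<Rightarrow> bool" where
  "test_fits B W (WLess d e) \<longleftrightarrow> wfits B W d \<and> wfits B W e"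
| "test_fits B W (VLess d e) \<longleftrightarrow> vfits B W d \<and> vfits B W e"

primrec test_cost :: "test \<Rightarrow> nat" where
  "test_cost (WLess d e) = 1 + wcost d + wcost e"
| "test_cost (VLess d e) = 1 + vcost d + vcost e"

text \<open>
  \<open>exec B p s k s'\<close>: with word bound \<open>B\<close>, the program \<open>p\<close> started in \<open>s\<close> halts in \<open>s'\<close> after
  exactly \<open>k\<close> steps. The relation is deterministic.
\<close>

inductive exec ::
  "nat \<Rightarrow> com \<Rightarrow> 'v::linordered_idom state \<Rightarrow> nat \<Rightarrow> 'v state \<Rightarrow> bool" for B :: nat where
  SetW: "wfits B W d \<Longrightarrow> wfits B W e \<Longrightarrow>
    exec B (SetW a d e) (W, X) (1 + wcost d + wcost e)
      (W(a := (W a)(wval W d := wval W e)), X)"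
| SetV: "wfits B W d \<Longrightarrow> vfits B W e \<Longrightarrow>
    exec B (SetV a d e) (W, X) (1 + wcost d + vcost e)
      (W, X(a := (X a)(wval W d := vval (W, X) e)))"
| Seq: "exec B p s k s' \<Longrightarrow> exec B q s' l s'' \<Longrightarrow> exec B (Seq p q) s (k + l) s''"
| IfTrue: "test_fits B (fst s) b \<Longrightarrow> test_val s b \<Longrightarrow> exec B p s k s' \<Longrightarrow>
    exec B (Cond b p q) s (test_cost b + k) s'"
| IfFalse: "test_fits B (fst s) b \<Longrightarrow> \<not> test_val s b \<Longrightarrow> exec B q s k s' \<Longrightarrow>
    exec B (Cond b p q) s (test_cost b + k) s'"
| WhileFalse: "test_fits B (fst s) b \<Longrightarrow> \<not> test_val s b \<Longrightarrow>
    exec B (While b p) s (test_cost b) s"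
| WhileTrue: "test_fits B (fst s) b \<Longrightarrow> test_val s b \<Longrightarrow> exec B p s k s' \<Longrightarrow>
    exec B (While b p) s' l s'' \<Longrightarrow> exec B (While b p) s (test_cost b + k + l) s''"

subsection \<open>Two restricted models\<close>

text \<open>
  In the addition-comparison model, values may only be moved, added and compared. In the arithmetic
  model, they may be added, subtracted and multiplied but not tested, so for each \<open>n\<close> a program is
  a straight-line computation over the ring.
\<close>

primrec additive :: "vexp \<Rightarrow> bool" where
  "additive (VNum k) \<longleftrightarrow> False"
| "additive (VCell a e) \<longleftrightarrow> True"
| "additive (VAdd d e) \<longleftrightarrow> additive d \<and> additive e"
| "additive (VSub d e) \<longleftrightarrow> False"
| "additive (VMul d e) \<longleftrightarrow> False"

primrec additive_test :: "test \<Rightarrow> bool" where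
  "additive_test (WLess d e) \<longleftrightarrow> True"
| "additive_test (VLess d e) \<longleftrightarrow> additive d \<and> additive e"

primrec addition_comparison :: "com \<Rightarrow> bool" where
  "addition_comparison (SetW a d e) \<longleftrightarrow> True"
| "addition_comparison (SetV a d e) \<longleftrightarrow> additive e"
| "addition_comparison (Seq p q) \<longleftrightarrow> addition_comparison p \<and> addition_comparison q"
| "addition_comparison (Cond b p q) \<longleftrightarrow>
     additive_test b \<and> addition_comparison p \<and> addition_comparison q"
| "addition_comparison (While b p) \<longleftrightarrow> additive_test b \<and> addition_comparison p"

primrec word_test :: "test \<Rightarrow> bool" where
  "word_test (WLess d e) \<longleftrightarrow> True"
| "word_test (VLess d e) \<longleftrightarrow> False"

primrec arithmetic :: "com \<Rightarrow> bool" where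
  "arithmetic (SetW a d e) \<longleftrightarrow> True"
| "arithmetic (SetV a d e) \<longleftrightarrow> True"
| "arithmetic (Seq p q) \<longleftrightarrow> arithmetic p \<and> arithmetic q"
| "arithmetic (Cond b p q) \<longleftrightarrow> word_test b \<and> arithmetic p \<and> arithmetic q"
| "arithmetic (While b p) \<longleftrightarrow> word_test b \<and> arithmetic p"

text \<open>The largest word on an input with parameter \<open>n\<close>: words have \<open>c log (n + 2)\<close> bits.\<close>

definition word_bound :: "nat \<Rightarrow> nat \<Rightarrow> nat" where
  "word_bound c n = (n + 2) ^ c"

section \<open>The exponent of matrix multiplication\<close>

text \<open>
  The number \<open>n\<close> is in cell 0 of word array 0, and the two matrices are stored row by row in the
  value arrays 0 and 1. The product is returned in value array 2.
\<close>

definition matrix_input :: "nat \<Rightarrow> (nat \<Rightarrow> nat \<Rightarrow> int) \<Rightarrow> (nat \<Rightarrow> nat \<Rightarrow> int) \<Rightarrow> int state" where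
  "matrix_input n M N =
    ((\<lambda>a i. if a = 0 \<and> i = 0 then n else 0),
     (\<lambda>a i. if i < n * n
            then (if a = 0 then M (i div n) (i mod n)
                  else if a = 1 then N (i div n) (i mod n) else 0)
            else 0))"

text \<open>
  Two \<open>n \<times> n\<close> matrices can be multiplied in \<open>O(n^\<omega>)\<close> arithmetic operations. Since the entries are
  not tested, correctness over the integers is a family of identities between integer polynomials;
  such a program multiplies matrices over every commutative ring. The bound covers the index
  computations of the (uniform) program as well.
\<close>

definition matmul_in_time :: "real \<Rightarrow> bool" where
  "matmul_in_time \<omega> \<longleftrightarrow>
    (\<exists>p c T. arithmetic p \<and> (\<lambda>n. real (T n)) \<in> O(\<lambda>n. real n powr \<omega>) \<and>
      (\<forall>n M N. \<exists>k W X.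
        exec (word_bound c n) p (matrix_input n M N) k (W, X) \<and> k \<le> T n \<and>
        (\<forall>i<n. \<forall>j<n. X 2 (i * n + j) = (\<Sum>l<n. M i l * N l j))))"

section \<open>Graph problems\<close>

text \<open>
  A graph on \<open>{0, \<dots>, n - 1}\<close> is given by \<open>n\<close> in cell 0 of word array 0, its adjacency matrix in
  word array 1, and the vertex weights in value array 0.
\<close>

definition graph_input :: "nat \<Rightarrow> nat graph \<Rightarrow> (nat \<Rightarrow> real) \<Rightarrow> real state" where
  "graph_input n G w =
    ((\<lambda>a i. if a = 0 \<and> i = 0 then n
            else if a = 1 \<and> i < n * n \<and> {i div n, i mod n} \<in> edges G then 1 else 0),
     (\<lambda>a i. if a = 0 \<and> i < n then w i else 0))"

text \<open>
  \<open>spec n G w W\<close> says that the final word memory \<open>W\<close> is a correct answer on \<open>(G, w)\<close>.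
\<close>

definition graph_problem_in_time ::
  "(nat \<Rightarrow> nat graph \<Rightarrow> (nat \<Rightarrow> real) \<Rightarrow> words \<Rightarrow> bool) \<Rightarrow> real \<Rightarrow> bool" where
  "graph_problem_in_time spec \<tau> \<longleftrightarrow>
    (\<exists>p c T. addition_comparison p \<and> (\<lambda>n. real (T n)) \<in> O(\<lambda>n. real n powr \<tau>) \<and>
      (\<forall>n G w. simple_graph G \<and> verts G = {..<n} \<longrightarrow>
        (\<exists>k W X. exec (word_bound c n) p (graph_input n G w) k (W, X) \<and> k \<le> T n \<and>
           spec n G w W)))"

text \<open>
  The output may consist of several records. Cell \<open>r\<close> of word array 2 tells whether record \<open>r\<close>
  contains a graph. If so, its \<open>h\<close> vertices are listed in array 3 and its adjacency matrix with
  respect to this list is in array 4.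
\<close>

definition out_graph :: "nat \<Rightarrow> words \<Rightarrow> nat \<Rightarrow> nat graph" where
  "out_graph h W r =
    ((\<lambda>i. W 3 (r * h + i)) ` {..<h},
     {{W 3 (r * h + i), W 3 (r * h + j)} | i j. i < h \<and> j < h \<and> W 4 ((r * h + i) * h + j) = 1})"

definition reports_heaviest ::
  "nat \<Rightarrow> (nat \<Rightarrow> real) \<Rightarrow> (nat graph \<Rightarrow> bool) \<Rightarrow> words \<Rightarrow> nat \<Rightarrow> bool" where
  "reports_heaviest h w P W r \<longleftrightarrow>
    (if \<exists>K. P K then W 2 r = 1 \<and> heaviest w P (out_graph h W r) else W 2 r = 0)"

definition all_pairs_max_induced ::
  "'a graph \<Rightarrow> nat \<Rightarrow> nat graph \<Rightarrow> (nat \<Rightarrow> real) \<Rightarrow> words \<Rightarrow> bool" where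
  "all_pairs_max_induced H n G w W \<longleftrightarrow>
    (\<forall>u<n. \<forall>v<n.
      reports_heaviest (card (verts H)) w
        (\<lambda>K. induced_H_subgraph H G K \<and> u \<in> verts K \<and> v \<in> verts K) W (u * n + v))"

definition max_H_subgraph ::
  "'a graph \<Rightarrow> nat \<Rightarrow> nat graph \<Rightarrow> (nat \<Rightarrow> real) \<Rightarrow> words \<Rightarrow> bool" where
  "max_H_subgraph H n G w W \<longleftrightarrow>
    reports_heaviest (card (verts H)) w (H_subgraph H G) W 0"

definition max_induced_H_subgraph ::
  "'a graph \<Rightarrow> nat \<Rightarrow> nat graph \<Rightarrow> (nat \<Rightarrow> real) \<Rightarrow> words \<Rightarrow> bool" where
  "max_induced_H_subgraph H n G w W \<longleftrightarrow>
    reports_heaviest (card (verts H)) w (induced_H_subgraph H G) W 0"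

section \<open>The exponent of the running time\<close>

text \<open>Integer division rounds towards minus infinity, so this is the floor of \<open>(h - b) / 2\<close>.\<close>

definition half_rest :: "nat \<Rightarrow> int \<Rightarrow> int" where
  "half_rest h b = (int h - b) div 2"

text \<open>For \<open>\<omega> < 4\<close>, the set in the definition of \<open>b1\<close> is finite and contains 0.\<close>

definition b1 :: "real \<Rightarrow> nat \<Rightarrow> nat" where
  "b1 \<omega> h = Max {b. real b / (4 - \<omega>) \<le> real_of_int (half_rest h (int b))}"

definition s1 :: "real \<Rightarrow> nat \<Rightarrow> real" where
  "s1 \<omega> h = real h - real (b1 \<omega> h) + real (b1 \<omega> h) / (4 - \<omega>)"

definition s2_at :: "real \<Rightarrow> nat \<Rightarrow> int \<Rightarrow> real" where
  "s2_at \<omega> h b =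
    max (real h - real_of_int b + real_of_int (half_rest h b))
        (real h - (3 - \<omega>) * real_of_int (half_rest h b))"

definition s2 :: "real \<Rightarrow> nat \<Rightarrow> real" where
  "s2 \<omega> h = Min {s2_at \<omega> h b | b. half_rest h b \<le> b \<and> b \<le> int h - 2}"

definition t_exponent :: "real \<Rightarrow> nat \<Rightarrow> real" where
  "t_exponent \<omega> h = min (s1 \<omega> h) (s2 \<omega> h)"

end

theory Submission
  imports Defs "HOL-Library.Nat_Bijection"
begin

text \<open>
  The roles \<open>0, \<dots>, h - 1\<close> of a labelled copy of \<open>H\<close> are split into three groups of
  sizes \<open>a \<le> c\<close> and \<open>b\<close>. Assigning vertices to the first two groups gives the rows and columns of a
  Boolean matrix product whose summation index runs through the assignments of the third group; an
  entry is nonzero iff the two partial assignments, if they are compatible with each other, extend to a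
  copy of \<open>H\<close>. With the third group sorted by weight and cut into blocks of size \<open>D\<close>, the last block
  with a nonzero product contains a heaviest extension. Computing all products in \<open>D \<times> D\<close> tiles takes
  \<open>n^h * D powr (\<omega> - 3)\<close> steps and scanning one block per pair takes \<open>n^(h - b) * D\<close> steps. Running over
  all labellings of \<open>H\<close> puts any prescribed pair of vertices into the roles 0 and 1, which are never in
  the third group.

  As \<open>\<omega>\<close> need not be computable, the program cannot compute the optimal \<open>D = n powr \<beta>\<close>. Instead, it
  doubles \<open>D\<close> until the number of steps of the matrix program on \<open>D \<times> D\<close> matrices, which it counts
  while simulating it, shows that the two costs are balanced, or until \<open>D\<close> would exceed \<open>n^a\<close>.

  The given matrix program works on values that the addition-comparison model cannot multiply. Since
  it never tests values, it can be simulated on words modulo \<open>D + 1\<close>, a modulus which exceeds every entry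
  of a product of 0-1-matrices.
\<close>

section \<open>Costs and word sizes\<close>

text \<open>The two costs are equal, up to constants, at
  \<open>D = n powr (b / (4 - \<omega>))\<close>, which gives \<open>s1\<close>; if the cap
  \<open>n ^ a\<close> is reached first, the exponent is the one in \<open>s2\<close>. Doubling
  misses the ideal \<open>D\<close> by a constant factor only, so \<omega> enters the analysis but
  not the program. One measurement is valid for all products of the same size because an arithmetic
  program takes the same path whatever the values are; \<open>simulated\<close> therefore fixes one
  step count for all initial values. Conversely, a counted step changes at most one value cell while
  \<open>D * D\<close> outputs must be produced, so \<open>D * D \<le> j D\<close>. This absorbs the
  cost of filling in the matrices and forces \<omega> \<ge> 2. The products test only the pairs of
  roles that involve the third group. Whether the first two groups fit together does not depend on
  the third, so the scan alone checks it. A copy of \<open>H\<close> need not be submitted itself,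
  as long as some submitted candidate for the same record is at least as heavy. The records are
  therefore specified by a ghost set of submitted candidates, which grows from stage to
  stage.\<close>

text \<open>
  A simplified semantics for programs that never write values: every command and test costs one step,
  and only the stored words are bounded. Since the words that occur in an expression are at most a fixed
  power of the stored ones, \<open>run_exec\<close> recovers the machine semantics up to constants.
\<close>

inductive run :: "nat \<Rightarrow> real vals \<Rightarrow> com \<Rightarrow> words \<Rightarrow> nat \<Rightarrow> words \<Rightarrow> bool"
  for M :: nat and X :: "real vals" where
  SetW: "wval W e \<le> M \<Longrightarrow> run M X (SetW a d e) W 1 (W(a := (W a)(wval W d := wval W e)))"
| Seq: "run M X p W k W' \<Longrightarrow> run M X q W' l W'' \<Longrightarrow> run M X (Seq p q) W (k + l) W''"
| IfTrue: "test_val (W, X) b \<Longrightarrow> run M X p W k W' \<Longrightarrow> run M X (Cond b p q) W (1 + k) W'"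
| IfFalse: "\<not> test_val (W, X) b \<Longrightarrow> run M X q W k W' \<Longrightarrow> run M X (Cond b p q) W (1 + k) W'"
| WhileFalse: "\<not> test_val (W, X) b \<Longrightarrow> run M X (While b p) W 1 W"
| WhileTrue: "test_val (W, X) b \<Longrightarrow> run M X p W k W' \<Longrightarrow> run M X (While b p) W' l W'' \<Longrightarrow>
    run M X (While b p) W (1 + k + l) W''"

text \<open>The exponent in the bound \<open>M ^ wsize e\<close> on the value of \<open>e\<close>. A
  constant \<open>k\<close> counts with its value because \<open>k \<le> 2 ^ k\<close> is the bound
  available for every \<open>M \<ge> 2\<close>.\<close>

primrec wsize :: "wexp \<Rightarrow> nat" where
  "wsize (Const k) = 1 + k"
| "wsize (Cell a e) = 1 + wsize e"
| "wsize (Op f d e) = 1 + wsize d + wsize e"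

primrec vsize :: "vexp \<Rightarrow> nat" where
  "vsize (VNum k) = 1"
| "vsize (VCell a e) = 1 + wsize e"
| "vsize (VAdd d e) = 1 + vsize d + vsize e"
| "vsize (VSub d e) = 1 + vsize d + vsize e"
| "vsize (VMul d e) = 1 + vsize d + vsize e"

primrec tsize :: "test \<Rightarrow> nat" where
  "tsize (WLess d e) = 1 + wsize d + wsize e"
| "tsize (VLess d e) = 1 + vsize d + vsize e"

primrec csize :: "com \<Rightarrow> nat" where
  "csize (SetW a d e) = 1 + wsize d + wsize e"
| "csize (SetV a d e) = 1 + wsize d + vsize e"
| "csize (Seq p q) = csize p + csize q"
| "csize (Cond b p q) = tsize b + csize p + csize q"
| "csize (While b p) = tsize b + csize p"

lemma wval_le_power:
  assumes "\<And>a i. W a i \<le> M" and M: "2 \<le> M"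
  shows "wval W e \<le> M ^ wsize e"
proof (induction e)
  case (Const k)
  have "k \<le> 2 ^ k" by (simp add: less_imp_le)
  also have "\<dots> \<le> M ^ k" using M by (rule power_mono) simp
  also have "\<dots> \<le> M * M ^ k" using M by simp
  finally show ?case by simp
next
  case (Cell a e)
  have "W a (wval W e) \<le> M" by (rule assms)
  also have "\<dots> \<le> M * M ^ wsize e" using M by simp
  finally show ?case by simp
next
  case (Op f d e)
  let ?x = "M ^ wsize d" and ?y = "M ^ wsize e"
  have 1: "1 \<le> ?x" "1 \<le> ?y" using M by simp_all
  \<comment> \<open>Addition is the operation that needs the extra factor \<open>M\<close>: it turns
    a sum into a product at the price of a factor 2.\<close>
  have "?x + ?y \<le> 2 * (?x * ?y)" using 1
    by (metis add_mono mult_2 mult.right_neutral mult_le_mono mult_1 le_refl)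
  also have "\<dots> \<le> M * (?x * ?y)" using M by simp
  finally have add: "?x + ?y \<le> M * (?x * ?y)" .
  have "?x * ?y \<le> M * (?x * ?y)" using M by simp
  hence mult: "wval W d * wval W e \<le> M * (?x * ?y)" using mult_le_mono[OF Op] by linarith
  have left: "wval W d \<le> M * (?x * ?y)" using Op(1) add by linarith
  show ?case
    using add mult left Op
    by (cases f) (auto simp: power_add mult.assoc intro: order_trans[OF div_le_dividend]
      order_trans[OF mod_less_eq_dividend])
qed

lemma wfits_power:
  assumes W: "\<And>a i. W a i \<le> M" and M: "2 \<le> M"
  shows "wsize e \<le> S \<Longrightarrow> wfits (M ^ S) W e"
proof (induction e)
  case (Const k)
  show ?case using wval_le_power[of W M "Const k", OF assms] power_increasing[OF Const, of M] M
    by simp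
next
  case (Cell a e)
  have "M ^ 1 \<le> M ^ S" using Cell.prems M by (intro power_increasing) auto
  thus ?case using Cell W[of a "wval W e"] by auto
next
  case (Op f d e)
  have "wval W (Op f d e) \<le> M ^ S"
    using wval_le_power[of W M "Op f d e", OF assms] power_increasing[OF Op.prems, of M] M by linarith
  thus ?case using Op by auto
qed

lemma vfits_power:
  assumes W: "\<And>a i. W a i \<le> M" and M: "2 \<le> M"
  shows "vsize e \<le> S \<Longrightarrow> vfits (M ^ S) W e"
  by (induction e) (auto intro!: wfits_power[OF assms])

lemma test_fits_power:
  assumes W: "\<And>a i. W a i \<le> M" and M: "2 \<le> M"
  shows "tsize b \<le> S \<Longrightarrow> test_fits (M ^ S) W b"
  by (cases b) (auto intro!: wfits_power[OF assms] vfits_power[OF assms])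

lemma wcost_le: "wcost e \<le> wsize e" by (induction e) auto
lemma vcost_le: "vcost e \<le> vsize e" by (induction e) (auto simp: wcost_le)
lemma test_cost_le: "test_cost b \<le> tsize b"
  by (cases b) (auto intro!: add_mono simp: wcost_le vcost_le)

lemma run_bounded:
  assumes "run M X p W k W'" and "\<And>a i. W a i \<le> M"
  shows "W' a i \<le> M"
  using assms by (induction arbitrary: a i) auto

text \<open>\<open>S\<close> dominates the size of every expression in \<open>p\<close>. It
  therefore serves twice: as the exponent that bounds intermediate words and as the machine cost of
  a single step of \<open>run\<close>.\<close>

lemma run_exec:
  assumes "run M X p W k W'" and "\<And>a i. W a i \<le> M" and M: "2 \<le> M" and "csize p \<le> S"
  shows "\<exists>k'\<le>S * k. exec (M ^ S) p (W, X) k' (W', X)"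
  using assms(1,2,4)
proof induction
  case (SetW W e a d)
  show ?case
    using exec.SetW[OF wfits_power[of W M, OF SetW(2) M] wfits_power[of W M, OF SetW(2) M], of d S e a X]
      wcost_le[of d] wcost_le[of e] SetW(3)
    by (intro exI[of _ "1 + wcost d + wcost e"]) (auto simp: fun_upd_def)
next
  case (Seq p W k W' q l W'')
  obtain k' where k': "k' \<le> S * k" "exec (M ^ S) p (W, X) k' (W', X)" using Seq by auto
  have "\<And>a i. W' a i \<le> M" using run_bounded[OF Seq(1)] Seq.prems by blast
  then obtain l' where l': "l' \<le> S * l" "exec (M ^ S) q (W', X) l' (W'', X)" using Seq by auto
  show ?case using exec.Seq[OF k'(2) l'(2)] k'(1) l'(1)
    by (intro exI[of _ "k' + l'"]) (auto simp: distrib_left)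
next
  case (IfTrue W b p k W' q)
  obtain k' where k': "k' \<le> S * k" "exec (M ^ S) p (W, X) k' (W', X)" using IfTrue by auto
  have "test_fits (M ^ S) W b" using test_fits_power[OF IfTrue.prems(1) M] IfTrue.prems by auto
  then show ?case using exec.IfTrue[of "M ^ S" "(W, X)" b p k' "(W', X)" q] k' IfTrue
      test_cost_le[of b] by (intro exI[of _ "test_cost b + k'"]) auto
next
  case (IfFalse W b q k W' p)
  obtain k' where k': "k' \<le> S * k" "exec (M ^ S) q (W, X) k' (W', X)" using IfFalse by auto
  have "test_fits (M ^ S) W b" using test_fits_power[OF IfFalse.prems(1) M] IfFalse.prems by auto
  then show ?case using exec.IfFalse[of "M ^ S" "(W, X)" b q k' "(W', X)" p] k' IfFalse
      test_cost_le[of b] by (intro exI[of _ "test_cost b + k'"]) auto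
next
  case (WhileFalse W b p)
  have "test_fits (M ^ S) W b" using test_fits_power[OF WhileFalse.prems(1) M] WhileFalse.prems by auto
  then show ?case using exec.WhileFalse[of "M ^ S" "(W, X)" b p] WhileFalse
      test_cost_le[of b] by (intro exI[of _ "test_cost b"]) auto
next
  case (WhileTrue W b p k W' l W'')
  obtain k' where k': "k' \<le> S * k" "exec (M ^ S) p (W, X) k' (W', X)" using WhileTrue by auto
  have "\<And>a i. W' a i \<le> M" using run_bounded[OF WhileTrue(2)] WhileTrue.prems by blast
  then obtain l' where l': "l' \<le> S * l" "exec (M ^ S) (While b p) (W', X) l' (W'', X)"
    using WhileTrue by auto
  have "test_fits (M ^ S) W b" using test_fits_power[OF WhileTrue.prems(1) M] WhileTrue.prems by auto
  then show ?case using exec.WhileTrue[of "M ^ S" "(W, X)" b p k' "(W', X)" l' "(W'', X)"] k' l' WhileTrue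
      test_cost_le[of b] by (intro exI[of _ "test_cost b + k' + l'"]) (auto simp: distrib_left)
qed

section \<open>Total correctness with a time budget\<close>

definition tc :: "nat \<Rightarrow> real vals \<Rightarrow> com \<Rightarrow> words \<Rightarrow> nat \<Rightarrow> (words \<Rightarrow> bool) \<Rightarrow> bool" where
  "tc M X p W T Q \<longleftrightarrow> (\<exists>k W'. run M X p W k W' \<and> k \<le> T \<and> Q W')"

lemma tc_SetW:
  "wval W e \<le> M \<Longrightarrow> 1 \<le> T \<Longrightarrow> Q (W(a := (W a)(wval W d := wval W e))) \<Longrightarrow> tc M X (SetW a d e) W T Q"
  unfolding tc_def using run.SetW by blast

lemma tc_Seq:
  assumes "tc M X p W T1 R" and "\<And>W'. R W' \<Longrightarrow> tc M X q W' T2 Q" and "T1 + T2 \<le> T"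
  shows "tc M X (Seq p q) W T Q"
proof -
  obtain k W' where 1: "run M X p W k W'" "k \<le> T1" "R W'" using assms(1) unfolding tc_def by blast
  obtain l W'' where 2: "run M X q W' l W''" "l \<le> T2" "Q W''"
    using assms(2)[OF 1(3)] unfolding tc_def by blast
  show ?thesis unfolding tc_def using run.Seq[OF 1(1) 2(1)] 1 2 assms(3)
    by (intro exI[of _ "k + l"] exI[of _ W'']) auto
qed

lemma tc_Seq_SetW:
  assumes "wval W e \<le> M" "tc M X q (W(a := (W a)(wval W d := wval W e))) T Q" "T + 1 \<le> T'"
  shows "tc M X (Seq (SetW a d e) q) W T' Q"
  by (rule tc_Seq[of _ _ _ _ 1 "\<lambda>W'. W' = W(a := (W a)(wval W d := wval W e))" _ T])
    (use assms in \<open>auto intro: tc_SetW\<close>)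

lemma tc_Cond:
  assumes "test_val (W, X) b \<Longrightarrow> tc M X p W T Q" and "\<not> test_val (W, X) b \<Longrightarrow> tc M X q W T Q"
    and "T + 1 \<le> T'"
  shows "tc M X (Cond b p q) W T' Q"
proof (cases "test_val (W, X) b")
  case True
  then obtain k W' where 1: "run M X p W k W'" "k \<le> T" "Q W'" using assms(1) unfolding tc_def by blast
  show ?thesis unfolding tc_def using run.IfTrue[OF True 1(1)] 1 assms(3)
    by (intro exI[of _ "1 + k"] exI[of _ W']) auto
next
  case False
  then obtain k W' where 1: "run M X q W k W'" "k \<le> T" "Q W'" using assms(2) unfolding tc_def by blast
  show ?thesis unfolding tc_def using run.IfFalse[OF False 1(1)] 1 assms(3)
    by (intro exI[of _ "1 + k"] exI[of _ W']) auto
qed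

lemma tc_mono:
  "tc M X p W T Q \<Longrightarrow> T \<le> T' \<Longrightarrow> (\<And>W'. Q W' \<Longrightarrow> Q' W') \<Longrightarrow> tc M X p W T' Q'"
  unfolding tc_def by (meson order_trans)

text \<open>The number \<open>m\<close> of rounds is known beforehand and the invariant is indexed
  by the round, so termination and cost both come from a backward induction from
  \<open>m\<close>.\<close>

lemma tc_While:
  assumes I0: "I 0 W"
    and test: "\<And>i W'. i \<le> m \<Longrightarrow> I i W' \<Longrightarrow> test_val (W', X) b \<longleftrightarrow> i < m"
    and body: "\<And>i W'. i < m \<Longrightarrow> I i W' \<Longrightarrow> tc M X p W' (t i) (I (Suc i))"
  shows "tc M X (While b p) W (1 + (\<Sum>i<m. 1 + t i)) (I m)"
proof -
  have "tc M X (While b p) W' (1 + (\<Sum>i=j..<m. 1 + t i)) (I m)" if "j \<le> m" "I j W'" for j W'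
    using that
  proof (induction arbitrary: W' rule: inc_induct)
    case base
    then have "run M X (While b p) W' 1 W'" using test[of m W'] by (intro run.WhileFalse) auto
    then show ?case unfolding tc_def using base
      by (intro exI[of _ 1] exI[of _ W']) auto
  next
    case (step j)
    obtain k W1 where 1: "run M X p W' k W1" "k \<le> t j" "I (Suc j) W1"
      using body[of j W'] step unfolding tc_def by blast
    obtain l W2 where 2: "run M X (While b p) W1 l W2" "l \<le> 1 + (\<Sum>i=Suc j..<m. 1 + t i)" "I m W2"
      using step.IH[OF 1(3)] unfolding tc_def by blast
    have "run M X (While b p) W' (1 + k + l) W2"
      using test[of j W'] step 1 2 by (intro run.WhileTrue) auto
    then show ?case unfolding tc_def using 1 2 step
      by (intro exI[of _ "1 + k + l"] exI[of _ W2]) (auto simp: sum.atLeast_Suc_lessThan)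
  qed
  from this[of 0 W] I0 show ?thesis by (simp add: atLeast0LessThan)
qed

abbreviation reg :: "nat \<Rightarrow> wexp" where "reg a \<equiv> Cell a (Const 0)"

definition For :: "nat \<Rightarrow> wexp \<Rightarrow> com \<Rightarrow> com" where
  "For v N p = Seq (SetW v (Const 0) (Const 0))
     (While (WLess (reg v) N) (Seq p (SetW v (Const 0) (Op Add (reg v) (Const 1)))))"

text \<open>What a loop body has to achieve: the invariant is demanded of the state that the counter
  increment appended by \<open>For\<close> is about to produce.\<close>

definition advance :: "(nat \<Rightarrow> words \<Rightarrow> bool) \<Rightarrow> nat \<Rightarrow> nat \<Rightarrow> words \<Rightarrow> bool" where
  "advance I v i W \<longleftrightarrow> W v 0 = i \<and> I (Suc i) (W(v := (W v)(0 := Suc i)))"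

lemma tc_For:
  assumes I0: "I 0 (W(v := (W v)(0 := 0)))"
    and N: "\<And>i W'. i \<le> m \<Longrightarrow> I i W' \<Longrightarrow> wval W' N = m" and mM: "m \<le> M"
    and body: "\<And>i W'. i < m \<Longrightarrow> I i W' \<Longrightarrow> W' v 0 = i \<Longrightarrow>
       tc M X p W' t (advance I v i)"
    and T: "m * (t + 2) + 2 \<le> T" and Q: "\<And>W'. I m W' \<Longrightarrow> W' v 0 = m \<Longrightarrow> Q W'"
  shows "tc M X (For v N p) W T Q"
  unfolding For_def
proof (rule tc_Seq_SetW)
  let ?b = "WLess (reg v) N" and ?p = "Seq p (SetW v (Const 0) (Op Add (reg v) (Const 1)))"
  have "tc M X (While ?b ?p) (W(v := (W v)(0 := 0))) (1 + (\<Sum>i<m. 1 + (t + 1)))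
    ((\<lambda>i W'. I i W' \<and> W' v 0 = i) m)"
  proof (rule tc_While)
    fix i W' assume i: "i < m" and I: "I i W' \<and> W' v 0 = i"
    show "tc M X ?p W' (t + 1) (\<lambda>W'. I (Suc i) W' \<and> W' v 0 = Suc i)"
      by (rule tc_Seq[OF body[of i W']]) (use i I mM in \<open>auto simp: advance_def intro!: tc_SetW\<close>)
  next
    show "I 0 (W(v := (W v)(0 := 0))) \<and> (W(v := (W v)(0 := 0))) v 0 = 0" using I0 by (simp del: fun_upd_apply) (simp)
  qed (use N in auto)
  from tc_mono[OF this, of "T - 1" Q] T Q
  show "tc M X (While ?b ?p) (W(v := (W v)(wval W (Const 0) := wval W (Const 0)))) (T - 1) Q"
    by (simp add: algebra_simps)
qed (use T in auto)

section \<open>Simulating a matrix program in the word memory\<close>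

text \<open>
  Word arrays: 0 and 1 hold the input and 2 to 4 the output; cell 0 of 5, 6, 7 and 8 holds the number \<open>\<rho>\<close>
  of the current simulation, its step counter, the block size \<open>D\<close> and the step count measured for \<open>D\<close>;
  9 to 12 are loop counters, 13 is the selected list of a merge, 14 the tuple under consideration and 15 a
  dummy. Families: \<open>fam 0\<close> and \<open>fam 1\<close> are the sorted lists of tuples and the heads used to merge them,
  \<open>fam 2\<close> and \<open>fam 3\<close> the simulated word and value arrays, \<open>fam 4 s\<close> the blocks found for the \<open>s\<close>-th
  labelling.
\<close>

definition fam :: "nat \<Rightarrow> nat \<Rightarrow> nat" where "fam k a = 20 + 5 * a + k"

lemma fam_eq [simp]: "k < 5 \<Longrightarrow> l < 5 \<Longrightarrow> fam k a = fam l b \<longleftrightarrow> k = l \<and> a = b"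
  unfolding fam_def by presburger

lemma fam_neq [simp]: "v < 20 \<Longrightarrow> fam k a \<noteq> v" "v < 20 \<Longrightarrow> v \<noteq> fam k a"
  by (auto simp: fam_def)

text \<open>
  Simulation \<open>\<rho>\<close> keeps cell \<open>i\<close> of an array at \<open>prod_encode (i, \<rho>)\<close>: every simulation starts on
  fresh, zero-initialised memory, and nothing has to be erased.
\<close>

definition enc :: "wexp \<Rightarrow> wexp" where
  "enc e = Op Add (Op Div (Op Mul (Op Add e (reg 5)) (Op Add (Op Add e (reg 5)) (Const 1))) (Const 2)) e"

lemma wval_enc [simp]: "wval W (enc e) = prod_encode (wval W e, W 5 0)"
  by (simp add: enc_def prod_encode_def triangle_def)

definition modulus :: wexp where "modulus = Op Add (reg 7) (Const 1)"

lemma wval_modulus [simp]: "wval W modulus = Suc (W 7 0)"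
  by (simp add: modulus_def)

primrec sim_w :: "wexp \<Rightarrow> wexp" where
  "sim_w (Const k) = Const k"
| "sim_w (Cell a e) = Cell (fam 2 a) (enc (sim_w e))"
| "sim_w (Op f d e) = Op f (sim_w d) (sim_w e)"

text \<open>All simulated values are reduced residues, so subtracting one from the modulus is never
  truncated. Negation is expressed in this way.\<close>

primrec sim_v :: "vexp \<Rightarrow> wexp" where
  "sim_v (VNum k) = (if 0 \<le> k then Op Mod (Const (nat k)) modulus
     else Op Mod (Op Sub modulus (Op Mod (Const (nat (- k))) modulus)) modulus)"
| "sim_v (VCell a e) = Cell (fam 3 a) (enc (sim_w e))"
| "sim_v (VAdd d e) = Op Mod (Op Add (sim_v d) (sim_v e)) modulus"
| "sim_v (VSub d e) = Op Mod (Op Add (sim_v d) (Op Sub modulus (sim_v e))) modulus"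
| "sim_v (VMul d e) = Op Mod (Op Mul (sim_v d) (sim_v e)) modulus"

primrec sim_t :: "test \<Rightarrow> test" where
  "sim_t (WLess d e) = WLess (sim_w d) (sim_w e)"
| "sim_t (VLess d e) = WLess (Const 0) (Const 0)"

definition tick :: com where "tick = SetW 6 (Const 0) (Op Add (reg 6) (Const 1))"

text \<open>One tick per assignment and per test: the tick before a loop and the one at the end of
  its body together count every evaluation of the loop test.\<close>

primrec sim :: "com \<Rightarrow> com" where
  "sim (SetW a d e) = Seq (SetW (fam 2 a) (enc (sim_w d)) (sim_w e)) tick"
| "sim (SetV a d e) = Seq (SetW (fam 3 a) (enc (sim_w d)) (sim_v e)) tick"
| "sim (Seq p q) = Seq (sim p) (sim q)"
| "sim (Cond b p q) = Seq tick (Cond (sim_t b) (sim p) (sim q))"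
| "sim (While b p) = Seq tick (While (sim_t b) (Seq (sim p) tick))"

lemma additive_sim_t: "additive_test (sim_t b)" by (cases b) auto

lemma addition_comparison_sim: "addition_comparison (sim p)"
  by (induction p) (auto simp: tick_def additive_sim_t)

definition region :: "nat \<Rightarrow> nat \<Rightarrow> nat \<Rightarrow> bool" where
  "region \<rho> a i \<longleftrightarrow> (\<exists>b. (a = fam 2 b \<or> a = fam 3 b)) \<and> snd (prod_decode i) = \<rho>"

definition rel :: "nat \<Rightarrow> nat \<Rightarrow> words \<Rightarrow> int vals \<Rightarrow> words \<Rightarrow> bool" where
  "rel m \<rho> V Y W \<longleftrightarrow> W 5 0 = \<rho> \<and> Suc (W 7 0) = m \<and>
     (\<forall>a i. W (fam 2 a) (prod_encode (i, \<rho>)) = V a i) \<and>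
     (\<forall>a i. int (W (fam 3 a) (prod_encode (i, \<rho>))) = Y a i mod int m)"

lemma sim_w: "rel m \<rho> V Y W \<Longrightarrow> wval W (sim_w e) = wval V e"
  by (induction e) (auto simp: rel_def)

lemma sim_v:
  assumes "rel m \<rho> V Y W" shows "int (wval W (sim_v e)) = vval (V, Y) e mod int m"
proof (induction e)
  case (VNum k)
  have m: "int m = 1 + int (W 7 0)" using assms by (auto simp: rel_def)
  show ?case
  proof (cases "0 \<le> k")
    case False
    let ?r = "nat (- k) mod Suc (W 7 0)"
    have "?r \<le> Suc (W 7 0)" by (simp add: less_imp_le)
    hence "int (Suc (W 7 0) - ?r) = int m - (- k) mod int m"
      using False by (simp add: of_nat_diff zmod_int m)
    hence "int ((Suc (W 7 0) - ?r) mod Suc (W 7 0)) = (int m - (- k) mod int m) mod int m"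
      by (simp only: zmod_int) (simp add: m)
    also have "\<dots> = k mod int m" by (simp add: mod_simps)
    finally show ?thesis using False by simp
  qed (use assms in \<open>auto simp: rel_def zmod_int m\<close>)
next
  case (VCell a e)
  then show ?case using assms sim_w[OF assms] by (simp add: rel_def)
next
  case (VAdd d e)
  have "int m = 1 + int (W 7 0)" using assms by (auto simp: rel_def)
  thus ?case using VAdd by (simp add: zmod_int mod_simps)
next
  case (VSub d e)
  have m: "int m = 1 + int (W 7 0)" using assms by (auto simp: rel_def)
  have "int (wval W (sim_v e)) \<le> int m" unfolding VSub using m by (simp add: less_imp_le)
  hence "int (Suc (W 7 0) - wval W (sim_v e)) = int m - vval (V, Y) e mod int m"
    using VSub m by (simp add: of_nat_diff)
  hence "int (wval W (sim_v (VSub d e)))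
      = (vval (V, Y) d mod int m + (int m - vval (V, Y) e mod int m)) mod int m"
    using VSub m by (simp only: sim_v.simps wval.simps wop_val.simps wval_modulus zmod_int of_nat_add) simp
  also have "\<dots> = (vval (V, Y) d mod int m - vval (V, Y) e mod int m + int m) mod int m"
    by (simp add: algebra_simps)
  also have "\<dots> = (vval (V, Y) d - vval (V, Y) e) mod int m"
    by (simp only: mod_add_self2) (simp add: mod_simps)
  finally show ?case by simp
next
  case (VMul d e)
  have "int m = 1 + int (W 7 0)" using assms by (auto simp: rel_def)
  thus ?case using VMul by (simp add: zmod_int mod_simps)
qed

lemma sim_t: "rel m \<rho> V Y W \<Longrightarrow> word_test b \<Longrightarrow> test_val (W, X) (sim_t b) \<longleftrightarrow> test_val (V, Y) b"
  by (cases b) (auto simp: sim_w)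

lemma rel_SetW:
  "rel m \<rho> V Y W \<Longrightarrow>
   rel m \<rho> (V(a := (V a)(i := v))) Y (W(fam 2 a := (W (fam 2 a))(prod_encode (i, \<rho>) := v)))"
  by (auto simp: rel_def)

lemma rel_SetV:
  "rel m \<rho> V Y W \<Longrightarrow> int x = y mod int m \<Longrightarrow>
   rel m \<rho> V (Y(a := (Y a)(i := y))) (W(fam 3 a := (W (fam 3 a))(prod_encode (i, \<rho>) := x)))"
  by (auto simp: rel_def)

lemma rel_tick: "rel m \<rho> V Y W \<Longrightarrow> rel m \<rho> V Y (W(6 := f))"
  by (auto simp: rel_def)

lemma tc_tick:
  "W 6 0 < M \<Longrightarrow> Q (W(6 := (W 6)(0 := W 6 0 + 1))) \<Longrightarrow> tc M X tick W 1 Q"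
  unfolding tick_def by (rule tc_SetW) auto

lemma tc_Seq_tick:
  "W 6 0 < M \<Longrightarrow> tc M X q (W(6 := (W 6)(0 := W 6 0 + 1))) T Q \<Longrightarrow> T + 1 \<le> T' \<Longrightarrow> tc M X (Seq tick q) W T' Q"
  unfolding tick_def by (rule tc_Seq_SetW) auto

definition sim_post :: "nat \<Rightarrow> nat \<Rightarrow> words \<Rightarrow> int vals \<Rightarrow> nat \<Rightarrow> words \<Rightarrow> words \<Rightarrow> bool" where
  "sim_post m \<rho> V Y j W W' \<longleftrightarrow> rel m \<rho> V Y W' \<and> W' 6 0 = W 6 0 + j \<and>
     (\<forall>a i. a \<noteq> 6 \<longrightarrow> \<not> region \<rho> a i \<longrightarrow> W' a i = W a i)"

lemma sim_post_trans:
  "sim_post m \<rho> V Y j W W' \<Longrightarrow> sim_post m \<rho> V' Y' l W' W'' \<Longrightarrow> sim_post m \<rho> V' Y' (j + l) W W''"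
  by (simp add: sim_post_def)

lemma sim_post_tick: "rel m \<rho> V Y W \<Longrightarrow> sim_post m \<rho> V Y 1 W (W(6 := (W 6)(0 := W 6 0 + 1)))"
  by (simp add: sim_post_def rel_tick)

text \<open>A tick comes with at most one further step, an assignment or a test. The third unit pays
  for the tick at the end of a loop body, which is charged both to this round and to the remaining
  loop when a loop is unrolled.\<close>

definition sim_run ::
  "com \<Rightarrow> nat \<Rightarrow> words \<Rightarrow> int vals \<Rightarrow> nat \<Rightarrow> words \<Rightarrow> int vals \<Rightarrow> bool" where
  "sim_run p B V Y j V' Y' \<longleftrightarrow>
    (\<forall>M X m \<rho> W. rel m \<rho> V Y W \<longrightarrow> B \<le> M \<longrightarrow> m \<le> M \<longrightarrow> W 6 0 + j \<le> M \<longrightarrow>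
       tc M X p W (3 * j) (sim_post m \<rho> V' Y' j W))"

lemma sim_runI:
  assumes "\<And>M X m \<rho> W. rel m \<rho> V Y W \<Longrightarrow> B \<le> M \<Longrightarrow> m \<le> M \<Longrightarrow> W 6 0 + j \<le> M \<Longrightarrow>
     tc M X p W (3 * j) (sim_post m \<rho> V' Y' j W)"
  shows "sim_run p B V Y j V' Y'"
  using assms unfolding sim_run_def by blast

lemma sim_runD:
  assumes "sim_run p B V Y j V' Y'" "rel m \<rho> V Y W" "B \<le> M" "m \<le> M" "W 6 0 + j \<le> M"
  shows "tc M X p W (3 * j) (sim_post m \<rho> V' Y' j W)"
  using assms unfolding sim_run_def by blast

lemma sim_run_Seq:
  assumes "sim_run p B V Y j V' Y'" "sim_run q B V' Y' l V'' Y''"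
  shows "sim_run (Seq p q) B V Y (j + l) V'' Y''"
proof (rule sim_runI)
  fix M X m \<rho> W assume *: "rel m \<rho> V Y W" "B \<le> M" "m \<le> M" "W 6 0 + (j + l) \<le> M"
  show "tc M X (Seq p q) W (3 * (j + l)) (sim_post m \<rho> V'' Y'' (j + l) W)"
  proof (rule tc_Seq[OF sim_runD[OF assms(1) *(1-3)]])
    fix W' assume W': "sim_post m \<rho> V' Y' j W W'"
    show "tc M X q W' (3 * l) (sim_post m \<rho> V'' Y'' (j + l) W)"
      by (rule tc_mono[OF sim_runD[OF assms(2), of m \<rho>]])
        (use * W' sim_post_trans[OF W'] in \<open>auto simp: sim_post_def\<close>)
  qed (use * in auto)
qed

lemma wfits_wval: "wfits B W e \<Longrightarrow> wval W e \<le> B" by (cases e) auto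

lemma sim_run_Cond:
  assumes "word_test b" "sim_run (sim (if test_val (V, Y) b then p else q)) B V Y j V' Y'"
  shows "sim_run (sim (Cond b p q)) B V Y (1 + j) V' Y'"
proof (rule sim_runI)
  fix M X m \<rho> W assume *: "rel m \<rho> V Y W" "B \<le> M" "m \<le> M" "W 6 0 + (1 + j) \<le> M"
  let ?W = "W(6 := (W 6)(0 := W 6 0 + 1))"
  have r: "rel m \<rho> V Y ?W" using *(1) by (rule rel_tick)
  have "tc M X (sim (if test_val (V, Y) b then p else q)) ?W (3 * j) (sim_post m \<rho> V' Y' (1 + j) W)"
    by (rule tc_mono[OF sim_runD[OF assms(2) r]])
      (use * sim_post_trans[OF sim_post_tick[OF *(1)]] in auto)
  with r assms(1) show "tc M X (sim (Cond b p q)) W (3 * (1 + j)) (sim_post m \<rho> V' Y' (1 + j) W)"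
    unfolding sim.simps using * by (intro tc_Seq_tick tc_Cond[where T = "3 * j"]) (auto simp: sim_t)
qed

text \<open>The postcondition of the body is the correctness of the remaining loop. This form suits
  loops whose number of rounds is known only from an execution.\<close>

lemma tc_While_unfold:
  assumes "test_val (W, X) b \<Longrightarrow> tc M X p W T1 (\<lambda>W'. tc M X (While b p) W' T2 Q)"
    and "\<not> test_val (W, X) b \<Longrightarrow> Q W" and "1 + (if test_val (W, X) b then T1 + T2 else 0) \<le> T"
  shows "tc M X (While b p) W T Q"
proof (cases "test_val (W, X) b")
  case True
  then obtain k W' l W'' where "run M X p W k W'" "k \<le> T1" "run M X (While b p) W' l W''" "l \<le> T2" "Q W''"
    using assms(1) unfolding tc_def by blast
  thus ?thesis using assms(3) True run.WhileTrue[of W X b M p k W' l W''] unfolding tc_def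
    by (intro exI[of _ "1 + k + l"] exI[of _ W'']) auto
next
  case False
  thus ?thesis using assms(2,3) run.WhileFalse[of W X b M p] unfolding tc_def
    by (intro exI[of _ "1"] exI[of _ W]) auto
qed

lemma sim_run_WhileTrue:
  assumes b: "word_test b" "test_val (V, Y) b"
    and p: "sim_run (sim p) B V Y j V' Y'" and w: "sim_run (sim (While b p)) B V' Y' l V'' Y''"
  shows "sim_run (sim (While b p)) B V Y (1 + j + l) V'' Y''"
proof (rule sim_runI)
  fix M X m \<rho> W assume *: "rel m \<rho> V Y W" "B \<le> M" "m \<le> M" "W 6 0 + (1 + j + l) \<le> M"
  let ?W = "W(6 := (W 6)(0 := W 6 0 + 1))" and ?post = "sim_post m \<rho> V'' Y'' (1 + j + l) W"
  let ?loop = "While (sim_t b) (Seq (sim p) tick)"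
  have r: "rel m \<rho> V Y ?W" using *(1) by (rule rel_tick)
  have "tc M X ?loop ?W (2 + 3 * j + 3 * l) ?post"
  proof (rule tc_While_unfold)
    show "tc M X (Seq (sim p) tick) ?W (3 * j + 1) (\<lambda>W'. tc M X ?loop W' (3 * l) ?post)"
    proof (rule tc_Seq[OF sim_runD[OF p r *(2,3)]])
      fix W1 assume W1: "sim_post m \<rho> V' Y' j ?W W1"
      obtain i W2 where i: "run M X (sim (While b p)) W1 i W2" "i \<le> 3 * l" "sim_post m \<rho> V'' Y'' l W1 W2"
        using sim_runD[OF w, of m \<rho> W1 M X] * W1 unfolding tc_def sim_post_def by auto
      \<comment> \<open>The simulation of the remaining loop starts with a tick. It is the same tick
        that closes the body of the current round, so it is split off here.\<close>
      from i(1) obtain i' where i': "run M X ?loop (W1(6 := (W1 6)(0 := W1 6 0 + 1))) i' W2" "i = 1 + i'" "W1 6 0 < M"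
        by (auto simp: tick_def elim!: run.cases[of _ _ "Seq _ _"] run.cases[of _ _ "SetW _ _ _"])
      have "?post W2"
        using sim_post_trans[OF sim_post_tick[OF *(1)] sim_post_trans[OF W1 i(3)]] by (simp add: add.assoc)
      with i i' show "tc M X tick W1 1 (\<lambda>W'. tc M X ?loop W' (3 * l) ?post)"
        by (intro tc_tick) (auto simp: tc_def simp del: fun_upd_apply intro!: exI[of _ i'] exI[of _ W2])
    qed (use * in auto)
  qed (use sim_t[OF r b(1)] b(2) in auto)
  thus "tc M X (sim (While b p)) W (3 * (1 + j + l)) ?post"
    unfolding sim.simps using * by (intro tc_Seq_tick) auto
qed

text \<open>A counted step changes at most one value cell. This is the source of the lower bound
  \<open>n * n \<le> j n\<close> for matrix programs.\<close>

definition few_changes :: "nat \<Rightarrow> int vals \<Rightarrow> int vals \<Rightarrow> bool" where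
  "few_changes j Y Y' \<longleftrightarrow> finite {(a, i). Y' a i \<noteq> Y a i} \<and> card {(a, i). Y' a i \<noteq> Y a i} \<le> j"

lemma few_changes_refl: "few_changes j Y Y"
proof -
  have "{(a, i). Y a i \<noteq> Y a i} = {}" by auto
  thus ?thesis by (simp add: few_changes_def)
qed

lemma few_changes_upd: "few_changes 1 Y (Y(a := (Y a)(i := y)))"
proof -
  have sub: "{(b, k). (Y(a := (Y a)(i := y))) b k \<noteq> Y b k} \<subseteq> {(a, i)}" by (auto split: if_splits)
  from card_mono[OF _ sub] finite_subset[OF sub] show ?thesis by (simp add: few_changes_def del: fun_upd_apply)
qed

lemma few_changes_trans:
  assumes "few_changes j Y Y'" "few_changes l Y' Y''" shows "few_changes (j + l) Y Y''"
proof -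
  have sub: "{(a, i). Y'' a i \<noteq> Y a i} \<subseteq> {(a, i). Y' a i \<noteq> Y a i} \<union> {(a, i). Y'' a i \<noteq> Y' a i}"
    by auto
  with assms show ?thesis
    using card_mono[OF _ sub] card_Un_le[of "{(a, i). Y' a i \<noteq> Y a i}" "{(a, i). Y'' a i \<noteq> Y' a i}"]
    unfolding few_changes_def by (fastforce intro: finite_subset[OF sub])
qed

text \<open>The step count \<open>j\<close> does not depend on the initial values \<open>Y\<close>.\<close>

definition simulated :: "com \<Rightarrow> nat \<Rightarrow> words \<Rightarrow> nat \<Rightarrow> words \<Rightarrow> nat \<Rightarrow> bool" where
  "simulated p B V k V' j \<longleftrightarrow> j \<le> k \<and> (\<forall>Y. \<exists>Y'. exec B p (V, Y) k (V', Y') \<and>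
     sim_run (sim p) B V Y j V' Y' \<and> few_changes j Y Y')"

lemma simulatedI:
  assumes "j \<le> k" "\<And>Y. exec B p (V, Y) k (V', F Y)" "\<And>Y. sim_run (sim p) B V Y j V' (F Y)" "\<And>Y. few_changes j Y (F Y)"
  shows "simulated p B V k V' j"
  using assms unfolding simulated_def by blast

lemma simulatedE:
  assumes "simulated p B V k V' j"
  obtains Y' where "exec B p (V, Y) k (V', Y')" "sim_run (sim p) B V Y j V' Y'" "few_changes j Y Y'"
  using assms unfolding simulated_def by blast

lemma test_cost_pos: "1 \<le> test_cost b" by (cases b) auto

lemma simulated_Cond:
  assumes "word_test b" "test_fits B V b" and p: "simulated (if test_val (V, Y0 :: int vals) b then p else q) B V k V' j"
  shows "simulated (Cond b p q) B V (test_cost b + k) V' (1 + j)"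
  unfolding simulated_def
proof (intro conjI allI)
  show "1 + j \<le> test_cost b + k" using p test_cost_pos[of b] by (simp add: simulated_def)
  fix Y :: "int vals"
  have t: "test_val (V, Y0) b = test_val (V, Y) b" using assms(1) by (cases b) auto
  obtain Y' where Y': "exec B (if test_val (V, Y0) b then p else q) (V, Y) k (V', Y')"
    "sim_run (sim (if test_val (V, Y0) b then p else q)) B V Y j V' Y'" "few_changes j Y Y'"
    using p by (rule simulatedE)
  have "exec B (Cond b p q) (V, Y) (test_cost b + k) (V', Y')"
    using Y'(1) assms(2) unfolding t by (cases "test_val (V, Y) b") (auto intro: exec.IfTrue exec.IfFalse)
  moreover have "sim_run (sim (Cond b p q)) B V Y (1 + j) V' Y'"
    using Y'(2) assms(1) unfolding t by (intro sim_run_Cond)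
  moreover have "few_changes (1 + j) Y Y'" using Y'(3) by (auto simp: few_changes_def)
  ultimately show "\<exists>Y'. exec B (Cond b p q) (V, Y) (test_cost b + k) (V', Y') \<and>
      sim_run (sim (Cond b p q)) B V Y (1 + j) V' Y' \<and> few_changes (1 + j) Y Y'" by blast
qed

text \<open>Since values are never tested, a single execution determines words and control flow for
  every other initial value memory as well. The induction therefore follows one execution but
  concludes for all \<open>Y\<close>.\<close>

lemma exec_simulated:
  assumes "exec B p s k s'" "arithmetic p"
  shows "\<exists>j. simulated p B (fst s) k (fst s') j"
  using assms
proof induction
  case (SetW W d e a X0)
  have "sim_run (sim (SetW a d e)) B W Y 1 (W(a := (W a)(wval W d := wval W e))) Y" for Y
  proof (rule sim_runI)
    fix M X m \<rho> W' assume *: "rel m \<rho> W Y W'" "B \<le> M" "W' 6 0 + 1 \<le> M"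
    have wv: "wval W' (sim_w e) = wval W e" "wval W' (sim_w d) = wval W d" using * by (auto simp: sim_w)
    have \<rho>: "W' 5 0 = \<rho>" using * by (simp add: rel_def)
    show "tc M X (sim (SetW a d e)) W' (3 * 1) (sim_post m \<rho> (W(a := (W a)(wval W d := wval W e))) Y 1 W')"
      unfolding sim.simps
      by (rule tc_Seq_SetW[where T = 1], use wfits_wval[OF SetW(2)] wv * in simp, rule tc_tick)
        (use * rel_SetW[of m \<rho> W Y W' a "wval W d" "wval W e"] in
          \<open>auto simp: wv \<rho> region_def sim_post_def intro!: rel_tick\<close>)
  qed
  then have "simulated (SetW a d e) B W (1 + wcost d + wcost e) (W(a := (W a)(wval W d := wval W e))) 1"
    using exec.SetW[OF SetW(1,2), of a] few_changes_refl by (intro simulatedI[where F = "\<lambda>Y. Y"]) simp_all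
  then show ?case unfolding fst_conv by blast
next
  case (SetV W d e a X0)
  let ?Y = "\<lambda>Y. Y(a := (Y a)(wval W d := vval (W, Y) e))"
  have "sim_run (sim (SetV a d e)) B W Y 1 W (?Y Y)" for Y
  proof (rule sim_runI)
    fix M X m \<rho> W' assume *: "rel m \<rho> W Y W'" "m \<le> M" "W' 6 0 + 1 \<le> M"
    have wv: "wval W' (sim_w d) = wval W d" using * by (auto simp: sim_w)
    have v: "int (wval W' (sim_v e)) = vval (W, Y) e mod int m" using * by (simp add: sim_v)
    have "int m > 0" using * by (auto simp: rel_def)
    hence "int (wval W' (sim_v e)) < int m" unfolding v by simp
    hence le: "wval W' (sim_v e) \<le> M" using * by simp
    have \<rho>: "W' 5 0 = \<rho>" using * by (simp add: rel_def)
    show "tc M X (sim (SetV a d e)) W' (3 * 1) (sim_post m \<rho> W (?Y Y) 1 W')"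
      unfolding sim.simps
      by (rule tc_Seq_SetW[where T = 1], use le in simp, rule tc_tick)
        (use * rel_SetV[of m \<rho> W Y W' "wval W' (sim_v e)" _ a "wval W d", OF _ v] in
          \<open>auto simp: wv \<rho> region_def sim_post_def intro!: rel_tick\<close>)
  qed
  then have "simulated (SetV a d e) B W (1 + wcost d + vcost e) W 1"
    using exec.SetV[OF SetV(1,2), of a] few_changes_upd by (intro simulatedI[where F = ?Y]) (simp_all del: fun_upd_apply)
  then show ?case unfolding fst_conv by blast
next
  case (Seq p s k s' q l s'')
  then obtain j j' where j: "simulated p B (fst s) k (fst s') j" "simulated q B (fst s') l (fst s'') j'" by auto
  have "\<exists>Y''. exec B (Seq p q) (fst s, Y) (k + l) (fst s'', Y'') \<and>
      sim_run (sim (Seq p q)) B (fst s) Y (j + j') (fst s'') Y'' \<and> few_changes (j + j') Y Y''" for Y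
  proof -
    obtain Y' where 1: "exec B p (fst s, Y) k (fst s', Y')" "sim_run (sim p) B (fst s) Y j (fst s') Y'"
      "few_changes j Y Y'" using j(1) by (rule simulatedE)
    obtain Y'' where 2: "exec B q (fst s', Y') l (fst s'', Y'')" "sim_run (sim q) B (fst s') Y' j' (fst s'') Y''"
      "few_changes j' Y' Y''" using j(2) by (rule simulatedE)
    show ?thesis using exec.Seq[OF 1(1) 2(1)] sim_run_Seq[OF 1(2) 2(2)] few_changes_trans[OF 1(3) 2(3)] by auto
  qed
  then have "simulated (Seq p q) B (fst s) (k + l) (fst s'') (j + j')" using j by (simp add: simulated_def)
  then show ?case by blast
next
  case (IfTrue s b p k s' q)
  then obtain j where j: "simulated p B (fst s) k (fst s') j" by auto
  have "test_val (fst s, \<lambda>_ _. 0 :: int) b" using IfTrue by (cases b) auto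
  with IfTrue j show ?case using simulated_Cond[of b B "fst s" "\<lambda>_ _. 0" p q] by auto
next
  case (IfFalse s b q k s' p)
  then obtain j where j: "simulated q B (fst s) k (fst s') j" by auto
  have "\<not> test_val (fst s, \<lambda>_ _. 0 :: int) b" using IfFalse by (cases b) auto
  with IfFalse j show ?case using simulated_Cond[of b B "fst s" "\<lambda>_ _. 0" p q] by auto
next
  case (WhileFalse s b p)
  have t: "\<not> test_val (fst s, Y) b" for Y :: "int vals" using WhileFalse by (cases b) auto
  have "sim_run (sim (While b p)) B (fst s) Y 1 (fst s) Y" for Y
  proof (rule sim_runI)
    fix M X m \<rho> W assume *: "rel m \<rho> (fst s) Y W" "W 6 0 + 1 \<le> M"
    from sim_t[OF rel_tick[OF *(1)], where b = b] sim_post_tick[OF *(1)] * t[of Y] WhileFalse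
    show "tc M X (sim (While b p)) W (3 * 1) (sim_post m \<rho> (fst s) Y 1 W)"
      unfolding sim.simps by (intro tc_Seq_tick[where T = 1] tc_While_unfold) auto
  qed
  moreover have "exec B (While b p) (fst s, Y) (test_cost b) (fst s, Y)" for Y :: "int vals"
    using WhileFalse t by (intro exec.WhileFalse) auto
  ultimately have "simulated (While b p) B (fst s) (test_cost b) (fst s) 1"
    using few_changes_refl test_cost_pos by (intro simulatedI[where F = "\<lambda>Y. Y"])
  then show ?case by blast
next
  case (WhileTrue s b p k s' l s'')
  have t: "test_val (fst s, Y) b" for Y :: "int vals" using WhileTrue by (cases b) auto
  have wt: "word_test b" using WhileTrue by auto
  obtain j j' where j: "simulated p B (fst s) k (fst s') j" "simulated (While b p) B (fst s') l (fst s'') j'"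
    using WhileTrue by auto
  have "\<exists>Y''. exec B (While b p) (fst s, Y) (test_cost b + k + l) (fst s'', Y'') \<and>
      sim_run (sim (While b p)) B (fst s) Y (1 + j + j') (fst s'') Y'' \<and> few_changes (1 + j + j') Y Y''" for Y
  proof -
    obtain Y' where 1: "exec B p (fst s, Y) k (fst s', Y')" "sim_run (sim p) B (fst s) Y j (fst s') Y'"
      "few_changes j Y Y'" using j(1) by (rule simulatedE)
    obtain Y'' where 2: "exec B (While b p) (fst s', Y') l (fst s'', Y'')"
      "sim_run (sim (While b p)) B (fst s') Y' j' (fst s'') Y''" "few_changes j' Y' Y''"
      using j(2) by (rule simulatedE)
    have "exec B (While b p) (fst s, Y) (test_cost b + k + l) (fst s'', Y'')"
      using WhileTrue t by (intro exec.WhileTrue[OF _ _ 1(1) 2(1)]) auto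
    moreover have "few_changes (1 + j + j') Y Y''"
      using few_changes_trans[OF 1(3) 2(3)] by (auto simp: few_changes_def)
    ultimately show ?thesis using sim_run_WhileTrue[OF wt t 1(2) 2(2)] by blast
  qed
  moreover have "1 + j + j' \<le> test_cost b + k + l" using j test_cost_pos[of b] by (simp add: simulated_def)
  ultimately have "simulated (While b p) B (fst s) (test_cost b + k + l) (fst s'') (1 + j + j')"
    by (simp add: simulated_def)
  then show ?case by blast
qed

text \<open>It identifies the execution that \<open>simulated\<close> provides with the one whose
  result is known to be the matrix product.\<close>

lemma exec_deterministic:
  assumes "exec B p s k s'" "exec B p s l s''" shows "k = l \<and> s' = s''"
  using assms
proof (induction arbitrary: l s'')
  case (SetW W d e a X) from SetW.prems show ?case by cases auto
next
  case (SetV W d e a X) from SetV.prems show ?case by cases auto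
next
  case (Seq p s k s' q l s'') from Seq.prems show ?case by cases (use Seq.IH in blast)
next
  case (IfTrue s b p k s' q) from IfTrue.prems show ?case by cases (use IfTrue in blast)+
next
  case (IfFalse s b p k s' q) from IfFalse.prems show ?case by cases (use IfFalse in blast)+
next
  case (WhileFalse s b p) from WhileFalse.prems show ?case by cases (use WhileFalse in blast)+
next
  case (WhileTrue s b p k s' l s'') from WhileTrue.prems show ?case by cases (use WhileTrue in blast)+
qed

section \<open>Boolean products and the choice of the block size\<close>

text \<open>\<open>j n\<close> is the exact number of ticks, common to all matrices of size
  \<open>n\<close>, and \<open>B n\<close> bounds the words of the original program.\<close>

locale matrix_program =
  fixes p :: com and B j :: "nat \<Rightarrow> nat"
  assumes product: "\<exists>V Y. sim_run (sim p) (B n) (fst (matrix_input n P Q)) (snd (matrix_input n P Q)) (j n) V Y \<and>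
      (\<forall>i<n. \<forall>k<n. Y 2 (i * n + k) = (\<Sum>l<n. P i l * Q l k))"
    and square_le: "n * n \<le> j n"

lemma matrix_program_exists:
  assumes "arithmetic p"
    and ex: "\<And>n M N. \<exists>k W X. exec (B n) p (matrix_input n M N) k (W, X) \<and> k \<le> T n \<and>
        (\<forall>i<n. \<forall>j<n. X 2 (i * n + j) = (\<Sum>l<n. M i l * N l j))"
  obtains j where "matrix_program p B j" "\<And>n. j n \<le> T n"
proof -
  define good where "good n j \<longleftrightarrow> j \<le> T n \<and> n * n \<le> j \<and> (\<forall>P Q. \<exists>V Y.
      sim_run (sim p) (B n) (fst (matrix_input n P Q)) (snd (matrix_input n P Q)) j V Y \<and>
      (\<forall>i<n. \<forall>k<n. Y 2 (i * n + k) = (\<Sum>l<n. P i l * Q l k)))" for n j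
  have "\<exists>j. good n j" for n
  proof -
    let ?I = "\<lambda>P Q. matrix_input n P Q"
    have fst: "fst (?I P Q) = fst (?I P' Q')" for P Q P' Q' by (simp add: matrix_input_def)
    \<comment> \<open>The zero matrices merely fix the control flow; the resulting \<open>k\<close>,
      \<open>W\<close> and \<open>j\<close> are valid for all inputs.\<close>
    obtain k W X where k: "exec (B n) p (?I (\<lambda>_ _. 0) (\<lambda>_ _. 0)) k (W, X)" "k \<le> T n"
      using ex by blast
    obtain j where j: "simulated p (B n) (fst (?I (\<lambda>_ _. 0) (\<lambda>_ _. 0))) k W j"
      using exec_simulated[OF k(1) assms(1)] by auto
    have *: "\<exists>Y'. sim_run (sim p) (B n) (fst (?I P Q)) (snd (?I P Q)) j W Y' \<and>
      (\<forall>i<n. \<forall>k<n. Y' 2 (i * n + k) = (\<Sum>l<n. P i l * Q l k)) \<and> few_changes j (snd (?I P Q)) Y'" for P Q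
    proof -
      obtain Y' where Y': "exec (B n) p (?I P Q) k (W, Y')"
        "sim_run (sim p) (B n) (fst (?I P Q)) (snd (?I P Q)) j W Y'" "few_changes j (snd (?I P Q)) Y'"
        using simulatedE[OF j, of "snd (?I P Q)"] unfolding fst[of "\<lambda>_ _. 0" "\<lambda>_ _. 0" P Q] prod.collapse by blast
      obtain k' W' X' where "exec (B n) p (?I P Q) k' (W', X')"
        "\<forall>i<n. \<forall>j<n. X' 2 (i * n + j) = (\<Sum>l<n. P i l * Q l j)" using ex by blast
      with exec_deterministic[OF Y'(1)] have "\<forall>i<n. \<forall>k<n. Y' 2 (i * n + k) = (\<Sum>l<n. P i l * Q l k)" by blast
      with Y' show ?thesis by blast
    qed
    have "n * n \<le> j"
    proof (cases "n = 0")
      case False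
      \<comment> \<open>The product of the all-one matrices has \<open>n \<noteq> 0\<close> in every
        entry, whereas value array 2 is initially zero. Hence \<open>n * n\<close> cells have
        changed.\<close>
      let ?Y = "snd (?I (\<lambda>_ _. 1) (\<lambda>_ _. 1))"
      obtain Y' where Y': "\<forall>i<n. \<forall>k<n. Y' 2 (i * n + k) = (\<Sum>l<n. 1 * 1 :: int)" "few_changes j ?Y Y'"
        using *[of "\<lambda>_ _. 1" "\<lambda>_ _. 1"] by blast
      have "Y' 2 z \<noteq> ?Y 2 z" if "z < n * n" for z
      proof -
        have "Y' 2 (z div n * n + z mod n) = int n"
          using Y'(1)[rule_format, of "z div n" "z mod n"] that False by (simp add: less_mult_imp_div_less)
        with False show ?thesis by (simp add: matrix_input_def)
      qed
      hence "(\<lambda>z. (2, z)) ` {..<n * n} \<subseteq> {(a, i). Y' a i \<noteq> ?Y a i}" by auto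
      from card_mono[OF _ this] Y'(2) show ?thesis by (simp add: few_changes_def card_image inj_on_def)
    qed simp
    moreover have "\<exists>V Y. sim_run (sim p) (B n) (fst (?I P Q)) (snd (?I P Q)) j V Y \<and>
      (\<forall>i<n. \<forall>k<n. Y 2 (i * n + k) = (\<Sum>l<n. P i l * Q l k))" for P Q using *[of P Q] by blast
    moreover have "j \<le> k" using j by (simp add: simulated_def)
    ultimately show ?thesis using k(2) unfolding good_def by (intro exI[of _ j]) simp
  qed
  then obtain j where "\<And>n. good n (j n)" by metis
  thus ?thesis by (intro that[of j]) (auto simp: matrix_program_def good_def)
qed

section \<open>Boolean products by simulated arithmetic\<close>

primrec pw :: "nat \<Rightarrow> wexp" where
  "pw 0 = Const 1"
| "pw (Suc k) = Op Mul (reg 0) (pw k)"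

lemma wval_pw [simp]: "wval W (pw k) = W 0 0 ^ k"
  by (induction k) auto

text \<open>A frame condition that exempts the simulation arrays. Finished simulations leave their
  contents there; \<open>clean\<close> tells which part is still fresh.\<close>

definition agree :: "nat set \<Rightarrow> words \<Rightarrow> words \<Rightarrow> bool" where
  "agree S W W' \<longleftrightarrow> (\<forall>a. a \<notin> S \<longrightarrow> a \<notin> range (fam 2) \<longrightarrow> a \<notin> range (fam 3) \<longrightarrow> W' a = W a)"

definition clean :: "nat \<Rightarrow> words \<Rightarrow> bool" where
  "clean \<rho> W \<longleftrightarrow> (\<forall>r\<ge>\<rho>. \<forall>a i. W (fam 2 a) (prod_encode (i, r)) = 0 \<and> W (fam 3 a) (prod_encode (i, r)) = 0)"

lemma fam_small [simp]: "v < 20 \<Longrightarrow> v \<notin> range (fam k)"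
  by (auto simp: fam_def)

lemma fam_range [simp]: "k < 5 \<Longrightarrow> l < 5 \<Longrightarrow> fam k a \<in> range (fam l) \<longleftrightarrow> k = l"
  by (auto simp: image_iff)

lemma agreeD: "agree S W W' \<Longrightarrow> a \<notin> S \<Longrightarrow> a \<notin> range (fam 2) \<Longrightarrow> a \<notin> range (fam 3) \<Longrightarrow> W' a = W a"
  by (auto simp: agree_def)

lemma agree_refl [simp]: "agree S W W" by (simp add: agree_def)

lemma agree_trans: "agree S W W' \<Longrightarrow> agree S' W' W'' \<Longrightarrow> S \<union> S' \<subseteq> S'' \<Longrightarrow> agree S'' W W''"
  unfolding agree_def by (metis UnCI subsetD)

lemma agree_upd: "agree S W W' \<Longrightarrow> a \<in> S \<or> a \<in> range (fam 2) \<or> a \<in> range (fam 3) \<Longrightarrow> agree S W (W'(a := f))"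
  by (auto simp: agree_def)

lemma clean_upd: "clean \<rho> W \<Longrightarrow> a \<notin> range (fam 2) \<Longrightarrow> a \<notin> range (fam 3) \<Longrightarrow> clean \<rho> (W(a := f))"
  by (auto simp: clean_def)

lemma clean_region:
  assumes "clean (Suc \<rho>) W" "\<And>a i. a \<noteq> 6 \<Longrightarrow> \<not> region \<rho> a i \<Longrightarrow> W' a i = W a i"
  shows "clean (Suc \<rho>) W'"
  using assms by (auto simp: clean_def region_def)

lemma agree_region:
  assumes "\<And>a i. a \<noteq> 6 \<Longrightarrow> \<not> region \<rho> a i \<Longrightarrow> W' a i = W a i" "6 \<in> S"
  shows "agree S W W'"
  unfolding agree_def
proof (intro allI impI ext)
  fix a i assume "a \<notin> S" "a \<notin> range (fam 2)" "a \<notin> range (fam 3)"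
  moreover from this have "\<not> region \<rho> a i" by (auto simp: region_def)
  ultimately show "W' a i = W a i" using assms by metis
qed

lemma rel_clean:
  assumes "clean \<rho> W" "W 5 0 = \<rho>" "W 7 0 = D"
  shows "rel (Suc D) \<rho> (fst (matrix_input D (\<lambda>_ _. 0) (\<lambda>_ _. 0))) (snd (matrix_input D (\<lambda>_ _. 0) (\<lambda>_ _. 0)))
     (W(fam 2 0 := (W (fam 2 0))(prod_encode (0, \<rho>) := D)))"
  using assms by (auto simp: rel_def matrix_input_def clean_def)

definition entries :: "wexp \<Rightarrow> wexp \<Rightarrow> com" where
  "entries m1 m2 = For 10 (Op Mul (reg 7) (reg 7))
     (Seq (SetW (fam 3 0) (enc (reg 10)) m1) (SetW (fam 3 1) (enc (reg 10)) m2))"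

definition product_call :: "com \<Rightarrow> wexp \<Rightarrow> wexp \<Rightarrow> com" where
  "product_call p m1 m2 = Seq (SetW (fam 2 0) (enc (Const 0)) (reg 7))
     (Seq (SetW 6 (Const 0) (Const 0)) (Seq (entries m1 m2) (sim p)))"

context matrix_program begin

text \<open>The expressions \<open>m1\<close> and \<open>m2\<close> are evaluated while the loop
  counter and the simulated matrices are changing. Their values are therefore prescribed in every
  memory that agrees with \<open>W\<close> elsewhere.\<close>

lemma product_call:
  assumes cl: "clean \<rho> W" and \<rho>: "W 5 0 = \<rho>" and D: "W 7 0 = D"
    and M: "B D \<le> M" "j D \<le> M" "Suc D \<le> M"
    and f: "\<And>z. z < D * D \<Longrightarrow> f1 z \<le> 1 \<and> f2 z \<le> 1"
    and m: "\<And>W' z. agree {6, 10} W W' \<Longrightarrow> W' 10 0 = z \<Longrightarrow> z < D * D \<Longrightarrow> wval W' m1 = f1 z \<and> wval W' m2 = f2 z"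
    and T: "4 * (D * D) + 4 + 3 * j D \<le> T"
  shows "tc M X (product_call p m1 m2) W T (\<lambda>W'. agree {6, 10} W W' \<and> clean (Suc \<rho>) W' \<and>
    (\<forall>i<D. \<forall>k<D. (0 < W' (fam 3 2) (prod_encode (i * D + k, \<rho>))) = (\<exists>l<D. f1 (i * D + l) = 1 \<and> f2 (l * D + k) = 1)))"
    (is "tc M X _ W T ?post")
proof -
  define P where "P i l = int (f1 (i * D + l))" for i l
  define Q where "Q i l = int (f2 (i * D + l))" for i l
  have PQ: "P (z div D) (z mod D) = int (f1 z)" "Q (z div D) (z mod D) = int (f2 z)" for z
    by (simp_all add: P_def Q_def)
  obtain V Y where sr: "sim_run (sim p) (B D) (fst (matrix_input D P Q)) (snd (matrix_input D P Q)) (j D) V Y"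
    and Y: "\<And>i k. i < D \<Longrightarrow> k < D \<Longrightarrow> Y 2 (i * D + k) = (\<Sum>l<D. P i l * Q l k)"
    using product[of D P Q] by (elim exE conjE) (rule that, assumption, simp)
  let ?W1 = "W(fam 2 0 := (W (fam 2 0))(prod_encode (0, \<rho>) := D), 6 := (W 6)(0 := 0))"
  define I where "I z W' \<longleftrightarrow> agree {6, 10} W W' \<and> W' 6 0 = 0 \<and>
     W' (fam 2 0) (prod_encode (0, \<rho>)) = D \<and>
     (\<forall>a i. i \<noteq> 0 \<or> a \<noteq> 0 \<longrightarrow> W' (fam 2 a) (prod_encode (i, \<rho>)) = 0) \<and>
     (\<forall>i<z. W' (fam 3 0) (prod_encode (i, \<rho>)) = f1 i \<and> W' (fam 3 1) (prod_encode (i, \<rho>)) = f2 i) \<and>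
     (\<forall>a i. i \<ge> z \<or> a \<ge> 2 \<longrightarrow> W' (fam 3 a) (prod_encode (i, \<rho>)) = 0) \<and> clean (Suc \<rho>) W'" for z W'
  \<comment> \<open>The loop counter fits into a word because
    \<open>D * D \<le> j D \<le> M\<close>.\<close>
  have DM: "D * D \<le> M" using square_le[of D] M by linarith
  have IW: "W' 5 0 = \<rho> \<and> W' 7 0 = D" if "I z W'" for z W'
    using that \<rho> D by (auto simp: I_def agree_def)
  have fill: "tc M X (entries m1 m2) ?W1 (4 * (D * D) + 2) (I (D * D))"
    unfolding entries_def
  proof (rule tc_For[where I = I and m = "D * D" and t = 2])
    show "I 0 (?W1(10 := (?W1 10)(0 := 0)))"
      using cl by (auto simp: I_def clean_def agree_def)
  next
    fix z W' assume z: "z < D * D" and I: "I z W'" and W': "W' 10 0 = z"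
    have v1: "wval W' m1 = f1 z" using m[of W' z] I W' z by (auto simp: I_def)
    let ?W' = "W'(fam 3 0 := (W' (fam 3 0))(prod_encode (z, \<rho>) := f1 z))"
    have "agree {6, 10} W ?W'" using I by (auto simp: I_def intro!: agree_upd)
    hence v2: "wval ?W' m2 = f2 z" using m[of ?W' z] W' z by auto
    show "tc M X (Seq (SetW (fam 3 0) (enc (reg 10)) m1) (SetW (fam 3 1) (enc (reg 10)) m2)) W' 2
            (advance I 10 z)"
    proof (rule tc_Seq_SetW[where T = 1])
      have *: "wval W' (enc (reg 10)) = prod_encode (z, \<rho>)" using W' IW[OF I] by simp
      show "tc M X (SetW (fam 3 1) (enc (reg 10)) m2)
         (W'(fam 3 0 := (W' (fam 3 0))(wval W' (enc (reg 10)) := wval W' m1))) 1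
         (advance I 10 z)"
        unfolding * v1
      proof (rule tc_SetW)
        have *: "wval ?W' (enc (reg 10)) = prod_encode (z, \<rho>)" using W' IW[OF I] by simp
        let ?W'' = "?W'(fam 3 1 := (?W' (fam 3 1))(prod_encode (z, \<rho>) := f2 z))"
        have "agree {6, 10} W (?W''(10 := (?W'' 10)(0 := Suc z)))"
          using I by (auto simp: I_def intro!: agree_upd)
        moreover have "clean (Suc \<rho>) (?W''(10 := (?W'' 10)(0 := Suc z)))"
          using I by (auto simp: I_def clean_def)
        let ?W2 = "?W'(fam 3 1 := (?W' (fam 3 1))(wval ?W' (enc (reg 10)) := wval ?W' m2))"
        show "advance I 10 z ?W2"
          unfolding * v2 advance_def
          using I W' \<open>agree {6, 10} W (?W''(10 := (?W'' 10)(0 := Suc z)))\<close>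
            \<open>clean (Suc \<rho>) (?W''(10 := (?W'' 10)(0 := Suc z)))\<close>
          unfolding I_def by (auto simp: less_Suc_eq)
        show "wval ?W' m2 \<le> M" using v2 f[OF z] M(3) by simp
      qed simp
      show "wval W' m1 \<le> M" using v1 f[OF z] M(3) by simp
    qed simp
  qed (use IW DM in auto)
  show ?thesis unfolding product_call_def
  proof (rule tc_Seq_SetW, use M D in simp, rule tc_Seq_SetW, simp)
    let ?W = "W(fam 2 0 := (W (fam 2 0))(wval W (enc (Const 0)) := wval W (reg 7)))"
    have "?W1 = ?W(6 := (?W 6)(wval ?W (Const 0) := wval ?W (Const 0)))" using \<rho> D by simp
    then show "tc M X (Seq (entries m1 m2) (sim p)) (?W(6 := (?W 6)(wval ?W (Const 0) := wval ?W (Const 0))))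
       (4 * (D * D) + 2 + 3 * j D) ?post"
    proof (elim subst, intro tc_Seq[OF fill])
      fix W' assume I: "I (D * D) W'"
      have r: "rel (Suc D) \<rho> (fst (matrix_input D P Q)) (snd (matrix_input D P Q)) W'"
        unfolding rel_def
      proof (intro conjI allI)
        fix a i
        show "W' (fam 2 a) (prod_encode (i, \<rho>)) = fst (matrix_input D P Q) a i"
          using I by (auto simp: I_def matrix_input_def)
        consider "i < D * D" "a = 0" | "i < D * D" "a = 1" | "i \<ge> D * D \<or> a \<ge> 2" by linarith
        then show "int (W' (fam 3 a) (prod_encode (i, \<rho>))) = snd (matrix_input D P Q) a i mod int (Suc D)"
        proof cases
          case 3
          then show ?thesis using I by (auto simp: I_def matrix_input_def)
        next
          case 1
          then have "0 < D" by (cases D) auto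
          then show ?thesis using 1 I f[OF 1(1)] by (auto simp: I_def matrix_input_def PQ)
        next
          case 2
          then have "0 < D" by (cases D) auto
          then show ?thesis using 2 I f[OF 2(1)] by (auto simp: I_def matrix_input_def PQ)
        qed
      qed (use IW[OF I] in auto)
      show "tc M X (sim p) W' (3 * j D) ?post"
      proof (rule tc_mono[OF sim_runD[OF sr r M(1) M(3)]])
        show "W' 6 0 + j D \<le> M" using I M by (simp add: I_def)
      next
        fix W'' assume W'': "sim_post (Suc D) \<rho> V Y (j D) W' W''"
        have "agree {6, 10} W' W''" by (rule agree_region[of \<rho>]) (use W'' in \<open>auto simp: sim_post_def\<close>)
        hence "agree {6, 10} W W''" using I agree_trans[of "{6, 10}" W W' "{6, 10}"] by (auto simp: I_def)
        moreover have "clean (Suc \<rho>) W''" by (rule clean_region[of _ W']) (use I W'' in \<open>auto simp: I_def sim_post_def\<close>)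
        moreover have "(0 < W'' (fam 3 2) (prod_encode (i * D + k, \<rho>))) = (\<exists>l<D. f1 (i * D + l) = 1 \<and> f2 (l * D + k) = 1)"
          if ik: "i < D" "k < D" for i k
        proof -
          have bd: "P i l * Q l k \<in> {0, 1} \<and> (P i l * Q l k = 1 \<longleftrightarrow> f1 (i * D + l) = 1 \<and> f2 (l * D + k) = 1)" if "l < D" for l
          proof -
            have "i * D + l < Suc i * D" "l * D + k < Suc l * D" using that ik by auto
            moreover have "Suc i * D \<le> D * D" "Suc l * D \<le> D * D" using that ik by (intro mult_le_mono; simp)+
            ultimately have "i * D + l < D * D" "l * D + k < D * D" by linarith+
            hence "f1 (i * D + l) \<in> {0, 1}" "f2 (l * D + k) \<in> {0, 1}" using f by force+
            thus ?thesis by (auto simp: P_def Q_def)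
          qed
          let ?s = "\<Sum>l<D. P i l * Q l k"
          have "?s \<le> (\<Sum>l<D. 1)" using bd by (intro sum_mono) force
          hence s1: "?s \<le> int D" by simp
          have s0: "0 \<le> ?s" using bd by (intro sum_nonneg) force
          have "int (W'' (fam 3 2) (prod_encode (i * D + k, \<rho>))) = ?s mod int (Suc D)"
            using W'' Y[OF ik] by (simp add: sim_post_def rel_def)
          also have "\<dots> = ?s" using s0 s1 by (intro mod_pos_pos_trivial) auto
          finally have "(0 < W'' (fam 3 2) (prod_encode (i * D + k, \<rho>))) = (?s \<noteq> 0)" using s0 by linarith
          also have "(?s \<noteq> 0) = (\<exists>l<D. P i l * Q l k \<noteq> 0)"
            using bd by (subst sum_nonneg_eq_0_iff) force+
          also have "\<dots> = (\<exists>l<D. f1 (i * D + l) = 1 \<and> f2 (l * D + k) = 1)"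
          proof -
            have "P i l * Q l k \<noteq> 0 \<longleftrightarrow> f1 (i * D + l) = 1 \<and> f2 (l * D + k) = 1" if "l < D" for l
              using bd[OF that] by force
            thus ?thesis by blast
          qed
          finally show ?thesis .
        qed
        ultimately show "?post W''" by blast
      qed simp
    qed simp
  qed (use T in auto)
qed


section \<open>Choosing the block size by doubling\<close>

text \<open>Fresh simulation memory already represents two zero matrices, and \<open>j D\<close>
  does not depend on the entries. Only the dimension has to be written.\<close>

definition measure :: com where
  "measure = Seq (SetW (fam 2 0) (enc (Const 0)) (reg 7)) (Seq (SetW 6 (Const 0) (Const 0))
     (Seq (sim p) (Seq (SetW 8 (Const 0) (reg 6)) (SetW 5 (Const 0) (Op Add (reg 5) (Const 1))))))"

lemma measure:
  assumes cl: "clean \<rho> W" and \<rho>: "W 5 0 = \<rho>" and D: "W 7 0 = D"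
    and M: "B D \<le> M" "j D \<le> M" "Suc D \<le> M" "Suc \<rho> \<le> M"
  shows "tc M X measure W (3 * j D + 4) (\<lambda>W'. agree {5, 6, 8} W W' \<and> clean (Suc \<rho>) W' \<and>
    W' 5 0 = Suc \<rho> \<and> W' 8 0 = j D)"
  unfolding measure_def
proof (rule tc_Seq_SetW, use M D in simp, rule tc_Seq_SetW, simp)
  obtain V Y where sr: "sim_run (sim p) (B D) (fst (matrix_input D (\<lambda>_ _. 0) (\<lambda>_ _. 0)))
      (snd (matrix_input D (\<lambda>_ _. 0) (\<lambda>_ _. 0))) (j D) V Y"
    using product[of D "\<lambda>_ _. 0" "\<lambda>_ _. 0"] by (elim exE conjE)
  let ?W = "W(fam 2 0 := (W (fam 2 0))(wval W (enc (Const 0)) := wval W (reg 7)))"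
  let ?W1 = "?W(6 := (?W 6)(wval ?W (Const 0) := wval ?W (Const 0)))"
  have r: "rel (Suc D) \<rho> (fst (matrix_input D (\<lambda>_ _. 0) (\<lambda>_ _. 0)))
      (snd (matrix_input D (\<lambda>_ _. 0) (\<lambda>_ _. 0))) ?W1"
    using rel_clean[OF cl \<rho> D] by (intro rel_tick) (simp add: \<rho> D)
  have cl1: "clean (Suc \<rho>) ?W1" using cl \<rho> by (auto simp: clean_def)
  have a1: "agree {5, 6, 8} W ?W1" by (intro agree_upd) auto
  show "tc M X (Seq (sim p) (Seq (SetW 8 (Const 0) (reg 6)) (SetW 5 (Const 0) (Op Add (reg 5) (Const 1)))))
     ?W1 (3 * j D + 2) (\<lambda>W'. agree {5, 6, 8} W W' \<and> clean (Suc \<rho>) W' \<and> W' 5 0 = Suc \<rho> \<and> W' 8 0 = j D)"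
  proof (rule tc_Seq[OF sim_runD[OF sr r M(1) M(3)]])
    fix W' assume "sim_post (Suc D) \<rho> V Y (j D) ?W1 W'"
    note W' = this[unfolded sim_post_def]
    have "agree {5, 6, 8} ?W1 W'" by (rule agree_region[of \<rho>]) (use W' in \<open>blast, simp\<close>)
    hence "agree {5, 6, 8} W W'" using agree_trans[OF a1] by auto
    moreover have "clean (Suc \<rho>) W'" by (rule clean_region[OF cl1]) (use W' in blast)
    moreover have "W' 5 0 = \<rho>" "W' 6 0 = j D" using W' by (auto simp: rel_def)
    ultimately show "tc M X (Seq (SetW 8 (Const 0) (reg 6)) (SetW 5 (Const 0) (Op Add (reg 5) (Const 1)))) W' 2
      (\<lambda>W'. agree {5, 6, 8} W W' \<and> clean (Suc \<rho>) W' \<and> W' 5 0 = Suc \<rho> \<and> W' 8 0 = j D)"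
      using M by (intro tc_Seq_SetW[where T = 1] tc_SetW) (auto intro!: agree_upd clean_upd)
  qed (use M in auto)
qed auto

text \<open>A conjunction as a single word test: the product of two truncated differences is
  positive iff \<open>D ^ 4 < n ^ b * j D\<close> and \<open>2 * D < n ^ a + 1\<close>.\<close>

definition search_test :: "nat \<Rightarrow> nat \<Rightarrow> test" where
  "search_test a b = WLess (Const 0) (Op Mul
     (Op Sub (Op Mul (pw b) (reg 8)) (Op Mul (Op Mul (reg 7) (reg 7)) (Op Mul (reg 7) (reg 7))))
     (Op Sub (Op Add (pw a) (Const 1)) (Op Mul (Const 2) (reg 7))))"

definition search :: "nat \<Rightarrow> nat \<Rightarrow> com" where
  "search a b = Seq (SetW 7 (Const 0) (Const 1)) (Seq measure
     (While (search_test a b) (Seq (SetW 7 (Const 0) (Op Mul (Const 2) (reg 7))) measure)))"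

text \<open>About \<open>n ^ (a + b + c) / D ^ 3\<close> tile products cost \<open>j D\<close> each,
  and the scan costs about \<open>n ^ (a + c) * D\<close>. Multiplying both by
  \<open>D ^ 3 / n ^ (a + c)\<close> gives the comparison of \<open>n ^ b * j D\<close> with
  \<open>D ^ 4\<close>.\<close>

definition continue :: "nat \<Rightarrow> nat \<Rightarrow> nat \<Rightarrow> nat \<Rightarrow> bool" where
  "continue n a b D \<longleftrightarrow> D ^ 4 < n ^ b * j D \<and> 2 * D \<le> n ^ a"

lemma search:
  assumes n: "0 < n" "W 0 0 = n" and cl: "clean 0 W" and \<rho>: "W 5 0 = 0"
    and M: "\<And>D. 0 < D \<Longrightarrow> D \<le> n ^ a \<Longrightarrow> B D \<le> M \<and> j D \<le> M \<and> Suc D \<le> M"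
  obtains l where "2 ^ l \<le> n ^ a" "\<not> continue n a b (2 ^ l)" "\<And>i. i < l \<Longrightarrow> continue n a b (2 ^ i)"
    "tc M X (search a b) W (7 + (\<Sum>i\<le>l. 3 * j (2 ^ i) + 6)) (\<lambda>W'. agree {5, 6, 7, 8} W W' \<and>
       clean (Suc l) W' \<and> W' 5 0 = Suc l \<and> W' 7 0 = 2 ^ l)"
proof -
  \<comment> \<open>The cap on \<open>D\<close> alone already stops the doubling, whatever
    \<open>j\<close> is.\<close>
  have "n ^ a < 2 ^ (n ^ a)" by simp
  hence "\<not> continue n a b (2 ^ (n ^ a))" unfolding continue_def by linarith
  hence ex: "\<exists>l. \<not> continue n a b (2 ^ l)" by blast
  define l where "l = (LEAST l. \<not> continue n a b (2 ^ l))"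
  have l: "\<not> continue n a b (2 ^ l)" unfolding l_def by (rule LeastI_ex[OF ex])
  have less: "continue n a b (2 ^ i)" if "i < l" for i using not_less_Least that unfolding l_def by blast
  have na: "2 ^ i \<le> n ^ a" if "i \<le> l" for i
  proof (cases i)
    case 0 thus ?thesis using n by simp
  next
    case (Suc i') thus ?thesis using less[of i'] that by (auto simp: continue_def)
  qed
  \<comment> \<open>After \<open>i\<close> doublings, \<open>i + 1\<close> measurements have used up
    the simulations \<open>0\<close> to \<open>i\<close>.\<close>
  define I where "I i W' \<longleftrightarrow> agree {5, 6, 7, 8} W W' \<and> clean (Suc i) W' \<and> W' 5 0 = Suc i \<and>
    W' 7 0 = 2 ^ i \<and> W' 8 0 = j (2 ^ i)" for i W'
  have bound: "B (2 ^ i) \<le> M" "j (2 ^ i) \<le> M" "Suc (2 ^ i) \<le> M" "Suc i \<le> M" if "i \<le> l" for i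
  proof -
    have "i < 2 ^ i" by (rule less_exp)
    moreover have "B (2 ^ i) \<le> M \<and> j (2 ^ i) \<le> M \<and> Suc (2 ^ i) \<le> M" by (rule M[OF _ na[OF that]]) simp
    ultimately show "B (2 ^ i) \<le> M" "j (2 ^ i) \<le> M" "Suc (2 ^ i) \<le> M" "Suc i \<le> M" by linarith+
  qed
  have meas: "tc M X measure W' (3 * j (2 ^ i) + 4) (I i)"
    if "i \<le> l" "agree {5, 6, 7, 8} W W'" "clean i W'" "W' 5 0 = i" "W' 7 0 = 2 ^ i" for i W'
  proof (rule tc_mono[OF measure[OF that(3-5) bound[OF that(1)]]])
    fix W'' assume *: "agree {5, 6, 8} W' W'' \<and> clean (Suc i) W'' \<and> W'' 5 0 = Suc i \<and> W'' 8 0 = j (2 ^ i)"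
    hence "W'' 7 = W' 7" by (auto elim!: agreeD)
    thus "I i W''" using * that(5) agree_trans[OF that(2), of "{5, 6, 8}" W''] by (auto simp: I_def)
  qed simp
  have "tc M X (search a b) W (1 + (3 * j (2 ^ 0) + 4) + (1 + (\<Sum>i<l. 1 + (1 + (3 * j (2 ^ Suc i) + 4))))) (I l)"
    unfolding search_def
  proof (rule tc_Seq_SetW)
    show "wval W (Const 1) \<le> M" using bound(3)[of 0] by simp
    show "tc M X (Seq measure (While (search_test a b)
       (Seq (SetW 7 (Const 0) (Op Mul (Const 2) (reg 7))) measure)))
       (W(7 := (W 7)(wval W (Const 0) := wval W (Const 1))))
       ((3 * j (2 ^ 0) + 4) + (1 + (\<Sum>i<l. 1 + (1 + (3 * j (2 ^ Suc i) + 4))))) (I l)"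
    proof (rule tc_Seq[OF meas[of 0]])
      fix W' assume I: "I 0 W'"
      show "tc M X (While (search_test a b)
       (Seq (SetW 7 (Const 0) (Op Mul (Const 2) (reg 7))) measure)) W'
         (1 + (\<Sum>i<l. 1 + (1 + (3 * j (2 ^ Suc i) + 4)))) (I l)"
      proof (rule tc_While[where I = I])
        show "I 0 W'" by (rule I)
      next
        fix i W' assume i: "i \<le> l" and I: "I i W'"
        have W': "W' 0 0 = n" "W' 7 0 = 2 ^ i" "W' 8 0 = j (2 ^ i)"
          using I n by (auto simp: I_def agree_def)
        have "(i < l) = continue n a b (2 ^ i)" using l less i by (metis le_neq_implies_less)
        thus "test_val (W', X) (search_test a b) = (i < l)"
          by (auto simp: search_test_def W' continue_def power4_eq_xxxx mult.assoc)
      next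
        fix i W' assume i: "i < l" and I: "I i W'"
        show "tc M X (Seq (SetW 7 (Const 0) (Op Mul (Const 2) (reg 7))) measure) W'
          (1 + (3 * j (2 ^ Suc i) + 4)) (I (Suc i))"
        proof (rule tc_Seq_SetW[OF _ meas])
          show "wval W' (Op Mul (Const 2) (reg 7)) \<le> M" using I bound(3)[of "Suc i"] i by (simp add: I_def)
        qed (use I i in \<open>auto simp: I_def intro!: agree_upd clean_upd\<close>)
      qed
    qed (use cl \<rho> in \<open>auto intro!: agree_upd clean_upd\<close>)
  qed auto
  moreover have "1 + (3 * j (2 ^ 0) + 4) + (1 + (\<Sum>i<l. 1 + (1 + (3 * j (2 ^ Suc i) + 4))))
     \<le> 7 + (\<Sum>i\<le>l. 3 * j (2 ^ i) + 6)"
  proof -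
    have "(\<Sum>i\<le>l. 3 * j (2 ^ i) + 6) = 3 * j (2 ^ 0) + 6 + (\<Sum>i<l. 3 * j (2 ^ Suc i) + 6)"
      by (simp add: sum.atMost_shift)
    moreover have "(\<Sum>i<l. 1 + (1 + (3 * j (2 ^ Suc i) + 4))) = (\<Sum>i<l. 3 * j (2 ^ Suc i) + 6)"
      by (intro sum.cong) auto
    ultimately show ?thesis by linarith
  qed
  ultimately have "tc M X (search a b) W (7 + (\<Sum>i\<le>l. 3 * j (2 ^ i) + 6)) (\<lambda>W'. agree {5, 6, 7, 8} W W' \<and>
       clean (Suc l) W' \<and> W' 5 0 = Suc l \<and> W' 7 0 = 2 ^ l)"
    by (rule tc_mono) (auto simp: I_def)
  with l less na[of l] show ?thesis by (intro that[of l]) auto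
qed

end

section \<open>Sorting tuples of vertices by weight\<close>

declare One_nat_def [simp del] \<comment> \<open>it would turn \<open>fam 1\<close> into \<open>fam (Suc 0)\<close>\<close>

lemma fam_image [simp]: "v < 20 \<Longrightarrow> v \<notin> fam k ` A"
  "k < 5 \<Longrightarrow> l < 5 \<Longrightarrow> fam k a \<in> fam l ` A \<longleftrightarrow> k = l \<and> a \<in> A"
  by (auto simp: image_iff)

definition dig :: "nat \<Rightarrow> nat \<Rightarrow> nat \<Rightarrow> nat" where "dig n y k = y div n ^ k mod n"

definition digit :: "wexp \<Rightarrow> nat \<Rightarrow> wexp" where
  "digit e k = Op Mod (Op Div e (pw k)) (reg 0)"

lemma wval_digit [simp]: "wval W (digit e k) = dig (W 0 0) (wval W e) k"
  by (simp add: digit_def dig_def)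

lemma dig_less: "0 < n \<Longrightarrow> dig n y k < n" by (simp add: dig_def)

lemma dig_0: "x < n \<Longrightarrow> dig n (x + n * y) 0 = x" by (simp add: dig_def)

lemma dig_Suc: "x < n \<Longrightarrow> dig n (x + n * y) (Suc k) = dig n y k"
  by (simp add: dig_def div_mult2_eq)

lemma dig_surj: "\<forall>k<m. x k < n \<Longrightarrow> \<exists>y<n ^ m. \<forall>k<m. dig n y k = x k"
proof (induction m arbitrary: x)
  case (Suc m)
  obtain y where y: "y < n ^ m" "\<forall>k<m. dig n y k = x (Suc k)"
    using Suc.IH[of "\<lambda>k. x (Suc k)"] Suc.prems by auto
  have x: "x 0 < n" using Suc.prems by simp
  have "x 0 + n * y < n * (y + 1)" using x by (simp add: distrib_left)
  also have "\<dots> \<le> n * n ^ m" using y by (intro mult_le_mono) auto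
  finally have "x 0 + n * y < n ^ Suc m" by simp
  moreover have "dig n (x 0 + n * y) k = x k" if "k < Suc m" for k
    using that y x by (cases k) (auto simp: dig_0 dig_Suc)
  ultimately show ?case by blast
qed simp

text \<open>Numerals are not additive expressions. The empty sum reads a cell of value array 1,
  which is initially zero and which the program leaves alone.\<close>

primrec vsum :: "nat \<Rightarrow> (nat \<Rightarrow> wexp) \<Rightarrow> vexp" where
  "vsum 0 f = VCell 1 (Const 0)"
| "vsum (Suc m) f = VAdd (vsum m f) (VCell 0 (f m))"

lemma vval_vsum: "X 1 0 = 0 \<Longrightarrow> vval (W, X) (vsum m f) = (\<Sum>i<m. X 0 (wval W (f i)))"
  by (induction m) auto

lemma additive_vsum [simp]: "additive (vsum m f)" by (induction m) auto

definition wt :: "(nat \<Rightarrow> real) \<Rightarrow> nat \<Rightarrow> nat \<Rightarrow> nat \<Rightarrow> real" where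
  "wt w n m y = (\<Sum>k<m. w (dig n y k))"

lemma wt_Suc: "x < n \<Longrightarrow> wt w n (Suc m) (x + n * y) = w x + wt w n m y"
  unfolding wt_def by (subst sum.lessThan_Suc_shift) (simp add: dig_0 dig_Suc)

text \<open>The strict variant of \<open>agree\<close> for code that runs no simulation: the
  simulation arrays are preserved too, so \<open>clean\<close> carries over.\<close>

definition same :: "nat set \<Rightarrow> words \<Rightarrow> words \<Rightarrow> bool" where
  "same S W W' \<longleftrightarrow> (\<forall>a. a \<notin> S \<longrightarrow> W' a = W a)"

lemma sameD: "same S W W' \<Longrightarrow> a \<notin> S \<Longrightarrow> W' a = W a" by (simp add: same_def)
lemma same_refl [simp]: "same S W W" by (simp add: same_def)
lemma same_trans: "same S W W' \<Longrightarrow> same S' W' W'' \<Longrightarrow> S \<union> S' \<subseteq> S'' \<Longrightarrow> same S'' W W''"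
  unfolding same_def by (metis UnCI subsetD)
lemma same_upd: "same S W W' \<Longrightarrow> a \<in> S \<Longrightarrow> same S W (W'(a := f))" by (auto simp: same_def)
lemma same_mono: "same S W W' \<Longrightarrow> S \<subseteq> S' \<Longrightarrow> same S' W W'" by (auto simp: same_def)
lemma same_agree: "same S W W' \<Longrightarrow> agree S W W'" by (auto simp: same_def agree_def)
lemma same_clean: "same S W W' \<Longrightarrow> (\<And>a. fam 2 a \<notin> S \<and> fam 3 a \<notin> S) \<Longrightarrow> clean \<rho> W \<Longrightarrow> clean \<rho> W'"
  by (auto simp: same_def clean_def)

definition skip :: com where "skip = SetW 15 (Const 0) (Const 0)"

lemma tc_skip: "Q (W(15 := (W 15)(0 := 0))) \<Longrightarrow> 1 \<le> T \<Longrightarrow> tc M X skip W T Q"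
  unfolding skip_def by (rule tc_SetW) auto

definition sorted_codes :: "(nat \<Rightarrow> real) \<Rightarrow> nat \<Rightarrow> nat \<Rightarrow> (nat \<Rightarrow> nat) \<Rightarrow> bool" where
  "sorted_codes w n m L \<longleftrightarrow> (\<forall>i<n ^ m. L i < n ^ m) \<and>
     (\<forall>i i'. i \<le> i' \<longrightarrow> i' < n ^ m \<longrightarrow> wt w n m (L i) \<le> wt w n m (L i')) \<and>
     (\<forall>y<n ^ m. \<exists>i<n ^ m. L i = y)"

text \<open>One round of an n-way merge sort: head \<open>x\<close> of the \<open>x\<close>-th list is cell \<open>x\<close> of array \<open>fam 1 m\<close>.\<close>

definition head_code :: "nat \<Rightarrow> nat \<Rightarrow> wexp" where
  "head_code m v = Op Add (reg v) (Op Mul (reg 0) (Cell (fam 0 m) (Cell (fam 1 m) (reg v))))"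

text \<open>Cell 0 of array 13 holds the best head so far; the value \<open>n\<close>, which is no
  list number, stands for none.\<close>

definition try_head :: "nat \<Rightarrow> com" where
  "try_head m = Cond (WLess (Cell (fam 1 m) (reg 12)) (pw m))
     (Cond (WLess (reg 13) (reg 0))
       (Cond (VLess (vsum (Suc m) (digit (head_code m 12))) (vsum (Suc m) (digit (head_code m 13))))
          (SetW 13 (Const 0) (reg 12)) skip)
       (SetW 13 (Const 0) (reg 12)))
     skip"

definition select_head :: "nat \<Rightarrow> com" where "select_head m = For 12 (reg 0) (try_head m)"

definition output_head :: "nat \<Rightarrow> com" where
  "output_head m = Seq (SetW (fam 0 (Suc m)) (reg 11) (head_code m 13))
     (SetW (fam 1 m) (reg 13) (Op Add (Cell (fam 1 m) (reg 13)) (Const 1)))"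

definition merge :: "nat \<Rightarrow> com" where
  "merge m = For 11 (pw (Suc m)) (Seq (SetW 13 (Const 0) (reg 0)) (Seq (select_head m) (output_head m)))"

primrec sort_codes :: "nat \<Rightarrow> com" where
  "sort_codes 0 = skip"
| "sort_codes (Suc m) = Seq (sort_codes m) (merge m)"

definition head_weight :: "real vals \<Rightarrow> nat \<Rightarrow> words \<Rightarrow> nat \<Rightarrow> real" where
  "head_weight X m W y = wt (X 0) (W 0 0) (Suc m) (y + W 0 0 * W (fam 0 m) (W (fam 1 m) y))"

definition head_selected :: "real vals \<Rightarrow> nat \<Rightarrow> nat \<Rightarrow> words \<Rightarrow> words \<Rightarrow> bool" where
  "head_selected X m n W W' \<longleftrightarrow> same {12, 13, 15} W W' \<and>
     (let s = W' 13 0 in s < n \<and> W (fam 1 m) s < n ^ m \<and>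
       (\<forall>y<n. W (fam 1 m) y < n ^ m \<longrightarrow> head_weight X m W s \<le> head_weight X m W y))"

lemma select_head:
  assumes X: "X 1 0 = 0" and M: "n \<le> M" and n: "W 0 0 = n" and s: "W 13 0 = n"
    and x: "x < n" "W (fam 1 m) x < n ^ m"
  shows "tc M X (select_head m) W (6 * n + 2) (head_selected X m n W)"
proof -
  let ?val = "head_weight X m W"
  define I where "I x W' \<longleftrightarrow> same {12, 13, 15} W W' \<and> (let s = W' 13 0 in
     (s = n \<and> (\<forall>y<x. n ^ m \<le> W (fam 1 m) y)) \<or> (s < n \<and> W (fam 1 m) s < n ^ m \<and>
       (\<forall>y<x. W (fam 1 m) y < n ^ m \<longrightarrow> ?val s \<le> ?val y)))" for x W'
  have W': "W' 0 0 = n \<and> W' (fam 0 m) = W (fam 0 m) \<and> W' (fam 1 m) = W (fam 1 m)" if "I x W'" for x W'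
    using that n by (auto simp: I_def same_def)
  have vv: "vval (W', X) (vsum (Suc m) (digit (head_code m v))) = ?val (W' v 0)" if "I x W'" for x W' v
    using W'[OF that] X by (simp only: vval_vsum wval_digit head_weight_def wt_def) (simp add: head_code_def n)
  show ?thesis unfolding select_head_def
  proof (rule tc_For[where I = I and m = n and t = 4])
    show "I 0 (W(12 := (W 12)(0 := 0)))" using s by (auto simp: I_def same_def)
  next
    fix i W' assume i: "i < n" and I: "I i W'" and W'12: "W' 12 0 = i"
    have setcase: "tc M X (SetW 13 (Const 0) (reg 12)) W' 1
       (advance I 12 i)"
      if "W (fam 1 m) i < n ^ m" "\<forall>y<i. W (fam 1 m) y < n ^ m \<longrightarrow> ?val i \<le> ?val y"
      using that I W'12 i M by (intro tc_SetW) (auto simp: advance_def I_def same_def less_Suc_eq)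
    have skipcase: "tc M X skip W' 1
       (advance I 12 i)"
      if "\<not> W (fam 1 m) i < n ^ m \<or> (W' 13 0 < n \<and> ?val (W' 13 0) \<le> ?val i)"
      using that I W'12 i by (intro tc_skip) (auto simp: advance_def I_def same_def less_Suc_eq Let_def)
    have le: "\<forall>y<i. W (fam 1 m) y < n ^ m \<longrightarrow> ?val i \<le> ?val y" if "\<not> W' 13 0 < n \<or> ?val i < ?val (W' 13 0)"
      using that I by (force simp: I_def Let_def)
    show "tc M X (try_head m) W' 4 (advance I 12 i)"
      unfolding try_head_def
    proof (rule tc_Cond[where T = 3], goal_cases)
      case 1
      then have lt: "W (fam 1 m) i < n ^ m" using W'[OF I] W'12 by simp
      show ?case
      proof (rule tc_Cond[where T = 2], goal_cases)
        case 1
        then have s13: "W' 13 0 < n" using W'[OF I] by simp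
        show ?case
          by (rule tc_Cond[where T = 1]; (rule setcase[OF lt le] skipcase)?)
            (use vv[OF I] W'12 s13 in \<open>auto simp del: vsum.simps vval.simps simp: not_less\<close>)
      next
        case 2
        then have "\<not> W' 13 0 < n" using W'[OF I] by simp
        then show ?case by (intro tc_mono[OF setcase[OF lt le]]) auto
      qed simp
    next
      case 2
      then have "\<not> W (fam 1 m) i < n ^ m" using W'[OF I] W'12 by simp
      then show ?case by (intro tc_mono[OF skipcase]) auto
    qed simp
  next
    fix W' assume "I n W'"
    then show "head_selected X m n W W'"
      using x by (auto simp: head_selected_def I_def Let_def not_le)
  qed (use W' M in auto)
qed

text \<open>The \<open>x\<close>-th list consists of the codes \<open>x + n * y\<close> with
  \<open>y\<close> running through the sorted \<open>m\<close>-tuples. Prefixing the same vertex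
  adds the same weight everywhere, so all \<open>n\<close> lists are sorted already. Finding the
  least head by inspecting all \<open>n\<close> of them costs a factor \<open>n\<close>, which the
  time bound can afford.\<close>

lemma merge:
  assumes X: "X 1 0 = 0" and n: "0 < n" "W 0 0 = n" and M: "n ^ Suc m \<le> M"
    and L: "sorted_codes (X 0) n m (W (fam 0 m))" and hd: "\<And>x. W (fam 1 m) x = 0"
  shows "tc M X (merge m) W (n ^ Suc m * (6 * n + 7) + 2) (\<lambda>W'.
     same {11, 12, 13, 15, fam 0 (Suc m), fam 1 m} W W' \<and> sorted_codes (X 0) n (Suc m) (W' (fam 0 (Suc m))))"
proof -
  let ?N = "n ^ m" and ?L = "W (fam 0 m)"
  define val where "val y t = wt (X 0) n (Suc m) (y + n * ?L t)" for y t
  have val: "val y t = X 0 y + wt (X 0) n m (?L t)" if "y < n" for y t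
    using that by (simp add: val_def wt_Suc)
  have val_mono: "val y t \<le> val y t'" if "y < n" "t \<le> t'" "t' < ?N" for y t t'
    using that L by (simp add: val sorted_codes_def)
  have code: "y + n * ?L t < n ^ Suc m" if "y < n" "t < ?N" for y t
  proof -
    have "?L t < ?N" using L that by (simp add: sorted_codes_def)
    hence "n * Suc (?L t) \<le> n * ?N" by (intro mult_le_mono) auto
    with that show ?thesis by simp
  qed
  define S where "S = {11, 12, 13, 15, fam 0 (Suc m), fam 1 m}"
  \<comment> \<open>Besides the sortedness of the output, the invariant says that no output exceeds
    a remaining element and that every consumed element has been output. The heads sum to the number
    of outputs.\<close>
  define I where "I i W' \<longleftrightarrow> same S W W' \<and> (let h = W' (fam 1 m); l = W' (fam 0 (Suc m)) in
     (\<forall>y<n. h y \<le> ?N) \<and> (\<Sum>y<n. h y) = i \<and> (\<forall>o'<i. l o' < n ^ Suc m) \<and>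
     (\<forall>o' o''. o' \<le> o'' \<longrightarrow> o'' < i \<longrightarrow> wt (X 0) n (Suc m) (l o') \<le> wt (X 0) n (Suc m) (l o'')) \<and>
     (\<forall>o'<i. \<forall>y<n. \<forall>t<?N. h y \<le> t \<longrightarrow> wt (X 0) n (Suc m) (l o') \<le> val y t) \<and>
     (\<forall>y<n. \<forall>t<h y. \<exists>o'<i. l o' = y + n * ?L t))" for i W'
  have W': "W' 0 0 = n \<and> W' (fam 0 m) = ?L" if "same S W W'" for W'
    using that n by (auto simp: S_def same_def)
  have nM: "n \<le> M" using n M order_trans[of n "n ^ Suc m" M] by simp
  have NM: "?N \<le> M" using n M order_trans[of "?N" "n ^ Suc m" M] by simp
  show ?thesis unfolding merge_def S_def[symmetric]
  proof (rule tc_For[where I = I and m = "n ^ Suc m" and t = "6 * n + 5"])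
    show "I 0 (W(11 := (W 11)(0 := 0)))" using hd by (auto simp: I_def S_def same_def)
  next
    fix i W' assume i: "i < n ^ Suc m" and I: "I i W'" and W'11: "W' 11 0 = i"
    define h where "h = W' (fam 1 m)"
    define l where "l = W' (fam 0 (Suc m))"
    have sm: "same S W W'" and hN: "\<And>y. y < n \<Longrightarrow> h y \<le> ?N" and hs: "(\<Sum>y<n. h y) = i"
      and l1: "\<And>o'. o' < i \<Longrightarrow> l o' < n ^ Suc m"
      and l2: "\<And>o' o''. o' \<le> o'' \<Longrightarrow> o'' < i \<Longrightarrow> wt (X 0) n (Suc m) (l o') \<le> wt (X 0) n (Suc m) (l o'')"
      and l3: "\<And>o' y t. o' < i \<Longrightarrow> y < n \<Longrightarrow> t < ?N \<Longrightarrow> h y \<le> t \<Longrightarrow> wt (X 0) n (Suc m) (l o') \<le> val y t"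
      and l4: "\<And>y t. y < n \<Longrightarrow> t < h y \<Longrightarrow> \<exists>o'<i. l o' = y + n * ?L t"
      using I unfolding I_def Let_def h_def l_def by blast+
    \<comment> \<open>If all lists were exhausted, the heads would sum to \<open>n * n ^ m\<close>,
      but they sum to \<open>i\<close>.\<close>
    have "\<exists>x<n. h x < ?N"
    proof (rule ccontr)
      assume "\<not> ?thesis"
      hence "(\<Sum>y<n. ?N) \<le> (\<Sum>y<n. h y)" by (intro sum_mono) (meson lessThan_iff not_less)
      with hs i show False by simp
    qed
    then obtain x where x: "x < n" "h x < ?N" by blast
    let ?W1 = "W'(13 := (W' 13)(0 := n))"
    show "tc M X (Seq (SetW 13 (Const 0) (reg 0)) (Seq (select_head m) (output_head m))) W' (6 * n + 5)
        (advance I 11 i)"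
    proof (rule tc_Seq_SetW)
      have e: "wval W' (Const 0) = 0" "wval W' (reg 0) = n" using W'[OF sm] by auto
      show "tc M X (Seq (select_head m) (output_head m))
       (W'(13 := (W' 13)(wval W' (Const 0) := wval W' (reg 0)))) (6 * n + 4)
        (advance I 11 i)"
        unfolding e
      proof (rule tc_Seq)
        show "tc M X (select_head m) ?W1 (6 * n + 2) (head_selected X m n ?W1)"
          by (rule select_head) (use X nM W'[OF sm] x h_def in auto)
      next
        fix W'' assume W'': "head_selected X m n ?W1 W''"
        define s where "s = W'' 13 0"
        have s: "s < n" "h s < ?N" "\<And>y. y < n \<Longrightarrow> h y < ?N \<Longrightarrow> val s (h s) \<le> val y (h y)"
          using W'' W'[OF sm] by (auto simp: head_selected_def head_weight_def s_def h_def val_def Let_def)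
        have W''2: "W'' 0 0 = n" "W'' (fam 0 m) = ?L" "W'' (fam 1 m) = h" "W'' (fam 0 (Suc m)) = l" "W'' 11 0 = i"
          using W'' W'[OF sm] W'11 by (auto simp: head_selected_def h_def l_def same_def)
        have hc: "wval W'' (head_code m 13) = s + n * ?L (h s)"
          by (simp add: head_code_def W''2 s_def)
        let ?Wa = "W''(fam 0 (Suc m) := (W'' (fam 0 (Suc m)))(i := s + n * ?L (h s)))"
        let ?Wb = "?Wa(fam 1 m := (?Wa (fam 1 m))(s := Suc (h s)))"
        have sm'': "same S W (?Wb(11 := (?Wb 11)(0 := Suc i)))"
        proof -
          have "same S W' ?W1" by (auto simp: same_def S_def)
          moreover have "same S ?W1 W''" using W'' by (auto simp: head_selected_def same_def S_def)
          ultimately have "same S W W''" using sm same_trans[of S W W' S ?W1 S] same_trans[of S W ?W1 S W'' S] by blast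
          thus ?thesis by (intro same_upd) (auto simp: S_def)
        qed
        have min: "val s (h s) \<le> val y t" if "y < n" "t < ?N" "h y \<le> t" for y t
          using s(3)[of y] val_mono[of y "h y" t] that by linarith
        have "I (Suc i) (?Wb(11 := (?Wb 11)(0 := Suc i)))"
        proof -
          let ?h = "h(s := Suc (h s))" and ?l = "l(i := s + n * ?L (h s))"
          have eqs: "(?Wb(11 := (?Wb 11)(0 := Suc i))) (fam 1 m) = ?h"
            "(?Wb(11 := (?Wb 11)(0 := Suc i))) (fam 0 (Suc m)) = ?l" using W''2 by auto
          have "(\<Sum>y<n. ?h y) = Suc i"
          proof -
            have "(\<Sum>y<n. ?h y) = ?h s + (\<Sum>y\<in>{..<n} - {s}. ?h y)" using s by (intro sum.remove) auto
            also have "(\<Sum>y\<in>{..<n} - {s}. ?h y) = (\<Sum>y\<in>{..<n} - {s}. h y)" by (intro sum.cong) auto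
            also have "?h s + (\<Sum>y\<in>{..<n} - {s}. h y) = Suc (\<Sum>y<n. h y)"
              using s by (subst (2) sum.remove[of _ s]) auto
            finally show ?thesis using hs by simp
          qed
          moreover have "\<forall>y<n. ?h y \<le> ?N" using hN s by auto
          moreover have "\<forall>o'<Suc i. ?l o' < n ^ Suc m" using l1 code[OF s(1,2)] by (auto simp: less_Suc_eq)
          moreover have "wt (X 0) n (Suc m) (?l o') \<le> wt (X 0) n (Suc m) (?l o'')"
            if "o' \<le> o''" "o'' < Suc i" for o' o''
            using that l2 l3[OF _ s(1,2)] by (cases "o'' = i"; cases "o' = i") (auto simp: val_def)
          moreover have "wt (X 0) n (Suc m) (?l o') \<le> val y t" if "o' < Suc i" "y < n" "t < ?N" "?h y \<le> t" for o' y t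
          proof -
            have "h y \<le> t" using that(4) by (auto split: if_splits)
            thus ?thesis using that l3[of o' y t] min[of y t] by (cases "o' = i") (auto simp: val_def)
          qed
          moreover have "\<exists>o'<Suc i. ?l o' = y + n * ?L t" if "y < n" "t < ?h y" for y t
          proof (cases "y = s \<and> t = h s")
            case True
            thus ?thesis by (intro exI[of _ i]) auto
          next
            case False
            hence "t < h y" using that by (auto split: if_splits)
            from l4[OF that(1) this] obtain o' where "o' < i" "l o' = y + n * ?L t" by blast
            thus ?thesis by (intro exI[of _ o']) auto
          qed
          ultimately show ?thesis using sm'' unfolding I_def eqs Let_def by blast
        qed
        moreover have "(?Wb(11 := (?Wb 11)(0 := Suc i))) 11 0 = Suc i" by simp
        ultimately show "tc M X (output_head m) W'' 2
          (advance I 11 i)"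
          unfolding output_head_def
          using code[OF s(1,2)] s M NM
          by (intro tc_Seq_SetW[where T = 1] tc_SetW)
            (auto simp: advance_def hc W''2 s_def[symmetric] simp del: fun_upd_apply, simp_all add: W''2 s_def[symmetric] flip: Suc_eq_plus1)
      qed simp
    qed (use W'[OF sm] nM in auto)
  next
    fix W' assume I: "I (n ^ Suc m) W'"
    define h where "h = W' (fam 1 m)"
    have hN: "\<forall>y<n. h y \<le> ?N" and hs: "(\<Sum>y<n. h y) = n * ?N" using I by (auto simp: I_def Let_def h_def)
    \<comment> \<open>Each head is at most \<open>n ^ m\<close> and they sum to
      \<open>n * n ^ m\<close>, so every list has been consumed entirely and every code was
      output.\<close>
    have full: "h y = ?N" if "y < n" for y
    proof (rule ccontr)
      assume "h y \<noteq> ?N"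
      hence "(\<Sum>y<n. h y) < (\<Sum>y<n. ?N)" using hN that by (intro sum_strict_mono_ex1) (auto intro!: bexI[of _ y] le_neq_implies_less)
      with hs show False by simp
    qed
    have "\<exists>i<n ^ Suc m. W' (fam 0 (Suc m)) i = y" if y: "y < n ^ Suc m" for y
    proof -
      have "y div n < ?N" using y by (intro less_mult_imp_div_less) (simp add: mult.commute)
      then obtain t where t: "t < ?N" "?L t = y div n" using L by (auto simp: sorted_codes_def)
      have "y mod n < n" using n by simp
      moreover have "\<forall>y<n. \<forall>t<h y. \<exists>o'<n ^ Suc m. W' (fam 0 (Suc m)) o' = y + n * ?L t"
        using I unfolding I_def Let_def h_def by blast
      ultimately have "\<exists>o'<n ^ Suc m. W' (fam 0 (Suc m)) o' = y mod n + n * ?L t" using t full by metis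
      thus ?thesis unfolding t(2) by simp
    qed
    with I show "same S W W' \<and> sorted_codes (X 0) n (Suc m) (W' (fam 0 (Suc m)))"
      by (auto simp: I_def Let_def sorted_codes_def)
  next
    fix i W' assume "I i W'"
    hence "same S W W'" by (simp add: I_def)
    from W'[OF this] show "wval W' (pw (Suc m)) = n ^ Suc m" by simp
  qed (use M in auto)
qed

lemma sort_codes:
  assumes X: "X 1 0 = 0" and n: "0 < n" "W 0 0 = n" and M: "n ^ m \<le> M"
    and z: "\<And>k a i. k < 2 \<Longrightarrow> W (fam k a) i = 0"
  shows "tc M X (sort_codes m) W (1 + m * (n ^ m * (6 * n + 7) + 2)) (\<lambda>W'.
     same ({11, 12, 13, 15} \<union> fam 0 ` {1..m} \<union> fam 1 ` {..<m}) W W' \<and> sorted_codes (X 0) n m (W' (fam 0 m)))"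
  using M
proof (induction m)
  case 0
  \<comment> \<open>The only 0-tuple has code 0, and the zero-initialised list contains it
    already.\<close>
  show ?case unfolding sort_codes.simps by (rule tc_skip) (use z[of 0 0 0] in \<open>auto simp: same_def sorted_codes_def\<close>)
next
  case (Suc m)
  have M: "n ^ m \<le> M" using Suc.prems n order_trans[of "n ^ m" "n ^ Suc m" M] by simp
  show ?case unfolding sort_codes.simps
  proof (rule tc_Seq[OF Suc.IH[OF M]])
    fix W' assume W': "same ({11, 12, 13, 15} \<union> fam 0 ` {1..m} \<union> fam 1 ` {..<m}) W W' \<and>
      sorted_codes (X 0) n m (W' (fam 0 m))"
    show "tc M X (merge m) W' (n ^ Suc m * (6 * n + 7) + 2) (\<lambda>W'.
      same ({11, 12, 13, 15} \<union> fam 0 ` {1..Suc m} \<union> fam 1 ` {..<Suc m}) W W' \<and> sorted_codes (X 0) n (Suc m) (W' (fam 0 (Suc m))))"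
    proof (rule tc_mono[OF merge[where X = X and n = n and W = W' and M = M and m = m, OF X n(1) _ Suc.prems]])
      show "W' 0 0 = n" using W' n by (auto simp: same_def)
      show "W' (fam 1 m) x = 0" for x using W' z[of 1 m x] by (auto simp: same_def)
      fix W'' assume W'': "same {11, 12, 13, 15, fam 0 (Suc m), fam 1 m} W' W'' \<and>
         sorted_codes (X 0) n (Suc m) (W'' (fam 0 (Suc m)))"
      have "same ({11, 12, 13, 15} \<union> fam 0 ` {1..Suc m} \<union> fam 1 ` {..<Suc m}) W W''"
        by (rule same_trans[OF conjunct1[OF W'] conjunct1[OF W'']]) auto
      with W'' show "same ({11, 12, 13, 15} \<union> fam 0 ` {1..Suc m} \<union> fam 1 ` {..<Suc m}) W W'' \<and>
         sorted_codes (X 0) n (Suc m) (W'' (fam 0 (Suc m)))" by blast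
    qed (use W' in auto)
  next
    have "n ^ m * (6 * n + 7) \<le> n ^ Suc m * (6 * n + 7)" using n by (intro mult_le_mono) auto
    hence "m * (n ^ m * (6 * n + 7) + 2) \<le> m * (n ^ Suc m * (6 * n + 7) + 2)" by (intro mult_le_mono) auto
    thus "1 + m * (n ^ m * (6 * n + 7) + 2) + (n ^ Suc m * (6 * n + 7) + 2) \<le> 1 + Suc m * (n ^ Suc m * (6 * n + 7) + 2)"
      by simp
  qed
qed

section \<open>Records and tuple tests\<close>

text \<open>An unrolled loop: its length depends on \<open>H\<close> alone and contributes a
  constant factor.\<close>

primrec fill :: "nat \<Rightarrow> (nat \<Rightarrow> wexp) \<Rightarrow> (nat \<Rightarrow> wexp) \<Rightarrow> nat \<Rightarrow> com" where
  "fill a d e 0 = skip"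
| "fill a d e (Suc m) = Seq (fill a d e m) (SetW a (d m) (e m))"

lemma tc_fill:
  assumes "\<And>W' i. same {a, 15} W W' \<Longrightarrow> i < m \<Longrightarrow> wval W' (d i) = d' i \<and> wval W' (e i) = e' i"
    and "inj_on d' {..<m}" and "\<And>i. i < m \<Longrightarrow> e' i \<le> M" and "a < 15"
  shows "tc M X (fill a d e m) W (m + 1) (\<lambda>W'. same {a, 15} W W' \<and>
     (\<forall>i<m. W' a (d' i) = e' i) \<and> (\<forall>x. x \<notin> d' ` {..<m} \<longrightarrow> W' a x = W a x))"
  using assms(1-3)
proof (induction m)
  case 0
  show ?case unfolding fill.simps by (rule tc_skip) (use assms(4) in \<open>auto simp: same_def\<close>)
next
  case (Suc m)
  have "tc M X (fill a d e m) W (m + 1) (\<lambda>W'. same {a, 15} W W' \<and>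
     (\<forall>i<m. W' a (d' i) = e' i) \<and> (\<forall>x. x \<notin> d' ` {..<m} \<longrightarrow> W' a x = W a x))"
    by (rule Suc.IH) (use Suc.prems in \<open>auto simp: inj_on_def\<close>)
  then show ?case unfolding fill.simps
  proof (rule tc_Seq)
    fix W' assume W': "same {a, 15} W W' \<and>
     (\<forall>i<m. W' a (d' i) = e' i) \<and> (\<forall>x. x \<notin> d' ` {..<m} \<longrightarrow> W' a x = W a x)"
    have v: "wval W' (d m) = d' m" "wval W' (e m) = e' m" using Suc.prems(1)[of W' m] W' by auto
    have "d' m \<noteq> d' i \<and> d' i \<noteq> d' m" if "i < m" for i using inj_onD[OF Suc.prems(2), of m i] that by auto
    with W' Suc.prems(3)[of m] show "tc M X (SetW a (d m) (e m)) W' 1 (\<lambda>W'. same {a, 15} W W' \<and>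
     (\<forall>i<Suc m. W' a (d' i) = e' i) \<and> (\<forall>x. x \<notin> d' ` {..<Suc m} \<longrightarrow> W' a x = W a x))"
      by (intro tc_SetW) (auto simp: v less_Suc_eq same_def lessThan_Suc)
  qed simp
qed

text \<open>A candidate consists of a pattern, the tuple of vertices that play its roles, and a record number.\<close>

type_synonym pattern = "(nat \<times> nat) set"
type_synonym candidate = "pattern \<times> (nat \<Rightarrow> nat) \<times> nat"

text \<open>With \<open>m = i * h + k\<close> the index \<open>r * (h * h) + m\<close> is the index
  \<open>(r * h + i) * h + k\<close> that \<open>out_graph\<close> reads.\<close>

definition stored :: "nat \<Rightarrow> words \<Rightarrow> nat \<Rightarrow> pattern \<Rightarrow> (nat \<Rightarrow> nat) \<Rightarrow> bool" where
  "stored h W r E x \<longleftrightarrow> (\<forall>i<h. W 3 (r * h + i) = x i) \<and>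
     (\<forall>m<h * h. W 4 (r * (h * h) + m) = of_bool ((m div h, m mod h) \<in> E))"

definition maximal :: "nat \<Rightarrow> (nat \<Rightarrow> real) \<Rightarrow> candidate set \<Rightarrow> nat \<Rightarrow> (nat \<Rightarrow> nat) \<Rightarrow> bool" where
  "maximal h w S r x \<longleftrightarrow> (\<forall>E' x'. (E', x', r) \<in> S \<longrightarrow> (\<Sum>i<h. w (x' i)) \<le> (\<Sum>i<h. w (x i)))"

text \<open>\<open>S\<close> is a ghost set, the candidates submitted so far. Ties may be resolved
  either way, hence the existential over the stored candidate.\<close>

definition record_ok :: "nat \<Rightarrow> (nat \<Rightarrow> real) \<Rightarrow> words \<Rightarrow> candidate set \<Rightarrow> nat \<Rightarrow> bool" where
  "record_ok h w W S r \<longleftrightarrow> (if \<exists>E x. (E, x, r) \<in> S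
     then W 2 r = 1 \<and> (\<exists>E x. (E, x, r) \<in> S \<and> stored h W r E x \<and> maximal h w S r x) else W 2 r = 0)"

definition records :: "nat \<Rightarrow> (nat \<Rightarrow> real) \<Rightarrow> words \<Rightarrow> candidate set \<Rightarrow> bool" where
  "records h w W S \<longleftrightarrow> (\<forall>r. record_ok h w W S r)"

lemma record_okI:
  "(E, x, r) \<in> S \<Longrightarrow> W 2 r = 1 \<Longrightarrow> stored h W r E x \<Longrightarrow> maximal h w S r x \<Longrightarrow> record_ok h w W S r"
  unfolding record_ok_def by auto

lemma record_okE:
  assumes "record_ok h w W S r" "W 2 r \<noteq> 0"
  obtains E x where "(E, x, r) \<in> S" "W 2 r = 1" "stored h W r E x" "maximal h w S r x"
  using assms unfolding record_ok_def by (cases "\<exists>E x. (E, x, r) \<in> S") auto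

lemma record_ok_cong:
  assumes "record_ok h w W S r" "W' 2 r = W 2 r" "\<And>i. i < h \<Longrightarrow> W' 3 (r * h + i) = W 3 (r * h + i)"
    "\<And>m. m < h * h \<Longrightarrow> W' 4 (r * (h * h) + m) = W 4 (r * (h * h) + m)"
    "\<And>E x. (E, x, r) \<in> S' \<longleftrightarrow> (E, x, r) \<in> S"
  shows "record_ok h w W' S' r"
proof -
  have "stored h W' r E x = stored h W r E x" for E x using assms(3,4) by (simp add: stored_def)
  moreover have "maximal h w S' r x = maximal h w S r x" for x using assms(5) by (simp add: maximal_def)
  ultimately show ?thesis using assms(1,2,5) by (simp add: record_ok_def)
qed

lemma records_cong: "W' 2 = W 2 \<Longrightarrow> W' 3 = W 3 \<Longrightarrow> W' 4 = W 4 \<Longrightarrow> records h w W' S = records h w W S"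
  by (simp add: records_def record_ok_def stored_def)

lemma records_upd [simp]: "a \<notin> {2, 3, 4} \<Longrightarrow> records h w (W(a := f)) S = records h w W S"
  by (rule records_cong) auto

definition write_record :: "nat \<Rightarrow> pattern \<Rightarrow> wexp \<Rightarrow> com" where
  "write_record h E key = Seq (SetW 2 key (Const 1))
     (Seq (fill 3 (\<lambda>i. Op Add (Op Mul key (Const h)) (Const i)) (\<lambda>i. Cell 14 (Const i)) h)
        (fill 4 (\<lambda>m. Op Add (Op Mul key (Const (h * h))) (Const m))
           (\<lambda>m. Const (of_bool ((m div h, m mod h) \<in> E))) (h * h)))"

definition update_record :: "nat \<Rightarrow> pattern \<Rightarrow> wexp \<Rightarrow> com" where
  "update_record h E key = Cond (WLess (Const 0) (Cell 2 key))
     (Cond (VLess (vsum h (\<lambda>i. Cell 3 (Op Add (Op Mul key (Const h)) (Const i)))) (vsum h (\<lambda>i. Cell 14 (Const i))))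
        (write_record h E key) skip)
     (write_record h E key)"

lemma block_index_eq:
  assumes "i < h" "i' < (h::nat)" shows "r * h + i = r' * h + i' \<longleftrightarrow> r = r' \<and> i = i'"
proof
  assume eq: "r * h + i = r' * h + i'"
  have "(r * h + i) div h = (r' * h + i') div h" using eq by simp
  with assms have "r = r'" by simp
  with eq show "r = r' \<and> i = i'" by simp
qed simp

lemma write_record:
  assumes S: "records h w W S" and key: "\<And>W'. same {2, 3, 4, 15} W W' \<Longrightarrow> wval W' key = r"
    and x: "\<And>i. i < h \<Longrightarrow> W 14 i = x i \<and> x i \<le> M" and M: "1 \<le> M"
    and best: "maximal h w S r x"
  shows "tc M X (write_record h E key) W (h * h + h + 3) (\<lambda>W'. same {2, 3, 4, 15} W W' \<and>
     records h w W' (insert (E, x, r) S))"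
  unfolding write_record_def
proof (rule tc_Seq_SetW)
  let ?T = "{2, 3, 4, 15::nat}"
  let ?W1 = "W(2 := (W 2)(wval W key := wval W (Const 1)))"
  have s1: "same ?T W ?W1" by (auto simp: same_def)
  have k: "wval W key = r" using key[of W] by simp
  show "tc M X (Seq (fill 3 (\<lambda>i. Op Add (Op Mul key (Const h)) (Const i)) (\<lambda>i. Cell 14 (Const i)) h)
        (fill 4 (\<lambda>m. Op Add (Op Mul key (Const (h * h))) (Const m))
           (\<lambda>m. Const (of_bool ((m div h, m mod h) \<in> E))) (h * h))) ?W1 (h * h + h + 2)
       (\<lambda>W'. same {2, 3, 4, 15} W W' \<and> records h w W' (insert (E, x, r) S))"
  proof (rule tc_Seq)
    show "tc M X (fill 3 (\<lambda>i. Op Add (Op Mul key (Const h)) (Const i)) (\<lambda>i. Cell 14 (Const i)) h) ?W1 (h + 1)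
      (\<lambda>W'. same {3, 15} ?W1 W' \<and> (\<forall>i<h. W' 3 (r * h + i) = x i) \<and>
         (\<forall>i. i \<notin> (\<lambda>i. r * h + i) ` {..<h} \<longrightarrow> W' 3 i = ?W1 3 i))"
    proof (rule tc_fill)
      fix W' i assume W': "same {3, 15} ?W1 W'" and i: "i < h"
      have "same ?T W W'" by (rule same_trans[OF s1 W']) auto
      from key[OF this] sameD[OF W', of 14] x[OF i] show "wval W' (Op Add (Op Mul key (Const h)) (Const i)) = r * h + i \<and>
         wval W' (Cell 14 (Const i)) = x i" by simp
    qed (use x in \<open>auto simp: inj_on_def\<close>)
  next
    fix W2 assume W2: "same {3, 15} ?W1 W2 \<and> (\<forall>i<h. W2 3 (r * h + i) = x i) \<and>
         (\<forall>i. i \<notin> (\<lambda>i. r * h + i) ` {..<h} \<longrightarrow> W2 3 i = ?W1 3 i)"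
    have s2: "same ?T W W2" by (rule same_trans[OF s1 conjunct1[OF W2]]) auto
    let ?e = "\<lambda>m. of_bool ((m div h, m mod h) \<in> E) :: nat"
    show "tc M X (fill 4 (\<lambda>m. Op Add (Op Mul key (Const (h * h))) (Const m))
           (\<lambda>m. Const (of_bool ((m div h, m mod h) \<in> E))) (h * h)) W2 (h * h + 1)
       (\<lambda>W'. same {2, 3, 4, 15} W W' \<and> records h w W' (insert (E, x, r) S))"
    proof (rule tc_mono[OF tc_fill[where d' = "\<lambda>m. r * (h * h) + m" and e' = ?e]])
      fix W' i assume "same {4, 15} W2 W'"
      hence "same ?T W W'" by (rule same_trans[OF s2]) auto
      from key[OF this] show "wval W' (Op Add (Op Mul key (Const (h * h))) (Const i)) = r * (h * h) + i \<and>
         wval W' (Const (of_bool ((i div h, i mod h) \<in> E))) = ?e i" by simp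
    next
      fix W3 assume W3: "same {4, 15} W2 W3 \<and> (\<forall>i<h * h. W3 4 (r * (h * h) + i) = ?e i) \<and>
         (\<forall>i. i \<notin> (\<lambda>m. r * (h * h) + m) ` {..<h * h} \<longrightarrow> W3 4 i = W2 4 i)"
      have s3: "same ?T W W3" by (rule same_trans[OF s2 conjunct1[OF W3]]) auto
      have r2: "W3 2 = (W 2)(r := 1)" using W3 W2 k by (auto simp: same_def)
      have r3: "W3 3 = W2 3" "W2 4 = W 4" "?W1 3 = W 3" using W3 W2 by (auto simp: same_def)
      have "record_ok h w W3 (insert (E, x, r) S) r'" for r'
      proof (cases "r' = r")
        case True
        have "stored h W3 r E x" using W2 W3 r3 by (simp add: stored_def)
        then show ?thesis unfolding True using r2 best by (intro record_okI[of E x]) (auto simp: maximal_def)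
      next
        case False
        show ?thesis
        proof (rule record_ok_cong)
          show "record_ok h w W S r'" using S by (simp add: records_def)
          show "W3 3 (r' * h + i) = W 3 (r' * h + i)" if "i < h" for i
            using W2 r3 that False block_index_eq[OF that, of _ r' r] by (metis imageE lessThan_iff)
          show "W3 4 (r' * (h * h) + m) = W 4 (r' * (h * h) + m)" if "m < h * h" for m
            using W3 r3 that False block_index_eq[OF that, of _ r' r] by (metis imageE lessThan_iff)
        qed (use r2 False in auto)
      qed
      then have "records h w W3 (insert (E, x, r) S)" by (simp add: records_def)
      with s3 show "same ?T W W3 \<and> records h w W3 (insert (E, x, r) S)" by blast
    qed (use M in \<open>auto simp: inj_on_def\<close>)
  qed simp
qed (use M in auto)

lemma update_record:
  assumes S: "records h w W S" and key: "\<And>W'. same {2, 3, 4, 15} W W' \<Longrightarrow> wval W' key = r"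
    and x: "\<And>i. i < h \<Longrightarrow> W 14 i = x i \<and> x i \<le> M" and M: "1 \<le> M"
    and X: "X 1 0 = 0" "X 0 = w"
  shows "tc M X (update_record h E key) W (h * h + h + 5) (\<lambda>W'. same {2, 3, 4, 15} W W' \<and>
     records h w W' (insert (E, x, r) S))"
  unfolding update_record_def
proof (rule tc_Cond[where T = "h * h + h + 4"], goal_cases)
  have k: "wval W key = r" using key[of W] by simp
  {
    case 1
    then have "W 2 r \<noteq> 0" using k by simp
    then obtain E' x' where E': "(E', x', r) \<in> S" "W 2 r = 1" "stored h W r E' x'" "maximal h w S r x'"
      by (rule record_okE[OF S[unfolded records_def, rule_format]])
    have t: "test_val (W, X) (VLess (vsum h (\<lambda>i. Cell 3 (Op Add (Op Mul key (Const h)) (Const i)))) (vsum h (\<lambda>i. Cell 14 (Const i))))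
       \<longleftrightarrow> (\<Sum>i<h. w (x' i)) < (\<Sum>i<h. w (x i))"
      using X E'(3) x k by (simp add: vval_vsum stored_def)
    show ?case
    proof (rule tc_Cond[where T = "h * h + h + 3"], goal_cases)
      case 1
      then have "maximal h w S r x" unfolding t using E'(4) by (force simp: maximal_def)
      then show ?case by (intro write_record[OF S key x M])
    next
      case 2
      \<comment> \<open>The stored candidate is at least as heavy as the new one, so it remains a
        witness for the enlarged set.\<close>
      then have "maximal h w (insert (E, x, r) S) r x'" using E'(4) unfolding t by (auto simp: maximal_def)
      then have "record_ok h w W (insert (E, x, r) S) r'" for r'
        using S E' by (cases "r' = r") (auto simp: records_def intro: record_okI[of E' x'] record_ok_cong[of h w W S])
      then have "records h w W (insert (E, x, r) S)" by (simp add: records_def)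
      then show ?case by (intro tc_skip) (auto simp: same_upd)
    qed simp
  next
    case 2
    then have "W 2 r = 0" using k by simp
    then have "maximal h w S r x" using S[unfolded records_def, rule_format, of r]
      by (auto simp: record_ok_def maximal_def split: if_splits)
    then show ?case by (intro tc_mono[OF write_record[OF S key x M]]) auto
  }
qed simp

section \<open>Testing tuples by arithmetic expressions\<close>

definition pair_ok :: "bool \<Rightarrow> bool \<Rightarrow> nat \<Rightarrow> (nat \<Rightarrow> nat) \<Rightarrow> nat \<Rightarrow> nat \<Rightarrow> bool" where
  "pair_ok ind e n A x y \<longleftrightarrow> x \<noteq> y \<and> (if e then A (x * n + y) = 1 else ind \<longrightarrow> A (x * n + y) \<noteq> 1)"

text \<open>Branch-free, because matrix entries must be expressions with values 0 and 1. The two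
  truncated differences add up to the distance of \<open>x\<close> and \<open>y\<close>, and
  \<open>1 - (1 - d)\<close> is the indicator of \<open>d > 0\<close>.\<close>

definition pair_exp :: "bool \<Rightarrow> bool \<Rightarrow> wexp \<Rightarrow> wexp \<Rightarrow> wexp" where
  "pair_exp ind e x y = Op Mul
     (Op Sub (Const 1) (Op Sub (Const 1) (Op Add (Op Sub x y) (Op Sub y x))))
     (if e then Cell 1 (Op Add (Op Mul x (reg 0)) y)
      else if ind then Op Sub (Const 1) (Cell 1 (Op Add (Op Mul x (reg 0)) y)) else Const 1)"

lemma wval_pair_exp:
  assumes "\<And>i. W 1 i \<le> 1"
  shows "wval W (pair_exp ind e x y) = of_bool (pair_ok ind e (W 0 0) (W 1) (wval W x) (wval W y))"
proof -
  have "W 1 i = 0 \<or> W 1 i = 1" for i using assms[of i] by linarith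
  from this[of "wval W x * W 0 0 + wval W y"] show ?thesis
    by (auto simp: pair_exp_def pair_ok_def)
qed

definition tuple_ok ::
  "bool \<Rightarrow> pattern \<Rightarrow> nat \<Rightarrow> (nat \<Rightarrow> nat) \<Rightarrow> (nat \<times> nat) list \<Rightarrow> (nat \<Rightarrow> nat) \<Rightarrow> bool" where
  "tuple_ok ind E n A ps x \<longleftrightarrow> (\<forall>(i, k)\<in>set ps. pair_ok ind ((i, k) \<in> E) n A (x i) (x k))"

primrec tuple_exp :: "bool \<Rightarrow> pattern \<Rightarrow> (nat \<times> nat) list \<Rightarrow> (nat \<Rightarrow> wexp) \<Rightarrow> wexp" where
  "tuple_exp ind E [] x = Const 1"
| "tuple_exp ind E (ik # ps) x = Op Mul (pair_exp ind (ik \<in> E) (x (fst ik)) (x (snd ik))) (tuple_exp ind E ps x)"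

lemma wval_tuple_exp:
  assumes "\<And>i. W 1 i \<le> 1"
  shows "wval W (tuple_exp ind E ps x) = of_bool (tuple_ok ind E (W 0 0) (W 1) ps (\<lambda>i. wval W (x i)))"
  by (induction ps) (auto simp: tuple_ok_def wval_pair_exp[of W, OF assms])

definition tup :: "nat \<Rightarrow> nat \<Rightarrow> nat \<Rightarrow> nat \<Rightarrow> nat \<Rightarrow> nat \<Rightarrow> nat \<Rightarrow> nat" where
  "tup n a c u v y k = (if k < a then dig n u k else if k < a + c then dig n v (k - a) else dig n y (k - (a + c)))"

definition tup_exp :: "nat \<Rightarrow> nat \<Rightarrow> wexp \<Rightarrow> wexp \<Rightarrow> wexp \<Rightarrow> nat \<Rightarrow> wexp" where
  "tup_exp a c u v y k = (if k < a then digit u k else if k < a + c then digit v (k - a) else digit y (k - (a + c)))"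

lemma wval_tup_exp [simp]:
  "wval W (tup_exp a c u v y k) = tup (W 0 0) a c (wval W u) (wval W v) (wval W y) k"
  by (simp add: tup_exp_def tup_def)

definition pairs :: "nat \<Rightarrow> (nat \<times> nat) list" where
  "pairs h = filter (\<lambda>(i, k). i < k) (List.product [0..<h] [0..<h])"

text \<open>A pair inside the third group depends on the third tuple alone and could go into either
  factor; it is charged to the left one.\<close>

definition left_pairs :: "nat \<Rightarrow> nat \<Rightarrow> nat \<Rightarrow> (nat \<times> nat) list" where
  "left_pairs a c h = filter (\<lambda>(i, k). a + c \<le> k \<and> (i < a \<or> a + c \<le> i)) (pairs h)"

definition right_pairs :: "nat \<Rightarrow> nat \<Rightarrow> nat \<Rightarrow> (nat \<times> nat) list" where
  "right_pairs a c h = filter (\<lambda>(i, k). a + c \<le> k \<and> a \<le> i \<and> i < a + c) (pairs h)"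

lemma set_pairs: "set (pairs h) = {(i, k). i < k \<and> k < h}"
  by (auto simp: pairs_def)

lemma tuple_ok_left:
  "tuple_ok ind E n A (left_pairs a c h) (tup n a c u v y) = tuple_ok ind E n A (left_pairs a c h) (tup n a c u v' y)"
  unfolding tuple_ok_def left_pairs_def by (intro ball_cong refl) (auto simp: tup_def set_pairs)

lemma tuple_ok_right:
  "tuple_ok ind E n A (right_pairs a c h) (tup n a c u v y) = tuple_ok ind E n A (right_pairs a c h) (tup n a c u' v y)"
  unfolding tuple_ok_def right_pairs_def by (intro ball_cong refl) (auto simp: tup_def set_pairs)

lemma tuple_ok_filter:
  assumes "\<And>ik. P ik \<or> Q ik \<or> R ik"
  shows "tuple_ok ind E n A ps x \<longleftrightarrow> tuple_ok ind E n A (filter P ps) x \<and>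
     tuple_ok ind E n A (filter Q ps) x \<and> tuple_ok ind E n A (filter R ps) x"
  using assms unfolding tuple_ok_def by fastforce

text \<open>The three conjuncts depend on \<open>(u, y)\<close>, \<open>(v, y)\<close> and
  \<open>(u, v)\<close> only. The first two are the factors of the Boolean product with summation
  index \<open>y\<close>. The third is the same for all \<open>y\<close>, so it cannot affect which
  \<open>y\<close> is best.\<close>

lemma tuple_ok_split:
  "tuple_ok ind E n A (pairs h) (tup n a c u v y) \<longleftrightarrow>
     tuple_ok ind E n A (left_pairs a c h) (tup n a c u 0 y) \<and>
     tuple_ok ind E n A (right_pairs a c h) (tup n a c 0 v y) \<and>
     tuple_ok ind E n A (filter (\<lambda>(i, k). k < a + c) (pairs h)) (tup n a c u v 0)"
proof -
  have "tuple_ok ind E n A (pairs h) (tup n a c u v y) \<longleftrightarrow>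
     tuple_ok ind E n A (left_pairs a c h) (tup n a c u v y) \<and>
     tuple_ok ind E n A (right_pairs a c h) (tup n a c u v y) \<and>
     tuple_ok ind E n A (filter (\<lambda>(i, k). k < a + c) (pairs h)) (tup n a c u v y)"
    unfolding left_pairs_def right_pairs_def by (rule tuple_ok_filter) auto
  moreover have "tuple_ok ind E n A (filter (\<lambda>(i, k). k < a + c) (pairs h)) (tup n a c u v y)
     = tuple_ok ind E n A (filter (\<lambda>(i, k). k < a + c) (pairs h)) (tup n a c u v 0)"
    unfolding tuple_ok_def by (intro ball_cong refl) (auto simp: tup_def set_pairs)
  ultimately show ?thesis
    using tuple_ok_left[of ind E n A a c h u v y 0] tuple_ok_right[of ind E n A a c h u v y 0] by blast
qed

section \<open>Scanning and marking\<close>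

text \<open>Rounded up, so that the blocks cover all codes. Padded row and column codes are
  harmless: their digits are vertices, too. Padded ranks are not, and \<open>left_entry\<close>
  excludes them.\<close>

definition tiles :: "nat \<Rightarrow> nat \<Rightarrow> nat \<Rightarrow> nat" where "tiles n D k = n ^ k div D + 1"

definition tiles_exp :: "nat \<Rightarrow> wexp" where
  "tiles_exp k = Op Add (Op Div (pw k) (reg 7)) (Const 1)"

lemma wval_tiles_exp [simp]: "wval W (tiles_exp k) = tiles (W 0 0) (W 7 0) k"
  by (simp add: tiles_exp_def tiles_def)

lemma tiles_cover: "0 < D \<Longrightarrow> n ^ k < tiles n D k * D"
  unfolding tiles_def by (metis Suc_eq_plus1 dividend_less_div_times mult.commute mult_Suc_right add.commute mult_Suc)

text \<open>The records to which a tuple \<open>x\<close> is submitted: those of the pairs \<open>(x 0, x 1)\<close> and \<open>(x 0, x 0)\<close> if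
  there is a record for every pair, and record 0 otherwise.\<close>

definition key1 :: "bool \<Rightarrow> nat \<Rightarrow> (nat \<Rightarrow> nat) \<Rightarrow> nat" where
  "key1 all n x = (if all then x 0 * n + x 1 else 0)"
definition key2 :: "bool \<Rightarrow> nat \<Rightarrow> (nat \<Rightarrow> nat) \<Rightarrow> nat" where
  "key2 all n x = (if all then x 0 * n + x 0 else 0)"
definition key1_exp :: "bool \<Rightarrow> wexp" where
  "key1_exp all = (if all then Op Add (Op Mul (Cell 14 (Const 0)) (reg 0)) (Cell 14 (Const 1)) else Const 0)"
definition key2_exp :: "bool \<Rightarrow> wexp" where
  "key2_exp all = (if all then Op Add (Op Mul (Cell 14 (Const 0)) (reg 0)) (Cell 14 (Const 0)) else Const 0)"

definition candidates ::
  "bool \<Rightarrow> bool \<Rightarrow> pattern \<Rightarrow> nat \<Rightarrow> nat \<Rightarrow> (nat \<Rightarrow> nat) \<Rightarrow> (nat \<Rightarrow> nat) set \<Rightarrow> candidate set" where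
  "candidates all ind E n h A T = {(E, x, r) | x r. x \<in> T \<and> tuple_ok ind E n A (pairs h) x \<and> (r = key1 all n x \<or> r = key2 all n x)}"

lemma candidates_insert:
  "candidates all ind E n h A (insert x T) = candidates all ind E n h A T \<union>
     (if tuple_ok ind E n A (pairs h) x then {(E, x, key1 all n x), (E, x, key2 all n x)} else {})"
  by (auto simp: candidates_def)

definition check_tuple :: "bool \<Rightarrow> bool \<Rightarrow> pattern \<Rightarrow> nat \<Rightarrow> (nat \<Rightarrow> wexp) \<Rightarrow> com" where
  "check_tuple all ind E h x = Seq (fill 14 Const x h)
     (Cond (WLess (Const 0) (tuple_exp ind E (pairs h) (\<lambda>i. Cell 14 (Const i))))
       (Seq (update_record h E (key1_exp all)) (update_record h E (key2_exp all))) skip)"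

lemma tuple_ok_cong:
  "(\<And>i. i < h \<Longrightarrow> x i = y i) \<Longrightarrow> tuple_ok ind E n A (pairs h) x = tuple_ok ind E n A (pairs h) y"
  unfolding tuple_ok_def by (intro ball_cong refl) (auto simp: set_pairs)

lemma check_tuple:
  assumes S: "records h w W S" and n: "W 0 0 = n" and W1: "\<And>i. W 1 i \<le> 1"
    and xe: "\<And>W' i. same {14, 15} W W' \<Longrightarrow> i < h \<Longrightarrow> wval W' (xe i) = x i"
    and x: "\<And>i. i < h \<Longrightarrow> x i \<le> M" and M: "1 \<le> M" and h: "2 \<le> h"
    and X: "X 1 0 = 0" "X 0 = w" and T: "T = 2 * h * h + 3 * h + 12"
  shows "tc M X (check_tuple all ind E h xe) W T (\<lambda>W'. same {2, 3, 4, 14, 15} W W' \<and>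
     records h w W' (S \<union> candidates all ind E n h (W 1) {x}))"
proof -
  let ?S = "{2, 3, 4, 14, 15::nat}"
  let ?Q = "\<lambda>W'. same ?S W W' \<and> records h w W' (S \<union> candidates all ind E n h (W 1) {x})"
  have cand: "candidates all ind E n h (W 1) {x} =
     (if tuple_ok ind E n (W 1) (pairs h) x then {(E, x, key1 all n x), (E, x, key2 all n x)} else {})"
    using candidates_insert[of all ind E n h "W 1" x "{}"] by (auto simp: candidates_def)
  show ?thesis unfolding check_tuple_def
  proof (rule tc_Seq)
    show "tc M X (fill 14 Const xe h) W (h + 1) (\<lambda>W'. same {14, 15} W W' \<and>
     (\<forall>i<h. W' 14 i = x i) \<and> (\<forall>z. z \<notin> (\<lambda>i. i) ` {..<h} \<longrightarrow> W' 14 z = W 14 z))"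
      by (rule tc_fill) (use xe x in auto)
  next
    fix W1 assume W1': "same {14, 15} W W1 \<and> (\<forall>i<h. W1 14 i = x i) \<and>
       (\<forall>z. z \<notin> (\<lambda>i. i) ` {..<h} \<longrightarrow> W1 14 z = W 14 z)"
    have W1_eq: "W1 0 = W 0" "W1 1 = W 1" "W1 2 = W 2" "W1 3 = W 3" "W1 4 = W 4" using W1' by (auto simp: same_def)
    have s1: "same ?S W W1" by (rule same_mono[OF conjunct1[OF W1']]) auto
    have rec1: "records h w W1 S" using S by (simp add: records_cong[of W1 W] W1_eq)
    have ok: "test_val (W1, X) (WLess (Const 0) (tuple_exp ind E (pairs h) (\<lambda>i. Cell 14 (Const i))))
      \<longleftrightarrow> tuple_ok ind E n (W 1) (pairs h) x"
    proof -
      have "tuple_ok ind E n (W 1) (pairs h) (W1 14) = tuple_ok ind E n (W 1) (pairs h) x"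
        by (rule tuple_ok_cong) (use W1' in auto)
      thus ?thesis using W1 n by (simp add: wval_tuple_exp W1_eq)
    qed
    have k1: "wval W' (key1_exp all) = key1 all n x" "wval W' (key2_exp all) = key2 all n x"
      if "same {2, 3, 4, 15} W1 W'" for W'
    proof -
      have "W' 14 = W1 14" "W' 0 = W1 0" using that by (auto simp: same_def)
      thus "wval W' (key1_exp all) = key1 all n x" "wval W' (key2_exp all) = key2 all n x"
        using W1' h n by (auto simp: key1_exp_def key1_def key2_exp_def key2_def W1_eq)
    qed
    show "tc M X (Cond (WLess (Const 0) (tuple_exp ind E (pairs h) (\<lambda>i. Cell 14 (Const i))))
       (Seq (update_record h E (key1_exp all)) (update_record h E (key2_exp all))) skip) W1 (2 * h * h + 2 * h + 11) ?Q"
    proof (rule tc_Cond[where T = "2 * (h * h + h + 5)"])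
      assume "test_val (W1, X) (WLess (Const 0) (tuple_exp ind E (pairs h) (\<lambda>i. Cell 14 (Const i))))"
      hence okx: "tuple_ok ind E n (W 1) (pairs h) x" using ok by simp
      show "tc M X (Seq (update_record h E (key1_exp all)) (update_record h E (key2_exp all))) W1 (2 * (h * h + h + 5)) ?Q"
      proof (rule tc_Seq[OF update_record[OF rec1 k1(1)]])
        fix W2 assume W2: "same {2, 3, 4, 15} W1 W2 \<and> records h w W2 (insert (E, x, key1 all n x) S)"
        have s2: "same ?S W W2" by (rule same_trans[OF s1 conjunct1[OF W2]]) auto
        show "tc M X (update_record h E (key2_exp all)) W2 (h * h + h + 5) ?Q"
        proof (rule tc_mono[OF update_record[OF conjunct2[OF W2]]])
          fix W' assume "same {2, 3, 4, 15} W2 W'"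
          hence "same {2, 3, 4, 15} W1 W'" by (intro same_trans[OF conjunct1[OF W2]]) auto
          from k1(2)[OF this] show "wval W' (key2_exp all) = key2 all n x" .
        next
          fix W3 assume W3: "same {2, 3, 4, 15} W2 W3 \<and>
            records h w W3 (insert (E, x, key2 all n x) (insert (E, x, key1 all n x) S))"
          have "same ?S W W3" by (rule same_trans[OF s2 conjunct1[OF W3]]) auto
          moreover have "S \<union> candidates all ind E n h (W 1) {x} = insert (E, x, key2 all n x) (insert (E, x, key1 all n x) S)"
            using okx cand by auto
          ultimately show "?Q W3" using W3 by simp
        next
          show "W2 14 i = x i \<and> x i \<le> M" if "i < h" for i
            using W1' W2 x that by (auto simp: same_def)
        qed (use M X in auto)
      qed (use W1' x M X in auto)
    next
      assume "\<not> test_val (W1, X) (WLess (Const 0) (tuple_exp ind E (pairs h) (\<lambda>i. Cell 14 (Const i))))"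
      hence "\<not> tuple_ok ind E n (W 1) (pairs h) x" using ok by simp
      with cand have "S \<union> candidates all ind E n h (W 1) {x} = S" by simp
      with s1 rec1 show "tc M X skip W1 (2 * (h * h + h + 5)) ?Q"
        by (intro tc_skip) (auto simp: same_upd)
    qed simp
  qed (simp add: T)
qed

definition columns_exp :: "nat \<Rightarrow> wexp" where "columns_exp c = Op Mul (tiles_exp c) (reg 7)"

lemma wval_columns_exp [simp]: "wval W (columns_exp c) = tiles (W 0 0) (W 7 0) c * W 7 0"
  by (simp add: columns_exp_def)

definition scan_tuple :: "nat \<Rightarrow> nat \<Rightarrow> nat \<Rightarrow> nat \<Rightarrow> nat \<Rightarrow> wexp" where
  "scan_tuple a c b s = (let u = Op Div (reg 10) (reg 7) in
     tup_exp a c (Op Div u (columns_exp c)) (Op Mod u (columns_exp c))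
      (Cell (fam 0 b) (Op Add (Op Mul (Op Sub (Cell (fam 4 s) u) (Const 1)) (reg 7)) (Op Mod (reg 10) (reg 7)))))"

definition scan :: "bool \<Rightarrow> bool \<Rightarrow> pattern \<Rightarrow> nat \<Rightarrow> nat \<Rightarrow> nat \<Rightarrow> nat \<Rightarrow> com" where
  "scan all ind E a c b s = For 10 (Op Mul (Op Mul (Op Mul (tiles_exp a) (reg 7)) (columns_exp c)) (reg 7))
     (check_tuple all ind E (a + c + b) (scan_tuple a c b s))"

text \<open>Where no block was found, \<open>best\<close> is 0 and truncated subtraction selects
  block 0. The tuple obtained there, or past the end of the sorted list, still consists of vertices
  and is tested before it is submitted.\<close>

definition scanned :: "nat \<Rightarrow> nat \<Rightarrow> nat \<Rightarrow> nat \<Rightarrow> (nat \<Rightarrow> nat) \<Rightarrow> (nat \<Rightarrow> nat) \<Rightarrow> nat \<Rightarrow> nat \<Rightarrow> nat" where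
  "scanned n D a c L best z = (let u = z div D; N = tiles n D c * D in
     tup n a c (u div N) (u mod N) (L ((best u - 1) * D + z mod D)))"

lemma scan:
  assumes S: "records h w W S" and n: "0 < n" "W 0 0 = n" and D: "W 7 0 = D" and W1: "\<And>i. W 1 i \<le> 1"
    and h: "h = a + c + b" "2 \<le> h" and M: "n \<le> M" "N \<le> M" and X: "X 1 0 = 0" "X 0 = w"
    and N: "N = tiles n D a * D * (tiles n D c * D) * D"
  shows "tc M X (scan all ind E a c b s) W (N * (2 * h * h + 3 * h + 14) + 2) (\<lambda>W'. same {2, 3, 4, 10, 14, 15} W W' \<and>
     records h w W' (S \<union> candidates all ind E n h (W 1) (scanned n D a c (W (fam 0 b)) (W (fam 4 s)) ` {..<N})))"
proof -
  let ?S = "{2, 3, 4, 10, 14, 15::nat}"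
  let ?x = "scanned n D a c (W (fam 0 b)) (W (fam 4 s))"
  define I where "I z W' \<longleftrightarrow> same ?S W W' \<and> records h w W' (S \<union> candidates all ind E n h (W 1) (?x ` {..<z}))" for z W'
  have W': "W' 0 0 = n \<and> W' 7 0 = D \<and> W' 1 = W 1 \<and> W' (fam 0 b) = W (fam 0 b) \<and> W' (fam 4 s) = W (fam 4 s)"
    if "same ?S W W'" for W' using that n D by (auto simp: same_def)
  show ?thesis unfolding scan_def
  proof (rule tc_For[where I = I and m = N and t = "2 * h * h + 3 * h + 12"])
    show "I 0 (W(10 := (W 10)(0 := 0)))"
      using S by (auto simp: I_def same_upd candidates_def)
    show "wval W' (Op Mul (Op Mul (Op Mul (tiles_exp a) (reg 7)) (columns_exp c)) (reg 7)) = N" if "I i W'" for i W'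
    proof -
      have "same ?S W W'" using that by (simp add: I_def)
      from W'[OF this] show ?thesis by (simp add: N)
    qed
    show "N \<le> M" by fact
    show "N * (2 * h * h + 3 * h + 12 + 2) + 2 \<le> N * (2 * h * h + 3 * h + 14) + 2" by simp
    show "same ?S W W' \<and> records h w W' (S \<union> candidates all ind E n h (W 1) (?x ` {..<N}))" if "I N W'" for W'
      using that by (simp add: I_def)
    fix i W' assume i: "i < N" and I: "I i W'" and W'10: "W' 10 0 = i"
    have sm: "same ?S W W'" using I by (simp add: I_def)
    have lt: "?x i k < n" for k using n by (simp add: scanned_def Let_def tup_def dig_less)
    have "tc M X (check_tuple all ind E h (scan_tuple a c b s)) W' (2 * h * h + 3 * h + 12) (\<lambda>W''. same {2, 3, 4, 14, 15} W' W'' \<and>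
       records h w W'' ((S \<union> candidates all ind E n h (W 1) (?x ` {..<i})) \<union> candidates all ind E n h (W' 1) {?x i}))"
    proof (rule check_tuple)
      fix W'' k assume s: "same {14, 15} W' W''" and "k < h"
      have "same ?S W W''" by (rule same_trans[OF sm s]) auto
      moreover have "W'' 10 0 = i" using s W'10 by (auto simp: same_def)
      ultimately show "wval W'' (scan_tuple a c b s k) = ?x i k"
        using W'[of W''] by (simp add: scan_tuple_def scanned_def Let_def)
    qed (use I W'[OF sm] W1 X M n h less_imp_le[OF lt] order_trans[OF less_imp_le[OF lt]] in \<open>auto simp: I_def\<close>)
    then show "tc M X (check_tuple all ind E (a + c + b) (scan_tuple a c b s)) W' (2 * h * h + 3 * h + 12)
       (advance I 10 i)"
      unfolding h(1)[symmetric]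
    proof (rule tc_mono)
      fix W'' assume W'': "same {2, 3, 4, 14, 15} W' W'' \<and>
       records h w W'' ((S \<union> candidates all ind E n h (W 1) (?x ` {..<i})) \<union> candidates all ind E n h (W' 1) {?x i})"
      have "same ?S W W''" by (rule same_trans[OF sm conjunct1[OF W'']]) auto
      moreover have "candidates all ind E n h (W 1) (?x ` {..<i}) \<union> candidates all ind E n h (W' 1) {?x i}
        = candidates all ind E n h (W 1) (?x ` {..<Suc i})"
        using W'[OF sm] by (auto simp: candidates_def lessThan_Suc)
      ultimately show "advance I 10 i W''"
        using W'' W'10 sameD[OF conjunct1[OF W''], of 10] by (simp add: advance_def I_def Un_assoc same_upd)
    qed simp
  qed
qed

section \<open>Finding the last block with a hit\<close>

text \<open>An entry of the Boolean product for block \<open>K\<close>. Pairs of roles inside the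
  first two groups are absent on purpose.\<close>

definition hit ::
  "bool \<Rightarrow> pattern \<Rightarrow> nat \<Rightarrow> (nat \<Rightarrow> nat) \<Rightarrow> nat \<Rightarrow> nat \<Rightarrow> nat \<Rightarrow> (nat \<Rightarrow> nat) \<Rightarrow> nat \<Rightarrow> nat \<Rightarrow> nat \<Rightarrow> nat \<Rightarrow>
   bool" where
  "hit ind E n A a c b L D K u v \<longleftrightarrow> (\<exists>l<D. K * D + l < n ^ b \<and>
     tuple_ok ind E n A (left_pairs a c (a + c + b)) (tup n a c u 0 (L (K * D + l))) \<and>
     tuple_ok ind E n A (right_pairs a c (a + c + b)) (tup n a c 0 v (L (K * D + l))))"

text \<open>The loop counter \<open>9\<close> encodes the tile with block number \<open>K\<close>, row block \<open>I\<close> and column block \<open>J\<close>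
  as \<open>(K * tiles a + I) * tiles c + J\<close>.\<close>

definition block_exp :: "nat \<Rightarrow> nat \<Rightarrow> wexp" where
  "block_exp a c = Op Div (Op Div (reg 9) (tiles_exp c)) (tiles_exp a)"
definition row_exp :: "nat \<Rightarrow> nat \<Rightarrow> wexp \<Rightarrow> wexp" where
  "row_exp a c i = Op Add (Op Mul (Op Mod (Op Div (reg 9) (tiles_exp c)) (tiles_exp a)) (reg 7)) i"
definition column_exp :: "nat \<Rightarrow> wexp \<Rightarrow> wexp" where
  "column_exp c i = Op Add (Op Mul (Op Mod (reg 9) (tiles_exp c)) (reg 7)) i"
definition rank_exp :: "nat \<Rightarrow> nat \<Rightarrow> wexp \<Rightarrow> wexp" where
  "rank_exp a c i = Op Add (Op Mul (block_exp a c) (reg 7)) i"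

text \<open>The first factor is the indicator of \<open>t < n ^ b\<close>. Without it, a cell past
  the end of the sorted list could cause a hit in the last block that no genuine rank accounts for,
  and this block would hide a better one.\<close>

definition left_entry :: "bool \<Rightarrow> pattern \<Rightarrow> nat \<Rightarrow> nat \<Rightarrow> nat \<Rightarrow> wexp" where
  "left_entry ind E a c b = (let i = Op Div (reg 10) (reg 7); t = rank_exp a c (Op Mod (reg 10) (reg 7)) in
     Op Mul (Op Sub (Const 1) (Op Sub (Const 1) (Op Sub (pw b) t)))
       (tuple_exp ind E (left_pairs a c (a + c + b)) (tup_exp a c (row_exp a c i) (Const 0) (Cell (fam 0 b) t))))"

definition right_entry :: "bool \<Rightarrow> pattern \<Rightarrow> nat \<Rightarrow> nat \<Rightarrow> nat \<Rightarrow> wexp" where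
  "right_entry ind E a c b = tuple_exp ind E (right_pairs a c (a + c + b)) (tup_exp a c (Const 0)
     (column_exp c (Op Mod (reg 10) (reg 7))) (Cell (fam 0 b) (rank_exp a c (Op Div (reg 10) (reg 7)))))"

text \<open>Block \<open>K\<close> is stored as \<open>K + 1\<close>, so that zero-initialised
  memory means that no block was found.\<close>

definition mark_tile :: "nat \<Rightarrow> nat \<Rightarrow> nat \<Rightarrow> com" where
  "mark_tile a c s = For 10 (Op Mul (reg 7) (reg 7))
     (Cond (WLess (Const 0) (Cell (fam 3 2) (enc (reg 10))))
       (SetW (fam 4 s) (Op Add (Op Mul (row_exp a c (Op Div (reg 10) (reg 7))) (columns_exp c))
           (column_exp c (Op Mod (reg 10) (reg 7)))) (Op Add (block_exp a c) (Const 1)))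
       skip)"

context matrix_program begin

definition find_blocks :: "bool \<Rightarrow> pattern \<Rightarrow> nat \<Rightarrow> nat \<Rightarrow> nat \<Rightarrow> nat \<Rightarrow> com" where
  "find_blocks ind E a c b s = For 9 (Op Mul (Op Mul (tiles_exp b) (tiles_exp a)) (tiles_exp c))
     (Seq (product_call p (left_entry ind E a c b) (right_entry ind E a c b))
       (Seq (mark_tile a c s) (SetW 5 (Const 0) (Op Add (reg 5) (Const 1)))))"

end

lemma mark_tile:
  fixes K I J :: nat
  assumes n: "W 0 0 = n" and D: "W 7 0 = D" "0 < D" and q: "W 9 0 = (K * tiles n D a + I) * tiles n D c + J"
    and IJ: "I < tiles n D a" "J < tiles n D c" and M: "Suc K \<le> M" "D * D \<le> M"
  shows "tc M X (mark_tile a c s) W (4 * (D * D) + 2) (\<lambda>W'. same {10, 15, fam 4 s} W W' \<and>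
     (\<forall>u v. u < tiles n D a * D \<longrightarrow> v < tiles n D c * D \<longrightarrow> W' (fam 4 s) (u * (tiles n D c * D) + v) =
        (if u div D = I \<and> v div D = J \<and> 0 < W (fam 3 2) (prod_encode (u mod D * D + v mod D, W 5 0)) then K + 1
         else W (fam 4 s) (u * (tiles n D c * D) + v))))"
proof -
  let ?S = "{10, 15, fam 4 s}" and ?N = "tiles n D c * D"
  define P where "P z \<longleftrightarrow> 0 < W (fam 3 2) (prod_encode (z, W 5 0))" for z
  define In where "In z W' \<longleftrightarrow> same ?S W W' \<and> (\<forall>u v. u < tiles n D a * D \<longrightarrow> v < ?N \<longrightarrow> W' (fam 4 s) (u * ?N + v) =
     (if u div D = I \<and> v div D = J \<and> u mod D * D + v mod D < z \<and> P (u mod D * D + v mod D) then K + 1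
         else W (fam 4 s) (u * ?N + v)))" for z W'
  have W': "W' 0 0 = n \<and> W' 7 0 = D \<and> W' 9 0 = (K * tiles n D a + I) * tiles n D c + J \<and> W' (fam 3 2) = W (fam 3 2) \<and> W' 5 0 = W 5 0"
    if "same ?S W W'" for W' using that n D q by (auto simp: same_def)
  have ev: "wval W' (block_exp a c) = K" "wval W' (row_exp a c i) = I * D + wval W' i"
     "wval W' (column_exp c i) = J * D + wval W' i" if "same ?S W W'" for W' i
    using W'[OF that] IJ by (simp_all add: block_exp_def row_exp_def column_exp_def)
  show ?thesis unfolding mark_tile_def
  proof (rule tc_For[where I = In and m = "D * D" and t = 2])
    show "In 0 (W(10 := (W 10)(0 := 0)))" by (auto simp: In_def same_def)
    show "wval W' (Op Mul (reg 7) (reg 7)) = D * D" if "In i W'" for i W'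
    proof -
      have "same ?S W W'" using that by (simp add: In_def)
      from W'[OF this] show ?thesis by simp
    qed
    show "D * D \<le> M" by fact
    show "D * D * (2 + 2) + 2 \<le> 4 * (D * D) + 2" by simp
    have bd: "u mod D * D + v mod D < D * D" for u v
    proof -
      have "u mod D * D + v mod D < u mod D * D + D" using D by simp
      also have "\<dots> = Suc (u mod D) * D" by simp
      also have "\<dots> \<le> D * D" using D by (intro mult_le_mono) (auto simp: Suc_leI)
      finally show ?thesis .
    qed
    show "same ?S W W' \<and> (\<forall>u v. u < tiles n D a * D \<longrightarrow> v < tiles n D c * D \<longrightarrow> W' (fam 4 s) (u * (tiles n D c * D) + v) =
          (if u div D = I \<and> v div D = J \<and> 0 < W (fam 3 2) (prod_encode (u mod D * D + v mod D, W 5 0)) then K + 1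
           else W (fam 4 s) (u * (tiles n D c * D) + v)))" if "In (D * D) W'" for W'
      using that bd by (auto simp: In_def P_def)
    fix z W' assume z: "z < D * D" and I: "In z W'" and W'10: "W' 10 0 = z"
    have sm: "same ?S W W'" using I by (simp add: In_def)
    have zd: "z div D < D" "z mod D < D" "z div D * D + z mod D = z" using z D by (auto simp: less_mult_imp_div_less)
    have Jlt: "J * D + z mod D < ?N"
    proof -
      have "J * D + z mod D < Suc J * D" using zd by simp
      also have "\<dots> \<le> ?N" using IJ by (intro mult_le_mono) auto
      finally show ?thesis .
    qed
    let ?i = "(I * D + z div D) * ?N + (J * D + z mod D)"
    have idx: "u * ?N + v = ?i \<longleftrightarrow> u div D = I \<and> v div D = J \<and> u mod D * D + v mod D = z" if "v < ?N" for u v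
    proof -
      have "u * ?N + v = ?i \<longleftrightarrow> u = I * D + z div D \<and> v = J * D + z mod D"
        using that Jlt by (rule block_index_eq)
      also have "\<dots> \<longleftrightarrow> u div D = I \<and> v div D = J \<and> u mod D * D + v mod D = z" (is "?l \<longleftrightarrow> ?r")
      proof
        assume ?l thus ?r using zd by simp
      next
        assume r: ?r
        have m: "u mod D < D" "v mod D < D" using D by auto
        have "u mod D * D + v mod D = z div D * D + z mod D" using r zd by simp
        hence "u mod D = z div D \<and> v mod D = z mod D"
          by (rule iffD1[OF block_index_eq[OF m(2) zd(2)]])
        with r show ?l by (metis div_mult_mod_eq)
      qed
      finally show ?thesis .
    qed
    have pe: "(0 < W' (fam 3 2) (prod_encode (z, W' 5 0))) = P z" using W'[OF sm] by (simp add: P_def)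
    show "tc M X (Cond (WLess (Const 0) (Cell (fam 3 2) (enc (reg 10))))
         (SetW (fam 4 s) (Op Add (Op Mul (row_exp a c (Op Div (reg 10) (reg 7))) (columns_exp c))
             (column_exp c (Op Mod (reg 10) (reg 7)))) (Op Add (block_exp a c) (Const 1)))
         skip) W' 2 (advance In 10 z)"
    proof (rule tc_Cond[where T = 1], goal_cases)
      case 1
      hence Pz: "P z" using pe W'10 by simp
      let ?W = "W'(fam 4 s := (W' (fam 4 s))(?i := K + 1))"
      have i: "wval W' (Op Add (Op Mul (row_exp a c (Op Div (reg 10) (reg 7))) (columns_exp c))
             (column_exp c (Op Mod (reg 10) (reg 7)))) = ?i"
        using ev[OF sm] W'[OF sm] W'10 by simp
      have k: "wval W' (Op Add (block_exp a c) (Const 1)) = K + 1" using ev[OF sm] by simp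
      have "In (Suc z) (?W(10 := (?W 10)(0 := Suc z)))"
        unfolding In_def
      proof (intro conjI allI impI)
        show "same ?S W (?W(10 := (?W 10)(0 := Suc z)))" using sm by (auto simp: same_def)
        fix u v assume uv: "u < tiles n D a * D" "v < ?N"
        show "(?W(10 := (?W 10)(0 := Suc z))) (fam 4 s) (u * ?N + v) =
          (if u div D = I \<and> v div D = J \<and> u mod D * D + v mod D < Suc z \<and> P (u mod D * D + v mod D) then K + 1
           else W (fam 4 s) (u * ?N + v))"
          using idx[OF uv(2), of u] I uv Pz by (auto simp: In_def less_Suc_eq)
      qed
      then show ?case using M k W'10 i by (intro tc_SetW) (simp_all only: i k advance_def, simp_all)
    next
      case 2
      hence Pz: "\<not> P z" using pe W'10 by simp
      let ?W = "W'(15 := (W' 15)(0 := 0))"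
      have "In (Suc z) (?W(10 := (?W 10)(0 := Suc z)))"
        unfolding In_def
      proof (intro conjI allI impI)
        show "same ?S W (?W(10 := (?W 10)(0 := Suc z)))" using sm by (auto simp: same_def)
        fix u v assume uv: "u < tiles n D a * D" "v < ?N"
        show "(?W(10 := (?W 10)(0 := Suc z))) (fam 4 s) (u * ?N + v) =
          (if u div D = I \<and> v div D = J \<and> u mod D * D + v mod D < Suc z \<and> P (u mod D * D + v mod D) then K + 1
           else W (fam 4 s) (u * ?N + v))"
          using I uv Pz by (auto simp: In_def less_Suc_eq)
      qed
      then show ?case using W'10 by (intro tc_skip) (auto simp: advance_def)
    qed simp
  qed
qed

section \<open>One labelled pattern\<close>

definition blocks_found ::
  "bool \<Rightarrow> pattern \<Rightarrow> nat \<Rightarrow> (nat \<Rightarrow> nat) \<Rightarrow> nat \<Rightarrow> nat \<Rightarrow> nat \<Rightarrow> (nat \<Rightarrow> nat) \<Rightarrow> nat \<Rightarrow> (nat \<Rightarrow> nat) \<Rightarrow>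
   bool" where
  "blocks_found ind E n A a c b L D best \<longleftrightarrow> (\<forall>u<tiles n D a * D. \<forall>v<tiles n D c * D.
     let K = best (u * (tiles n D c * D) + v) in (K = 0 \<or> hit ind E n A a c b L D (K - 1) u v) \<and>
       (\<forall>K'<tiles n D b. hit ind E n A a c b L D K' u v \<longrightarrow> K' < K))"

text \<open>Domination within the same record, since only one block is scanned for each pair of
  partial assignments. The property is monotone in \<open>S\<close>, which lets the stages be
  combined.\<close>

definition complete_for ::
  "(nat \<Rightarrow> real) \<Rightarrow> bool \<Rightarrow> bool \<Rightarrow> pattern \<Rightarrow> nat \<Rightarrow> nat \<Rightarrow> (nat \<Rightarrow> nat) \<Rightarrow> candidate set \<Rightarrow> bool" where
  "complete_for w all ind E n h A S \<longleftrightarrow> (\<forall>x r. (\<forall>i<h. x i < n) \<longrightarrow> tuple_ok ind E n A (pairs h) x \<longrightarrow>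
     (r = key1 all n x \<or> r = key2 all n x) \<longrightarrow> (\<exists>x'. (E, x', r) \<in> S \<and> (\<Sum>i<h. w (x i)) \<le> (\<Sum>i<h. w (x' i))))"

lemma sum_tup:
  "(\<Sum>i<a + c + b. w (tup n a c u v y i)) = wt w n a u + wt w n c v + wt w n b y"
proof -
  have split: "(\<Sum>i<m + k. f i) = (\<Sum>i<m. f i) + (\<Sum>i<k. f (m + i))" for m k and f :: "nat \<Rightarrow> real"
    by (induction k) auto
  have "(\<Sum>i<a + c + b. w (tup n a c u v y i)) = (\<Sum>i<a. w (tup n a c u v y i)) +
      (\<Sum>i<c. w (tup n a c u v y (a + i))) + (\<Sum>i<b. w (tup n a c u v y (a + c + i)))"
    by (simp only: split)
  thus ?thesis by (simp add: tup_def wt_def)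
qed

text \<open>Let \<open>y\<close> be the part of a copy in the third group. Either its rank lies in
  the marked block and the copy itself is scanned, or it lies in an earlier block, and then any hit
  of the marked block is at least as heavy. Exchanging \<open>y\<close> for the hit keeps the first
  two groups and hence their mutual compatibility.\<close>

lemma complete_for_scanned:
  fixes n D a b c :: nat
  defines "N \<equiv> tiles n D a * D * (tiles n D c * D) * D" and "h \<equiv> a + c + b"
  assumes n: "0 < n" and D: "0 < D" and L: "sorted_codes w n b L" and ac: "2 \<le> a + c"
    and best: "blocks_found ind E n A a c b L D best"
  shows "complete_for w all ind E n h A (candidates all ind E n h A (scanned n D a c L best ` {..<N}))"
  unfolding complete_for_def
proof (intro allI impI)
  let ?N = "tiles n D c * D"
  fix x r assume x: "\<forall>i<h. x i < n" and ok: "tuple_ok ind E n A (pairs h) x"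
    and r: "r = key1 all n x \<or> r = key2 all n x"
  obtain u where u: "u < n ^ a" "\<forall>k<a. dig n u k = x k" using dig_surj[of a x n] x by (auto simp: h_def)
  obtain v where v: "v < n ^ c" "\<forall>k<c. dig n v k = x (a + k)"
    using dig_surj[of c "\<lambda>k. x (a + k)" n] x by (auto simp: h_def)
  obtain y where y: "y < n ^ b" "\<forall>k<b. dig n y k = x (a + c + k)"
    using dig_surj[of b "\<lambda>k. x (a + c + k)" n] x by (auto simp: h_def)
  have xt: "x i = tup n a c u v y i" if "i < h" for i
    using that u v y by (auto simp: tup_def h_def)
  obtain t where t: "t < n ^ b" "L t = y" using L y by (auto simp: sorted_codes_def)
  have "tuple_ok ind E n A (pairs h) (tup n a c u v y)"
    using ok tuple_ok_cong[of h x "tup n a c u v y"] xt by blast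
  hence left: "tuple_ok ind E n A (left_pairs a c h) (tup n a c u 0 y)"
    and right: "tuple_ok ind E n A (right_pairs a c h) (tup n a c 0 v y)"
    and rest: "tuple_ok ind E n A (filter (\<lambda>(i, k). k < a + c) (pairs h)) (tup n a c u v 0)"
    using tuple_ok_split by blast+
  have td: "t div D * D + t mod D = t" "t mod D < D" using D by auto
  have hit: "hit ind E n A a c b L D (t div D) u v"
    unfolding hit_def using td t left right by (intro exI[of _ "t mod D"]) (simp add: h_def)
  have uv: "u < tiles n D a * D" "v < ?N" using u v tiles_cover[OF D, of n] by (meson less_trans)+
  have tb: "t div D < tiles n D b"
    using t tiles_cover[OF D, of n b] by (intro less_mult_imp_div_less) (meson less_trans)
  let ?K = "best (u * ?N + v)"
  have best': "?K = 0 \<or> hit ind E n A a c b L D (?K - 1) u v" and K: "t div D < ?K"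
    using best uv tb hit unfolding blocks_found_def Let_def by blast+
  hence "hit ind E n A a c b L D (?K - 1) u v" by simp
  then obtain l where l: "l < D" "(?K - 1) * D + l < n ^ b"
    "tuple_ok ind E n A (left_pairs a c h) (tup n a c u 0 (L ((?K - 1) * D + l)))"
    "tuple_ok ind E n A (right_pairs a c h) (tup n a c 0 v (L ((?K - 1) * D + l)))" unfolding hit_def h_def by blast
  \<comment> \<open>The position to scan: that of \<open>y\<close> if \<open>y\<close> lies in the
    marked block, otherwise that of a hit which must exist there.\<close>
  define l' where "l' = (if t div D = ?K - 1 then t mod D else l)"
  define y' where "y' = L ((?K - 1) * D + l')"
  have l': "l' < D" "tuple_ok ind E n A (left_pairs a c h) (tup n a c u 0 y')"
    "tuple_ok ind E n A (right_pairs a c h) (tup n a c 0 v y')" "wt w n b y \<le> wt w n b y'"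
  proof -
    have "l' < D \<and> tuple_ok ind E n A (left_pairs a c h) (tup n a c u 0 y') \<and>
      tuple_ok ind E n A (right_pairs a c h) (tup n a c 0 v y') \<and> wt w n b y \<le> wt w n b y'"
    proof (cases "t div D = ?K - 1")
      case True
      hence "y' = y" using td t by (simp add: y'_def l'_def flip: True)
      thus ?thesis using left right td True by (simp add: l'_def)
    next
      case False
      hence "Suc (t div D) * D \<le> (?K - 1) * D" using K by (intro mult_le_mono) auto
      moreover have "t < Suc (t div D) * D" using D by (metis dividend_less_div_times mult.commute mult_Suc_right add.commute mult_Suc)
      ultimately have "t \<le> (?K - 1) * D + l" by linarith
      hence "wt w n b (L t) \<le> wt w n b (L ((?K - 1) * D + l))" using L l by (auto simp: sorted_codes_def)
      thus ?thesis using False l t by (simp add: y'_def l'_def)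
    qed
    thus "l' < D" "tuple_ok ind E n A (left_pairs a c h) (tup n a c u 0 y')"
      "tuple_ok ind E n A (right_pairs a c h) (tup n a c 0 v y')" "wt w n b y \<le> wt w n b y'" by blast+
  qed
  let ?z = "(u * ?N + v) * D + l'" and ?x' = "tup n a c u v y'"
  have zN: "?z < N"
  proof -
    have "u * ?N + v < u * ?N + ?N" using uv by simp
    also have "\<dots> = Suc u * ?N" by simp
    also have "\<dots> \<le> tiles n D a * D * ?N" using uv by (intro mult_le_mono) auto
    finally have "Suc (u * ?N + v) * D \<le> N" unfolding N_def by (intro mult_le_mono) auto
    with l' show ?thesis by simp
  qed
  have "scanned n D a c L best ?z = ?x'"
  proof -
    have "(u * N' + v) div N' = u" "(u * N' + v) mod N' = v" if "v < N'" for N' using that by simp_all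
    from this[OF uv(2)] have "(u * ?N + v) div ?N = u" "(u * ?N + v) mod ?N = v" by blast+
    moreover have "?z div D = u * ?N + v" "?z mod D = l'" using l'(1) by simp_all
    ultimately show ?thesis by (simp only: scanned_def Let_def y'_def)
  qed
  hence x'T: "?x' \<in> scanned n D a c L best ` {..<N}" using zN by (metis imageI lessThan_iff)
  have ok': "tuple_ok ind E n A (pairs h) ?x'" using tuple_ok_split l' rest by blast
  \<comment> \<open>Roles 0 and 1 belong to the first two groups because
    \<open>2 \<le> a + c\<close>. They are untouched by the exchange, so the record number is the
    same.\<close>
  have "?x' i = x i" if "i < 2" for i using xt[of i] that ac by (auto simp: tup_def h_def)
  hence "r = key1 all n ?x' \<or> r = key2 all n ?x'" using r by (auto simp: key1_def key2_def)
  hence "(E, ?x', r) \<in> candidates all ind E n h A (scanned n D a c L best ` {..<N})"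
    using x'T ok' by (auto simp: candidates_def)
  moreover have "(\<Sum>i<h. w (x i)) \<le> (\<Sum>i<h. w (?x' i))"
  proof -
    have "(\<Sum>i<h. w (x i)) = (\<Sum>i<h. w (tup n a c u v y i))" using xt by simp
    thus ?thesis unfolding h_def sum_tup using l' by simp
  qed
  ultimately show "\<exists>x'. (E, x', r) \<in> candidates all ind E n h A (scanned n D a c L best ` {..<N}) \<and>
     (\<Sum>i<h. w (x i)) \<le> (\<Sum>i<h. w (x' i))" by blast
qed

definition sound_for ::
  "bool \<Rightarrow> bool \<Rightarrow> pattern set \<Rightarrow> nat \<Rightarrow> nat \<Rightarrow> (nat \<Rightarrow> nat) \<Rightarrow> candidate set \<Rightarrow> bool" where
  "sound_for all ind Es n h A S \<longleftrightarrow> (\<forall>(E, x, r)\<in>S. E \<in> Es \<and> (\<forall>i<h. x i < n) \<and> tuple_ok ind E n A (pairs h) x \<and>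
     (r = key1 all n x \<or> r = key2 all n x))"

definition solved ::
  "(nat \<Rightarrow> real) \<Rightarrow> bool \<Rightarrow> bool \<Rightarrow> pattern set \<Rightarrow> nat \<Rightarrow> nat \<Rightarrow> (nat \<Rightarrow> nat) \<Rightarrow> candidate set \<Rightarrow> words \<Rightarrow>
   bool" where
  "solved w all ind Es n h A S W \<longleftrightarrow> (\<exists>S'. records h w W (S \<union> S') \<and> sound_for all ind Es n h A S' \<and>
     (\<forall>E\<in>Es. complete_for w all ind E n h A S'))"

context matrix_program begin

text \<open>The block number is the leading digit of the loop counter. For each pair
  \<open>u\<close>, \<open>v\<close> the blocks are thus met in increasing order and later marks
  overwrite earlier ones, which leaves the last hit. Every product uses up one simulation number,
  hence \<open>\<rho> + Q\<close>.\<close>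

lemma find_blocks:
  fixes n D a b c :: nat and W :: words and ind :: bool and E
  defines "Q \<equiv> tiles n D b * tiles n D a * tiles n D c"
    and "L \<equiv> W (fam 0 b)" and "A \<equiv> W 1"
  assumes n: "0 < n" "W 0 0 = n" and D: "W 7 0 = D" "0 < D" and W1: "\<And>i. W 1 i \<le> 1"
    and cl: "clean \<rho> W" "W 5 0 = \<rho>" and z: "\<And>i. W (fam 4 s) i = 0"
    and M: "B D \<le> M" "j D \<le> M" "Suc D \<le> M" "\<rho> + Q \<le> M"
  shows "tc M X (find_blocks ind E a c b s) W (Q * (8 * (D * D) + 3 * j D + 9) + 2) (\<lambda>W'.
     agree {5, 6, 9, 10, 15, fam 4 s} W W' \<and> clean (\<rho> + Q) W' \<and> W' 5 0 = \<rho> + Q \<and>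
     blocks_found ind E n A a c b L D (W' (fam 4 s)))"
proof -
  let ?S = "{5, 6, 9, 10, 15, fam 4 s}" and ?N = "tiles n D c * D"
  let ?hit = "hit ind E n A a c b L D"
  let ?ta = "tiles n D a" and ?tc = "tiles n D c"
  have pos: "0 < ?ta" "0 < ?tc" by (auto simp: tiles_def)
  define I where "I q W' \<longleftrightarrow> agree ?S W W' \<and> clean (\<rho> + q) W' \<and> W' 5 0 = \<rho> + q \<and>
     (\<forall>u v. u < ?ta * D \<longrightarrow> v < ?N \<longrightarrow> (let K = W' (fam 4 s) (u * ?N + v) in
        (K = 0 \<or> ?hit (K - 1) u v) \<and>
        (\<forall>K'. (K' * ?ta + u div D) * ?tc + v div D < q \<longrightarrow> ?hit K' u v \<longrightarrow> K' < K)))" for q W'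
  have W': "W' 0 0 = n \<and> W' 7 0 = D \<and> W' 1 = A \<and> W' (fam 0 b) = L" if "agree ?S W W'" for W'
    using that n D by (auto simp: agree_def A_def L_def)
  have DM: "D * D \<le> M" using square_le[of D] M by linarith
  show ?thesis unfolding find_blocks_def
  proof (rule tc_For[where I = I and m = Q and t = "8 * (D * D) + 3 * j D + 7"])
    show "I 0 (W(9 := (W 9)(0 := 0)))" using cl z by (auto simp: I_def agree_def clean_def)
    show "wval W' (Op Mul (Op Mul (tiles_exp b) (tiles_exp a)) (tiles_exp c)) = Q" if "I i W'" for i W'
    proof -
      have "agree ?S W W'" using that by (simp add: I_def)
      from W'[OF this] show ?thesis by (simp add: Q_def)
    qed
    show "Q \<le> M" using M by simp
    fix q W' assume q: "q < Q" and I: "I q W'" and W'9: "W' 9 0 = q"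
    have ag: "agree ?S W W'" using I by (simp add: I_def)
    define K where "K = q div ?tc div ?ta"
    define r where "r = q div ?tc mod ?ta"
    define k where "k = q mod ?tc"
    have rk: "r < ?ta" "k < ?tc" using pos by (auto simp: r_def k_def)
    have qK: "q = (K * ?ta + r) * ?tc + k" unfolding K_def r_def k_def by simp
    have KQ: "Suc K \<le> Q"
    proof -
      have "K \<le> q" unfolding K_def by (meson div_le_dividend order_trans)
      with q show ?thesis by simp
    qed
    define f1 :: "nat \<Rightarrow> nat" where "f1 z = of_bool (K * D + z mod D < n ^ b \<and>
      tuple_ok ind E n A (left_pairs a c (a + c + b)) (tup n a c (r * D + z div D) 0 (L (K * D + z mod D))))" for z
    define f2 :: "nat \<Rightarrow> nat" where "f2 z = of_bool (
      tuple_ok ind E n A (right_pairs a c (a + c + b)) (tup n a c 0 (k * D + z mod D) (L (K * D + z div D))))" for z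
    have "tc M X (product_call p (left_entry ind E a c b) (right_entry ind E a c b)) W' (4 * (D * D) + 4 + 3 * j D)
       (\<lambda>W''. agree {6, 10} W' W'' \<and> clean (Suc (\<rho> + q)) W'' \<and>
       (\<forall>i<D. \<forall>i'<D. (0 < W'' (fam 3 2) (prod_encode (i * D + i', \<rho> + q))) = (\<exists>l<D. f1 (i * D + l) = 1 \<and> f2 (l * D + i') = 1)))"
    proof (rule product_call)
      fix W'' z assume ag': "agree {6, 10} W' W''" and z: "W'' 10 0 = z"
      have ag'': "agree ?S W W''" by (rule agree_trans[OF ag ag']) auto
      have "W'' 9 0 = q" using agreeD[OF ag', of 9] W'9 by simp
      hence ev: "wval W'' (block_exp a c) = K" "wval W'' (row_exp a c i) = r * D + wval W'' i"
        "wval W'' (column_exp c i) = k * D + wval W'' i" for i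
        using W'[OF ag''] by (simp_all add: block_exp_def row_exp_def column_exp_def K_def r_def k_def)
      have W1'': "W'' 1 i \<le> 1" for i using W'[OF ag''] W1 by (simp add: A_def)
      have guard: "1 - (1 - (x - y)) = of_bool (y < x)" for x y :: nat by auto
      have "wval W'' (left_entry ind E a c b) = f1 z"
        using W'[OF ag''] z
        by (simp add: left_entry_def Let_def wval_tuple_exp[of W'', OF W1''] rank_exp_def ev f1_def guard del: diff_diff_cancel)
      moreover have "wval W'' (right_entry ind E a c b) = f2 z"
        using W'[OF ag''] z
        by (simp add: right_entry_def Let_def wval_tuple_exp[of W'', OF W1''] rank_exp_def ev f2_def)
      ultimately show "wval W'' (left_entry ind E a c b) = f1 z \<and> wval W'' (right_entry ind E a c b) = f2 z" by blast
    qed (use I W'[OF ag] M in \<open>auto simp: I_def f1_def f2_def\<close>)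
    then show "tc M X (Seq (product_call p (left_entry ind E a c b) (right_entry ind E a c b))
       (Seq (mark_tile a c s) (SetW 5 (Const 0) (Op Add (reg 5) (Const 1))))) W' (8 * (D * D) + 3 * j D + 7)
         (advance I 9 q)"
    proof (rule tc_Seq)
      fix W2 assume W2: "agree {6, 10} W' W2 \<and> clean (Suc (\<rho> + q)) W2 \<and>
       (\<forall>i<D. \<forall>i'<D. (0 < W2 (fam 3 2) (prod_encode (i * D + i', \<rho> + q))) = (\<exists>l<D. f1 (i * D + l) = 1 \<and> f2 (l * D + i') = 1))"
      have ag2: "agree ?S W W2" by (rule agree_trans[OF ag conjunct1[OF W2]]) auto
      have W25: "W2 5 0 = \<rho> + q" "W2 9 0 = q" "W2 (fam 4 s) = W' (fam 4 s)"
        using agreeD[OF conjunct1[OF W2]] I W'9 by (auto simp: I_def)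
      have hitK: "(0 < W2 (fam 3 2) (prod_encode (u mod D * D + v mod D, \<rho> + q))) = ?hit K u v"
        if "u div D = r" "v div D = k" for u v
      proof -
        have uv: "r * D + u mod D = u" "k * D + v mod D = v" using that by auto
        have "u mod D < D" "v mod D < D" using D by auto
        hence "(0 < W2 (fam 3 2) (prod_encode (u mod D * D + v mod D, \<rho> + q))) =
           (\<exists>l<D. f1 (u mod D * D + l) = 1 \<and> f2 (l * D + v mod D) = 1)" using W2 by blast
        also have "\<dots> = ?hit K u v"
        proof -
          have "f1 (u mod D * D + l) = 1 \<longleftrightarrow> K * D + l < n ^ b \<and>
              tuple_ok ind E n A (left_pairs a c (a + c + b)) (tup n a c u 0 (L (K * D + l)))" if "l < D" for l
            using that uv by (simp add: f1_def)
          moreover have "f2 (l * D + v mod D) = 1 \<longleftrightarrow>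
              tuple_ok ind E n A (right_pairs a c (a + c + b)) (tup n a c 0 v (L (K * D + l)))" if "l < D" for l
            using that uv by (simp add: f2_def)
          ultimately show ?thesis unfolding hit_def by blast
        qed
        finally show ?thesis .
      qed
      show "tc M X (Seq (mark_tile a c s) (SetW 5 (Const 0) (Op Add (reg 5) (Const 1)))) W2 (4 * (D * D) + 3)
         (advance I 9 q)"
      proof (rule tc_Seq[OF mark_tile[where K = K and I = r and J = k]])
        fix W3 assume W3: "same {10, 15, fam 4 s} W2 W3 \<and>
          (\<forall>u v. u < ?ta * D \<longrightarrow> v < ?N \<longrightarrow> W3 (fam 4 s) (u * ?N + v) =
            (if u div D = r \<and> v div D = k \<and> 0 < W2 (fam 3 2) (prod_encode (u mod D * D + v mod D, W2 5 0)) then K + 1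
             else W2 (fam 4 s) (u * ?N + v)))"
        have ag3: "agree ?S W W3" by (rule agree_trans[OF ag2 same_agree[OF conjunct1[OF W3]]]) auto
        have cl3: "clean (\<rho> + Suc q) W3" using same_clean[OF conjunct1[OF W3]] W2 by auto
        have W35: "W3 5 0 = \<rho> + q" "W3 9 0 = q" using W3 W25 by (auto simp: same_def)
        let ?W = "W3(5 := (W3 5)(0 := Suc (\<rho> + q)))"
        let ?W' = "?W(9 := (?W 9)(0 := Suc q))"
        have "I (Suc q) ?W'"
          unfolding I_def
        proof (intro conjI allI impI)
          show "agree ?S W ?W'" using ag3 by (intro agree_upd) auto
          show "clean (\<rho> + Suc q) ?W'" using cl3 by (intro clean_upd) auto
          show "?W' 5 0 = \<rho> + Suc q" by simp
          fix u v assume uv: "u < ?ta * D" "v < ?N"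
          let ?K = "W3 (fam 4 s) (u * ?N + v)" and ?prev = "W' (fam 4 s) (u * ?N + v)"
          have c: "(u div D = r \<and> v div D = k \<and> 0 < W2 (fam 3 2) (prod_encode (u mod D * D + v mod D, \<rho> + q))) =
            (u div D = r \<and> v div D = k \<and> ?hit K u v)" using hitK by blast
          have new: "?K = (if u div D = r \<and> v div D = k \<and> ?hit K u v then K + 1 else ?prev)"
            using conjunct2[OF W3, rule_format, OF uv] unfolding W25 c .
          have old: "?prev = 0 \<or> ?hit (?prev - 1) u v"
            "\<And>K'. (K' * ?ta + u div D) * ?tc + v div D < q \<Longrightarrow> ?hit K' u v \<Longrightarrow> K' < ?prev"
            using I uv unfolding I_def Let_def by blast+
          have lt: "u div D < ?ta" "v div D < ?tc" using uv D by (auto simp: less_mult_imp_div_less)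
          have "?K = 0 \<or> ?hit (?K - 1) u v" using new old(1) by auto
          moreover have "K' < ?K" if K': "(K' * ?ta + u div D) * ?tc + v div D < Suc q" "?hit K' u v" for K'
          proof (cases "(K' * ?ta + u div D) * ?tc + v div D = q")
            case True
            hence "K' * ?ta + u div D = K * ?ta + r \<and> v div D = k"
              unfolding qK by (rule iffD1[OF block_index_eq[OF lt(2) rk(2)]])
            hence "K' = K \<and> u div D = r \<and> v div D = k" using block_index_eq[OF lt(1) rk(1), of K' K] by blast
            thus ?thesis using new K' by simp
          next
            case False
            hence less: "(K' * ?ta + u div D) * ?tc + v div D < q" using K' by simp
            show ?thesis
            proof (cases "u div D = r \<and> v div D = k \<and> ?hit K u v")
              case True
              \<comment> \<open>A larger leading digit would make the counter value at least
                \<open>q\<close>.\<close>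
              have "K' \<le> K"
              proof (rule ccontr)
                assume "\<not> K' \<le> K"
                hence "q \<le> (K' * ?ta + u div D) * ?tc + v div D"
                  unfolding qK using True by (intro add_mono mult_le_mono) auto
                with less show False by simp
              qed
              thus ?thesis using new True by simp
            next
              case False
              hence "?K = ?prev" unfolding new by (rule if_not_P)
              thus ?thesis using old(2)[OF less K'(2)] by simp
            qed
          qed
          ultimately show "let K = ?W' (fam 4 s) (u * ?N + v) in
            (K = 0 \<or> ?hit (K - 1) u v) \<and>
            (\<forall>K'. (K' * ?ta + u div D) * ?tc + v div D < Suc q \<longrightarrow> ?hit K' u v \<longrightarrow> K' < K)"
            by (simp add: Let_def)
        qed
        moreover have "?W 9 0 = q" using W35 by simp
        ultimately show "tc M X (SetW 5 (Const 0) (Op Add (reg 5) (Const 1))) W3 1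
           (advance I 9 q)"
          using W35 M q by (intro tc_SetW) (simp_all add: advance_def flip: Suc_eq_plus1)
      next
        show "W2 9 0 = (K * ?ta + r) * ?tc + k" using W25 qK by simp
      qed (use W'[OF ag2] D rk KQ M DM in auto)
    qed simp
  next
    show "Q * (8 * (D * D) + 3 * j D + 7 + 2) + 2 \<le> Q * (8 * (D * D) + 3 * j D + 9) + 2" by simp
  next
    fix W' assume I: "I Q W'"
    have "K' < W' (fam 4 s) (u * ?N + v)" if "u < ?ta * D" "v < ?N" "K' < tiles n D b" "?hit K' u v" for u v K'
    proof -
      have "u div D < ?ta" "v div D < ?tc" using that D by (auto simp: less_mult_imp_div_less)
      have "(K' * ?ta + u div D) * ?tc + v div D < (K' * ?ta + u div D) * ?tc + ?tc" using \<open>v div D < ?tc\<close> by simp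
      also have "\<dots> = (K' * ?ta + Suc (u div D)) * ?tc" by simp
      also have "\<dots> \<le> (K' * ?ta + ?ta) * ?tc" using \<open>u div D < ?ta\<close> by (intro mult_le_mono) auto
      also have "\<dots> = Suc K' * ?ta * ?tc" by simp
      also have "\<dots> \<le> Q" unfolding Q_def using that by (intro mult_le_mono) auto
      finally show ?thesis using I that unfolding I_def Let_def by blast
    qed
    with I show "agree ?S W W' \<and> clean (\<rho> + Q) W' \<and> W' 5 0 = \<rho> + Q \<and>
     blocks_found ind E n A a c b L D (W' (fam 4 s))"
      unfolding I_def blocks_found_def Let_def by blast
  qed
qed

definition stage :: "bool \<Rightarrow> bool \<Rightarrow> pattern \<Rightarrow> nat \<Rightarrow> nat \<Rightarrow> nat \<Rightarrow> nat \<Rightarrow> com" where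
  "stage all ind E a c b s = Seq (find_blocks ind E a c b s) (scan all ind E a c b s)"

lemma stage:
  fixes n D a b c :: nat
  defines "Q \<equiv> tiles n D b * tiles n D a * tiles n D c" and "N \<equiv> tiles n D a * D * (tiles n D c * D) * D"
    and "h \<equiv> a + c + b"
  assumes n: "0 < n" "W 0 0 = n" and D: "W 7 0 = D" "0 < D" and W1: "\<And>i. W 1 i \<le> 1"
    and cl: "clean \<rho> W" "W 5 0 = \<rho>" and z: "\<And>i. W (fam 4 s) i = 0"
    and L: "sorted_codes w n b (W (fam 0 b))" and ac: "2 \<le> a + c" and S: "records h w W S"
    and M: "B D \<le> M" "j D \<le> M" "Suc D \<le> M" "\<rho> + Q \<le> M" "n \<le> M" "N \<le> M" and X: "X 1 0 = 0" "X 0 = w"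
  shows "tc M X (stage all ind E a c b s) W (Q * (8 * (D * D) + 3 * j D + 9) + N * (2 * h * h + 3 * h + 14) + 4) (\<lambda>W'.
     agree {2, 3, 4, 5, 6, 9, 10, 14, 15, fam 4 s} W W' \<and> clean (\<rho> + Q) W' \<and> W' 5 0 = \<rho> + Q \<and>
     solved w all ind {E} n h (W 1) S W')"
  unfolding stage_def
proof (rule tc_Seq)
  show "tc M X (find_blocks ind E a c b s) W (Q * (8 * (D * D) + 3 * j D + 9) + 2) (\<lambda>W'.
     agree {5, 6, 9, 10, 15, fam 4 s} W W' \<and> clean (\<rho> + Q) W' \<and> W' 5 0 = \<rho> + Q \<and>
     blocks_found ind E n (W 1) a c b (W (fam 0 b)) D (W' (fam 4 s)))"
    unfolding Q_def by (rule find_blocks) (use assms in auto)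
next
  fix W1 assume W1': "agree {5, 6, 9, 10, 15, fam 4 s} W W1 \<and> clean (\<rho> + Q) W1 \<and> W1 5 0 = \<rho> + Q \<and>
     blocks_found ind E n (W 1) a c b (W (fam 0 b)) D (W1 (fam 4 s))"
  have eqs: "W1 0 = W 0" "W1 1 = W 1" "W1 2 = W 2" "W1 3 = W 3" "W1 4 = W 4" "W1 7 = W 7" "W1 (fam 0 b) = W (fam 0 b)"
    using agreeD[OF conjunct1[OF W1']] by simp_all
  have comp: "complete_for w all ind E n h (W 1)
     (candidates all ind E n h (W 1) (scanned n D a c (W (fam 0 b)) (W1 (fam 4 s)) ` {..<N}))"
    unfolding h_def N_def using W1' by (intro complete_for_scanned n D L ac) blast
  have sound: "sound_for all ind {E} n h (W 1)
     (candidates all ind E n h (W 1) (scanned n D a c (W (fam 0 b)) (W1 (fam 4 s)) ` {..<N}))"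
    using n by (auto simp: sound_for_def candidates_def scanned_def Let_def tup_def dig_less)
  show "tc M X (scan all ind E a c b s) W1 (N * (2 * h * h + 3 * h + 14) + 2) (\<lambda>W'.
     agree {2, 3, 4, 5, 6, 9, 10, 14, 15, fam 4 s} W W' \<and> clean (\<rho> + Q) W' \<and> W' 5 0 = \<rho> + Q \<and>
     solved w all ind {E} n h (W 1) S W')"
  proof (rule tc_mono[OF scan[where h = h and n = n and D = D]])
    show "records h w W1 S" using S by (simp add: records_cong[of W1 W] eqs)
    fix W2 assume W2: "same {2, 3, 4, 10, 14, 15} W1 W2 \<and>
     records h w W2 (S \<union> candidates all ind E n h (W1 1) (scanned n D a c (W1 (fam 0 b)) (W1 (fam 4 s)) ` {..<N}))"
    have "agree {2, 3, 4, 5, 6, 9, 10, 14, 15, fam 4 s} W W2"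
      by (rule agree_trans[OF conjunct1[OF W1'] same_agree[OF conjunct1[OF W2]]]) auto
    moreover have "clean (\<rho> + Q) W2" using same_clean[OF conjunct1[OF W2]] W1' by auto
    moreover have "W2 5 0 = \<rho> + Q" using W1' sameD[OF conjunct1[OF W2], of 5] by simp
    ultimately show "agree {2, 3, 4, 5, 6, 9, 10, 14, 15, fam 4 s} W W2 \<and> clean (\<rho> + Q) W2 \<and> W2 5 0 = \<rho> + Q \<and>
     solved w all ind {E} n h (W 1) S W2"
      using W2 comp sound unfolding eqs solved_def by blast
  qed (use eqs n D W1 M X ac in \<open>auto simp: h_def N_def\<close>)
qed simp

end

section \<open>The complete program\<close>

context matrix_program begin

text \<open>Every labelling marks its blocks in an array of its own, which is still zero when its
  stage begins.\<close>

primrec stages :: "bool \<Rightarrow> bool \<Rightarrow> nat \<Rightarrow> nat \<Rightarrow> nat \<Rightarrow> nat \<Rightarrow> pattern list \<Rightarrow> com" where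
  "stages all ind a c b s [] = skip"
| "stages all ind a c b s (E # Es) = Seq (stage all ind E a c b s) (stages all ind a c b (Suc s) Es)"

definition stage_time :: "nat \<Rightarrow> nat \<Rightarrow> nat \<Rightarrow> nat \<Rightarrow> nat \<Rightarrow> nat" where
  "stage_time n D a c b = tiles n D b * tiles n D a * tiles n D c * (8 * (D * D) + 3 * j D + 9) +
     tiles n D a * D * (tiles n D c * D) * D * (2 * (a + c + b) * (a + c + b) + 3 * (a + c + b) + 14) + 4"

lemma stages:
  fixes n D a b c :: nat
  defines "Q \<equiv> tiles n D b * tiles n D a * tiles n D c" and "N \<equiv> tiles n D a * D * (tiles n D c * D) * D"
    and "h \<equiv> a + c + b"
  assumes n: "0 < n" "W 0 0 = n" and D: "W 7 0 = D" "0 < D" and W1: "W 1 = A" "\<And>i. A i \<le> 1"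
    and cl: "clean \<rho> W" "W 5 0 = \<rho>" and z: "\<And>i s'. s \<le> s' \<Longrightarrow> W (fam 4 s') i = 0"
    and L: "sorted_codes w n b (W (fam 0 b))" and ac: "2 \<le> a + c" and S: "records h w W S"
    and M: "B D \<le> M" "j D \<le> M" "Suc D \<le> M" "\<rho> + length Es * Q \<le> M" "n \<le> M" "N \<le> M" and X: "X 1 0 = 0" "X 0 = w"
  shows "tc M X (stages all ind a c b s Es) W (length Es * stage_time n D a c b + 1) (solved w all ind (set Es) n h A S)"
  using n D W1 cl z L S M
proof (induction Es arbitrary: W s \<rho> S)
  case Nil
  show ?case unfolding stages.simps
    by (rule tc_skip) (use Nil.prems in \<open>auto simp: solved_def sound_for_def simp del: fun_upd_apply intro!: exI[of _ "{}"]\<close>)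
next
  case (Cons E Es)
  note prems = Cons.prems
  show ?case unfolding stages.simps
  proof (rule tc_Seq)
    show "tc M X (stage all ind E a c b s) W (stage_time n D a c b) (\<lambda>W'.
     agree {2, 3, 4, 5, 6, 9, 10, 14, 15, fam 4 s} W W' \<and> clean (\<rho> + Q) W' \<and> W' 5 0 = \<rho> + Q \<and>
     solved w all ind {E} n h (W 1) S W')"
      unfolding stage_time_def h_def Q_def
      by (rule stage) (use prems X ac in \<open>auto simp: h_def Q_def N_def\<close>)
  next
    fix W1 assume *: "agree {2, 3, 4, 5, 6, 9, 10, 14, 15, fam 4 s} W W1 \<and> clean (\<rho> + Q) W1 \<and> W1 5 0 = \<rho> + Q \<and>
     solved w all ind {E} n h (W 1) S W1"
    then obtain S1 where S1: "records h w W1 (S \<union> S1)" "sound_for all ind {E} n h A S1"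
      "complete_for w all ind E n h A S1" using prems by (auto simp: solved_def)
    have eqs: "W1 0 = W 0" "W1 7 = W 7" "W1 1 = W 1" "W1 (fam 0 b) = W (fam 0 b)"
      "\<And>s'. Suc s \<le> s' \<Longrightarrow> W1 (fam 4 s') = W (fam 4 s')"
      using agreeD[OF conjunct1[OF *]] by auto
    show "tc M X (stages all ind a c b (Suc s) Es) W1 (length Es * stage_time n D a c b + 1) (\<lambda>W'.
     solved w all ind (set (E # Es)) n h A S W')"
    proof (rule tc_mono[OF Cons.IH])
      show "records h w W1 (S \<union> S1)" by (rule S1)
      fix W' assume "solved w all ind (set Es) n h A (S \<union> S1) W'"
      then obtain S2 where S2: "records h w W' (S \<union> (S1 \<union> S2))" "sound_for all ind (set Es) n h A S2"
        "\<forall>E\<in>set Es. complete_for w all ind E n h A S2" by (auto simp: solved_def Un_assoc)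
      have mono: "complete_for w all ind E' n h A T \<Longrightarrow> T \<subseteq> T' \<Longrightarrow> complete_for w all ind E' n h A T'" for E' T T'
        unfolding complete_for_def by blast
      have "sound_for all ind (set (E # Es)) n h A (S1 \<union> S2)"
        using S1 S2 unfolding sound_for_def by auto
      moreover have "\<forall>E\<in>set (E # Es). complete_for w all ind E n h A (S1 \<union> S2)"
        using S1(3) S2(3) mono[of _ S1 "S1 \<union> S2"] mono[of _ S2 "S1 \<union> S2"] by auto
      ultimately show "solved w all ind (set (E # Es)) n h A S W'" using S2(1) unfolding solved_def by blast
    qed (use prems eqs * in \<open>auto simp: add.assoc\<close>)
  qed simp
qed

definition solver :: "bool \<Rightarrow> bool \<Rightarrow> nat \<Rightarrow> nat \<Rightarrow> nat \<Rightarrow> pattern list \<Rightarrow> com" where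
  "solver all ind a c b Es = Cond (WLess (Const 0) (reg 0))
     (Seq (sort_codes b) (Seq (search a b) (stages all ind a c b 0 Es))) skip"

definition solver_time :: "nat \<Rightarrow> nat \<Rightarrow> nat \<Rightarrow> nat \<Rightarrow> nat \<Rightarrow> nat \<Rightarrow> nat" where
  "solver_time e n l a c b = 12 + b * (n ^ b * (6 * n + 7) + 2) + (\<Sum>i\<le>l. 3 * j (2 ^ i) + 6) +
     e * stage_time n (2 ^ l) a c b"

lemma solver:
  fixes n a b c :: nat and W :: words and X :: "real vals"
  defines "A \<equiv> W 1" and "h \<equiv> a + c + b"
  assumes n: "0 < n" "W 0 0 = n" and W1: "\<And>i. A i \<le> 1"
    and z: "\<And>v i. 2 \<le> v \<Longrightarrow> W v i = 0" and ac: "2 \<le> a + c" and X: "X 1 0 = 0" "X 0 = w"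
    and M: "n ^ b \<le> M" "n \<le> M" "\<And>D. 0 < D \<Longrightarrow> D \<le> n ^ a \<Longrightarrow> B D \<le> M \<and> j D \<le> M \<and>
        D + 1 + length Es * (tiles n D b * tiles n D a * tiles n D c) \<le> M \<and>
        tiles n D a * D * (tiles n D c * D) * D \<le> M"
  obtains l where "2 ^ l \<le> n ^ a" "\<not> continue n a b (2 ^ l)" "\<And>i. i < l \<Longrightarrow> continue n a b (2 ^ i)"
    "tc M X (solver all ind a c b Es) W (solver_time (length Es) n l a c b)
       (solved w all ind (set Es) n h A {})"
proof -
  have fam_ge: "2 \<le> fam k a" for k a by (simp add: fam_def)
  let ?T = "{11, 12, 13, 15} \<union> fam 0 ` {1..b} \<union> fam 1 ` {..<b}"
  have sort: "tc M X (sort_codes b) W (1 + b * (n ^ b * (6 * n + 7) + 2)) (\<lambda>W'. same ?T W W' \<and>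
     sorted_codes (X 0) n b (W' (fam 0 b)))"
    by (rule sort_codes) (use n X M z fam_ge in auto)
  have clean: "clean 0 W" using z fam_ge by (simp add: clean_def)
  have pre: "clean 0 W'" "W' 5 0 = 0" "W' 0 0 = n" "W' 1 = A" "W' 2 = W 2" "W' (fam 4 s) = W (fam 4 s)"
    if "same ?T W W'" for W' s
    using same_clean[OF that _ clean] sameD[OF that] n z by (auto simp: A_def)
  obtain W0 where W0: "same ?T W W0 \<and> sorted_codes (X 0) n b (W0 (fam 0 b))" using sort unfolding tc_def by blast
  have srch: "\<exists>l. 2 ^ l \<le> n ^ a \<and> \<not> continue n a b (2 ^ l) \<and> (\<forall>i<l. continue n a b (2 ^ i)) \<and>
    tc M X (search a b) W' (7 + (\<Sum>i\<le>l. 3 * j (2 ^ i) + 6)) (\<lambda>W''. agree {5, 6, 7, 8} W' W'' \<and>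
       clean (Suc l) W'' \<and> W'' 5 0 = Suc l \<and> W'' 7 0 = 2 ^ l)" if st: "same ?T W W'" for W'
  proof -
    have *: "B D \<le> M \<and> j D \<le> M \<and> Suc D \<le> M" if "0 < D" "D \<le> n ^ a" for D
      using M(3)[OF that] by auto
    obtain l where "2 ^ l \<le> n ^ a" "\<not> continue n a b (2 ^ l)" "\<And>i. i < l \<Longrightarrow> continue n a b (2 ^ i)"
      "tc M X (search a b) W' (7 + (\<Sum>i\<le>l. 3 * j (2 ^ i) + 6)) (\<lambda>W''. agree {5, 6, 7, 8} W' W'' \<and>
       clean (Suc l) W'' \<and> W'' 5 0 = Suc l \<and> W'' 7 0 = 2 ^ l)"
      using search[where X = X and b = b, OF n(1) pre(3)[OF st] pre(1)[OF st] pre(2)[OF st] *] by blast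
    thus ?thesis by blast
  qed
  obtain l where l: "2 ^ l \<le> n ^ a" "\<not> continue n a b (2 ^ l)" "\<And>i. i < l \<Longrightarrow> continue n a b (2 ^ i)"
    using srch[of W0] W0 by blast
  \<comment> \<open>\<open>continue\<close> does not look at the memory, so the search stops at the
    same \<open>l\<close> from every sorted state. This permits fixing \<open>l\<close> by means of
    the sample state \<open>W0\<close> before the run is composed.\<close>
  have unique: "l' = l" if "\<not> continue n a b (2 ^ l')" "\<forall>i<l'. continue n a b (2 ^ i)" for l'
    using l that by (metis linorder_neqE_nat)
  let ?R = "solved w all ind (set Es) n h A {}"
  have rest: "tc M X (Seq (search a b) (stages all ind a c b 0 Es)) W'
     (7 + (\<Sum>i\<le>l. 3 * j (2 ^ i) + 6) + (length Es * stage_time n (2 ^ l) a c b + 1)) ?R"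
    if W': "same ?T W W' \<and> sorted_codes (X 0) n b (W' (fam 0 b))" for W'
  proof (rule tc_Seq)
    show "tc M X (search a b) W' (7 + (\<Sum>i\<le>l. 3 * j (2 ^ i) + 6)) (\<lambda>W''. agree {5, 6, 7, 8} W' W'' \<and>
       clean (Suc l) W'' \<and> W'' 5 0 = Suc l \<and> W'' 7 0 = 2 ^ l)"
      using srch[OF conjunct1[OF W']] unique by blast
    fix W1 assume W1': "agree {5, 6, 7, 8} W' W1 \<and> clean (Suc l) W1 \<and> W1 5 0 = Suc l \<and> W1 7 0 = 2 ^ l"
    have eqs: "W1 0 = W' 0" "W1 1 = W' 1" "W1 2 = W' 2" "W1 (fam 0 b) = W' (fam 0 b)" "\<And>s. W1 (fam 4 s) = W' (fam 4 s)"
      using agreeD[OF conjunct1[OF W1']] by auto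
    note pre' = pre[OF conjunct1[OF W']]
    have "Suc l \<le> 2 ^ l + 1" using less_exp[of l] by linarith
    moreover have "2 ^ l + 1 + length Es * (tiles n (2 ^ l) b * tiles n (2 ^ l) a * tiles n (2 ^ l) c) \<le> M"
      using M(3)[OF _ l(1)] by simp
    ultimately have M': "Suc l + length Es * (tiles n (2 ^ l) b * tiles n (2 ^ l) a * tiles n (2 ^ l) c) \<le> M"
      by linarith
    show "tc M X (stages all ind a c b 0 Es) W1 (length Es * stage_time n (2 ^ l) a c b + 1) ?R"
      unfolding h_def
    proof (rule stages)
      show "records (a + c + b) w W1 {}" using z by (simp add: records_def record_ok_def eqs pre')
      show "W1 (fam 4 s') i = 0" for s' i using z fam_ge by (simp add: eqs pre')
      show "Suc l + length Es * (tiles n (2 ^ l) b * tiles n (2 ^ l) a * tiles n (2 ^ l) c) \<le> M" by (rule M')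
    qed (use n eqs pre' W1 W1' W' ac X M(2) M(3)[OF _ l(1)] in auto)
  qed simp
  have "tc M X (solver all ind a c b Es) W (solver_time (length Es) n l a c b) ?R"
    unfolding solver_def
  proof (rule tc_Cond)
    show "tc M X (Seq (sort_codes b) (Seq (search a b) (stages all ind a c b 0 Es))) W
       (1 + b * (n ^ b * (6 * n + 7) + 2) + (7 + (\<Sum>i\<le>l. 3 * j (2 ^ i) + 6) + (length Es * stage_time n (2 ^ l) a c b + 1))) ?R"
      by (rule tc_Seq[OF sort]) (rule rest, assumption, simp)
  qed (use n in \<open>auto simp: solver_time_def\<close>)
  with l show ?thesis by (intro that)
qed

end

section \<open>Patterns and subgraphs\<close>

definition labellings :: "'a graph \<Rightarrow> nat \<Rightarrow> pattern set" where
  "labellings H h = {E. \<exists>\<sigma>. bij_betw \<sigma> {..<h} (verts H) \<and> E = {(i, k). i < h \<and> k < h \<and> {\<sigma> i, \<sigma> k} \<in> edges H}}"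

lemma finite_labellings: "finite (labellings H h)"
  by (rule finite_subset[of _ "Pow ({..<h} \<times> {..<h})"]) (auto simp: labellings_def)

definition pattern_graph :: "nat \<Rightarrow> pattern \<Rightarrow> (nat \<Rightarrow> nat) \<Rightarrow> nat graph" where
  "pattern_graph h E x = (x ` {..<h}, {{x i, x k} | i k. (i, k) \<in> E})"

definition occurs :: "bool \<Rightarrow> 'a graph \<Rightarrow> nat graph \<Rightarrow> nat graph \<Rightarrow> bool" where
  "occurs ind H G K \<longleftrightarrow> (if ind then induced_H_subgraph H G K else H_subgraph H G K)"

definition adjacency :: "nat \<Rightarrow> nat graph \<Rightarrow> nat \<Rightarrow> nat" where
  "adjacency n G i = (if i < n * n \<and> {i div n, i mod n} \<in> edges G then 1 else 0)"

lemma adjacency: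
  assumes "u < n" "v < n" shows "adjacency n G (u * n + v) = 1 \<longleftrightarrow> {u, v} \<in> edges G"
proof -
  have "u * n + v < Suc u * n" using assms by simp
  also have "\<dots> \<le> n * n" using assms by (intro mult_le_mono) auto
  finally show ?thesis using assms by (simp add: adjacency_def)
qed

lemma labellingE:
  assumes "E \<in> labellings H h" "simple_graph H"
  obtains \<sigma> where "bij_betw \<sigma> {..<h} (verts H)" "E = {(i, k). i < h \<and> k < h \<and> {\<sigma> i, \<sigma> k} \<in> edges H}"
    "\<forall>i k. (i, k) \<in> E \<longrightarrow> i \<noteq> k \<and> i < h \<and> k < h \<and> (k, i) \<in> E"
    "edges H = {{\<sigma> i, \<sigma> k} | i k. (i, k) \<in> E}"
proof -
  obtain \<sigma> where \<sigma>: "bij_betw \<sigma> {..<h} (verts H)" and E: "E = {(i, k). i < h \<and> k < h \<and> {\<sigma> i, \<sigma> k} \<in> edges H}"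
    using assms(1) unfolding labellings_def by blast
  have "i \<noteq> k" if "(i, k) \<in> E" for i k
  proof
    assume "i = k"
    hence "card {\<sigma> i, \<sigma> k} = 2" using that assms(2) E unfolding simple_graph_def by blast
    with \<open>i = k\<close> show False by simp
  qed
  hence 1: "\<forall>i k. (i, k) \<in> E \<longrightarrow> i \<noteq> k \<and> i < h \<and> k < h \<and> (k, i) \<in> E"
    using E by (auto simp: insert_commute)
  have "edges H = {{\<sigma> i, \<sigma> k} | i k. (i, k) \<in> E}"
  proof (intro equalityI subsetI)
    fix e assume e: "e \<in> edges H"
    hence "e \<subseteq> verts H" "card e = 2" using assms(2) by (auto simp: simple_graph_def)
    then obtain p q where "e = {p, q}" "p \<in> verts H" "q \<in> verts H" by (auto simp: card_2_iff)
    moreover from this have "p \<in> \<sigma> ` {..<h}" "q \<in> \<sigma> ` {..<h}" using \<sigma> by (simp_all add: bij_betw_def)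
    then obtain i k where "i < h" "k < h" "p = \<sigma> i" "q = \<sigma> k" by blast
    ultimately show "e \<in> {{\<sigma> i, \<sigma> k} | i k. (i, k) \<in> E}" using e E by blast
  next
    fix e assume "e \<in> {{\<sigma> i, \<sigma> k} | i k. (i, k) \<in> E}"
    thus "e \<in> edges H" using E by blast
  qed
  from that[OF \<sigma> E 1 this] show ?thesis by blast
qed

lemma tuple_ok_inj:
  assumes "tuple_ok ind E n A (pairs h) x"
  shows "inj_on x {..<h}"
proof (rule inj_onI, rule ccontr)
  fix i k assume ik: "i \<in> {..<h}" "k \<in> {..<h}" "x i = x k" "i \<noteq> k"
  hence "(i, k) \<in> set (pairs h) \<or> (k, i) \<in> set (pairs h)" by (auto simp: set_pairs)
  with assms ik show False by (auto simp: tuple_ok_def pair_ok_def)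
qed

lemma weight_pattern_graph:
  "inj_on x {..<h} \<Longrightarrow> weight w (pattern_graph h E x) = (\<Sum>i<h. w (x i))"
  by (simp add: weight_def pattern_graph_def sum.reindex)

text \<open>The isomorphism sends the vertex \<open>x i\<close> to the vertex
  \<open>\<sigma> i\<close> of \<open>H\<close> that the labelling puts into role
  \<open>i\<close>.\<close>

lemma occurs_pattern_graph:
  assumes H: "simple_graph H" and G: "simple_graph G" "verts G = {..<n}" and E: "E \<in> labellings H h"
    and x: "\<forall>i<h. x i < n" and ok: "tuple_ok ind E n (adjacency n G) (pairs h) x"
  shows "occurs ind H G (pattern_graph h E x)"
proof -
  let ?K = "pattern_graph h E x"
  obtain \<sigma> where \<sigma>: "bij_betw \<sigma> {..<h} (verts H)" and E': "E = {(i, k). i < h \<and> k < h \<and> {\<sigma> i, \<sigma> k} \<in> edges H}"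
    and Es': "\<forall>i k. (i, k) \<in> E \<longrightarrow> i \<noteq> k \<and> i < h \<and> k < h \<and> (k, i) \<in> E"
    and eH: "edges H = {{\<sigma> i, \<sigma> k} | i k. (i, k) \<in> E}" by (rule labellingE[OF E H])
  have Es: "i \<noteq> k \<and> i < h \<and> k < h \<and> (k, i) \<in> E" if "(i, k) \<in> E" for i k using Es' that by blast
  have inj: "inj_on x {..<h}" by (rule tuple_ok_inj[OF ok])
  have pair: "pair_ok ind ((i, k) \<in> E) n (adjacency n G) (x i) (x k)" if "i < k" "k < h" for i k
    using ok that by (auto simp: tuple_ok_def set_pairs)
  have adj: "adjacency n G (x i * n + x k) = 1 \<longleftrightarrow> {x i, x k} \<in> edges G" if "i < h" "k < h" for i k
    using adjacency[of "x i" n "x k" G] x that by simp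
  have edge1: "{x i, x k} \<in> edges G" if "(i, k) \<in> E" for i k
  proof (cases "i < k")
    case True
    thus ?thesis using pair[of i k] adj[of i k] Es[OF that] that by (simp add: pair_ok_def)
  next
    case False
    hence "k < i" using Es[OF that] by auto
    hence "{x k, x i} \<in> edges G" using pair[of k i] adj[of k i] Es[OF that] by (simp add: pair_ok_def)
    thus ?thesis by (simp add: insert_commute)
  qed
  have sub: "subgraph ?K G"
  proof -
    have "simple_graph ?K"
      using Es inj by (auto simp: simple_graph_def pattern_graph_def card_2_iff inj_on_def) blast
    thus ?thesis using x G edge1 by (auto simp: subgraph_def pattern_graph_def)
  qed
  have iso: "graph_iso ?K H"
    unfolding graph_iso_def
  proof (intro exI conjI)
    let ?f = "\<sigma> \<circ> inv_into {..<h} x"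
    have fx: "?f (x i) = \<sigma> i" if "i < h" for i using inj that by simp
    have "bij_betw (inv_into {..<h} x) (x ` {..<h}) {..<h}"
      using inj by (intro bij_betw_inv_into) (simp add: bij_betw_def)
    from bij_betw_trans[OF this \<sigma>] show "bij_betw ?f (verts ?K) (verts H)" by (simp add: pattern_graph_def)
    have "?f ` {x i, x k} = {\<sigma> i, \<sigma> k}" if "(i, k) \<in> E" for i k
      using fx Es[OF that] by simp
    hence eq: "{?f ` {x i, x k} | i k. (i, k) \<in> E} = {{\<sigma> i, \<sigma> k} | i k. (i, k) \<in> E}"
      by (intro Collect_cong ex_cong1) metis
    have "(\<lambda>e. ?f ` e) ` {{x i, x k} | i k. (i, k) \<in> E} = {?f ` {x i, x k} | i k. (i, k) \<in> E}" by blast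
    thus "edges H = (\<lambda>e. ?f ` e) ` edges ?K" unfolding pattern_graph_def snd_conv eH eq by (rule sym)
  qed
  have "edges ?K = {e \<in> edges G. e \<subseteq> verts ?K}" if ind
  proof (intro equalityI subsetI)
    fix e assume "e \<in> edges ?K"
    thus "e \<in> {e \<in> edges G. e \<subseteq> verts ?K}" using edge1 Es by (auto simp: pattern_graph_def)
  next
    fix e assume e: "e \<in> {e \<in> edges G. e \<subseteq> verts ?K}"
    hence "card e = 2" "e \<subseteq> x ` {..<h}" using G by (auto simp: simple_graph_def pattern_graph_def)
    then obtain p q where "e = {p, q}" "p \<noteq> q" "p \<in> x ` {..<h}" "q \<in> x ` {..<h}" by (auto simp: card_2_iff)
    then obtain i k where "i < h" "k < h" "e = {x i, x k}" "i \<noteq> k" by auto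
    then obtain i k where ik: "i < k" "k < h" "e = {x i, x k}" by (metis insert_commute linorder_neqE_nat)
    hence "(i, k) \<in> E" using pair[of i k] adj[of i k] e that by (auto simp: pair_ok_def split: if_splits)
    thus "e \<in> edges ?K" using ik by (auto simp: pattern_graph_def)
  qed
  with sub iso show ?thesis by (auto simp: occurs_def induced_H_subgraph_def H_subgraph_def induced_subgraph_def)
qed

text \<open>Any enumeration \<open>x\<close> of the copy works: composing it with the isomorphism
  \<open>f\<close> yields the labelling \<open>f \<circ> x\<close> of \<open>H\<close>. This freedom
  is what allows two given vertices to be placed first.\<close>

lemma occurs_labelling:
  assumes H: "simple_graph H" and G: "simple_graph G" "verts G = {..<n}"
    and K: "occurs ind H G K" and x: "bij_betw x {..<h} (verts K)"
  shows "\<exists>E\<in>labellings H h. tuple_ok ind E n (adjacency n G) (pairs h) x"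
proof -
  have sub: "subgraph K G" and iso: "graph_iso K H" and ind: "ind \<Longrightarrow> edges K = {e \<in> edges G. e \<subseteq> verts K}"
    using K by (auto simp: occurs_def induced_H_subgraph_def H_subgraph_def induced_subgraph_def split: if_splits)
  obtain f where f: "bij_betw f (verts K) (verts H)" "edges H = (\<lambda>e. f ` e) ` edges K"
    using iso by (auto simp: graph_iso_def)
  have xK: "x i \<in> verts K" if "i < h" for i using x that by (auto simp: bij_betw_def)
  have xn: "x i < n" if "i < h" for i using xK[OF that] sub G by (auto simp: subgraph_def)
  define E where "E = {(i, k). i < h \<and> k < h \<and> {(f \<circ> x) i, (f \<circ> x) k} \<in> edges H}"
  have "E \<in> labellings H h"
    unfolding labellings_def E_def using bij_betw_trans[OF x f(1)] by blast
  moreover have EK: "(i, k) \<in> E \<longleftrightarrow> {x i, x k} \<in> edges K" if "i < h" "k < h" for i k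
  proof
    assume "(i, k) \<in> E"
    hence "f ` {x i, x k} \<in> (\<lambda>e. f ` e) ` edges K" using f(2) by (simp add: E_def)
    then obtain e where e: "e \<in> edges K" "f ` {x i, x k} = f ` e" by blast
    have "e \<subseteq> verts K" using sub e by (auto simp: subgraph_def simple_graph_def)
    with e(2) f(1) xK that have "{x i, x k} = e" by (subst (asm) inj_on_image_eq_iff[of f "verts K"]) (auto simp: bij_betw_def)
    with e show "{x i, x k} \<in> edges K" by simp
  next
    assume "{x i, x k} \<in> edges K"
    hence "f ` {x i, x k} \<in> edges H" using f(2) by blast
    thus "(i, k) \<in> E" using that by (simp add: E_def)
  qed
  have "tuple_ok ind E n (adjacency n G) (pairs h) x"
    unfolding tuple_ok_def
  proof (clarify)
    fix i k assume "(i, k) \<in> set (pairs h)"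
    hence ik: "i < k" "k < h" "i < h" by (auto simp: set_pairs)
    have "x i \<noteq> x k" using x ik by (auto simp: bij_betw_def inj_on_def)
    moreover have "adjacency n G (x i * n + x k) = 1 \<longleftrightarrow> {x i, x k} \<in> edges G" using adjacency xn ik by simp
    moreover have "{x i, x k} \<in> edges G" if "(i, k) \<in> E" using that EK ik sub by (auto simp: subgraph_def)
    moreover have "{x i, x k} \<notin> edges G" if "(i, k) \<notin> E" ind using that EK ik ind xK by auto
    ultimately show "pair_ok ind ((i, k) \<in> E) n (adjacency n G) (x i) (x k)" by (auto simp: pair_ok_def)
  qed
  ultimately show ?thesis by blast
qed

lemma enumerate_from:
  assumes "finite V" "card V = h" "u \<in> V" "v \<in> V" "2 \<le> h"
  obtains x where "bij_betw x {..<h} V" "x 0 = u" "u \<noteq> v \<Longrightarrow> x 1 = (v :: nat)"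
proof -
  \<comment> \<open>For \<open>u = v\<close> any other vertex of \<open>V\<close> takes position 1;
    there is one because \<open>2 \<le> h\<close>.\<close>
  obtain v' where v': "v' \<in> V" "v' \<noteq> u" "u \<noteq> v \<Longrightarrow> v' = v"
  proof (cases "u = v")
    case True
    have "V \<noteq> {u}" using assms by auto
    with assms(3) True that show ?thesis by blast
  qed (use assms that in blast)
  obtain xs where xs: "set xs = V - {u, v'}" "distinct xs" using finite_distinct_list[of "V - {u, v'}"] assms by blast
  let ?xs = "u # v' # xs"
  have d: "distinct ?xs" "set ?xs = V" using xs v' assms by auto
  hence "length ?xs = h" using distinct_card[OF d(1)] assms by simp
  hence "bij_betw ((!) ?xs) {..<h} V" using bij_betw_nth[OF d(1), of "{..<h}" V] d by simp
  thus ?thesis using v' by (intro that[of "(!) ?xs"]) auto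
qed

lemma card_occurs:
  assumes "occurs ind H G K" "card (verts H) = h" "finite (verts G)"
  shows "finite (verts K) \<and> card (verts K) = h"
proof -
  have "subgraph K G" "graph_iso K H"
    using assms by (auto simp: occurs_def induced_H_subgraph_def H_subgraph_def induced_subgraph_def split: if_splits)
  thus ?thesis using assms by (auto simp: subgraph_def graph_iso_def dest: finite_subset bij_betw_same_card)
qed

lemma reports_heaviest_records:
  assumes rec: "records h w' W S"
    and sound: "\<And>E x. (E, x, r) \<in> S \<Longrightarrow> E \<subseteq> {..<h} \<times> {..<h} \<and> P (pattern_graph h E x) \<and>
        weight w (pattern_graph h E x) = (\<Sum>i<h. w' (x i))"
    and complete: "\<And>K. P K \<Longrightarrow> \<exists>E x. (E, x, r) \<in> S \<and> weight w K \<le> (\<Sum>i<h. w' (x i))"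
  shows "reports_heaviest h w P W r"
proof (cases "\<exists>E x. (E, x, r) \<in> S")
  case True
  then obtain E x where W2: "W 2 r = 1" and Ex: "(E, x, r) \<in> S" "stored h W r E x" "maximal h w' S r x"
    using rec[unfolded records_def, rule_format, of r] by (auto simp: record_ok_def)
  have W4: "W 4 ((r * h + i) * h + k) = 1 \<longleftrightarrow> (i, k) \<in> E" if "i < h" "k < h" for i k
  proof -
    have "i * h + k < Suc i * h" using that by simp
    also have "\<dots> \<le> h * h" using that by (intro mult_le_mono) auto
    finally have "W 4 (r * (h * h) + (i * h + k)) = of_bool ((i, k) \<in> E)" using Ex(2) that by (simp add: stored_def)
    thus ?thesis by (simp add: distrib_right mult.assoc add.assoc)
  qed
  have "out_graph h W r = pattern_graph h E x"
  proof -
    have "(\<lambda>i. W 3 (r * h + i)) ` {..<h} = x ` {..<h}" using Ex(2) by (auto simp: stored_def)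
    moreover have "{{W 3 (r * h + i), W 3 (r * h + k)} | i k. i < h \<and> k < h \<and> W 4 ((r * h + i) * h + k) = 1}
      = {{x i, x k} | i k. (i, k) \<in> E}"
    proof -
      have "i < h \<and> k < h \<and> W 4 ((r * h + i) * h + k) = 1 \<longleftrightarrow> (i, k) \<in> E" for i k
        using W4[of i k] sound[OF Ex(1)] by auto
      moreover have "W 3 (r * h + i) = x i \<and> W 3 (r * h + k) = x k" if "(i, k) \<in> E" for i k
        using Ex(2) sound[OF Ex(1)] that by (auto simp: stored_def)
      ultimately show ?thesis by (intro Collect_cong) metis
    qed
    ultimately show ?thesis by (simp add: out_graph_def pattern_graph_def)
  qed
  moreover have "heaviest w P (pattern_graph h E x)"
    unfolding heaviest_def using sound[OF Ex(1)] complete Ex(3) unfolding maximal_def by fastforce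
  moreover have "\<exists>K. P K" using sound[OF Ex(1)] by blast
  ultimately show ?thesis using W2 unfolding reports_heaviest_def by simp
next
  case False
  then have "\<not> (\<exists>K. P K)" using complete by blast
  moreover have "W 2 r = 0" using rec[unfolded records_def, rule_format, of r] False by (simp add: record_ok_def)
  ultimately show ?thesis unfolding reports_heaviest_def by simp
qed

text \<open>\<open>w'\<close> stands for the contents of value array 0, which agree with the weight
  function on the vertices but need not do so elsewhere.\<close>

lemma solution_reports:
  assumes H: "simple_graph H" "card (verts H) = h" "2 \<le> h" and G: "simple_graph G" "verts G = {..<n}"
    and w': "\<And>v. v < n \<Longrightarrow> w' v = w v" and solved: "solved w' all ind (labellings H h) n h (adjacency n G) {} W"
  shows "all \<Longrightarrow> ind \<Longrightarrow> all_pairs_max_induced H n G w W"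
    and "\<not> all \<Longrightarrow> \<not> ind \<Longrightarrow> max_H_subgraph H n G w W"
    and "\<not> all \<Longrightarrow> ind \<Longrightarrow> max_induced_H_subgraph H n G w W"
proof -
  obtain S where rec: "records h w' W S" and sound: "sound_for all ind (labellings H h) n h (adjacency n G) S"
    and complete: "\<And>E. E \<in> labellings H h \<Longrightarrow> complete_for w' all ind E n h (adjacency n G) S"
    using solved by (auto simp: solved_def)
  have S: "E \<in> labellings H h \<and> (\<forall>i<h. x i < n) \<and> (r = key1 all n x \<or> r = key2 all n x) \<and>
     E \<subseteq> {..<h} \<times> {..<h} \<and> occurs ind H G (pattern_graph h E x) \<and>
     weight w (pattern_graph h E x) = (\<Sum>i<h. w' (x i))" if "(E, x, r) \<in> S" for E x r
  proof -
    have 1: "E \<in> labellings H h" "\<forall>i<h. x i < n" "tuple_ok ind E n (adjacency n G) (pairs h) x"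
      "r = key1 all n x \<or> r = key2 all n x" using sound that unfolding sound_for_def by blast+
    have "weight w (pattern_graph h E x) = (\<Sum>i<h. w (x i))"
      by (rule weight_pattern_graph[OF tuple_ok_inj[OF 1(3)]])
    also have "\<dots> = (\<Sum>i<h. w' (x i))" using 1(2) w' by simp
    finally show ?thesis using 1 occurs_pattern_graph[OF H(1) G 1(1-3)] by (auto simp: labellings_def)
  qed
  have C: "\<exists>E x'. (E, x', r) \<in> S \<and> weight w K \<le> (\<Sum>i<h. w' (x' i))"
    if K: "occurs ind H G K" and x: "bij_betw x {..<h} (verts K)" and r: "r = key1 all n x \<or> r = key2 all n x" for K x r
  proof -
    obtain E where E: "E \<in> labellings H h" "tuple_ok ind E n (adjacency n G) (pairs h) x"
      using occurs_labelling[OF H(1) G K x] by blast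
    have "verts K \<subseteq> {..<n}" using K G by (auto simp: occurs_def induced_H_subgraph_def H_subgraph_def
        induced_subgraph_def subgraph_def split: if_splits)
    hence xn: "\<forall>i<h. x i < n" using x by (auto simp: bij_betw_def)
    have "weight w K = (\<Sum>i<h. w (x i))" unfolding weight_def by (rule sum.reindex_bij_betw[OF x, symmetric])
    also have "\<dots> = (\<Sum>i<h. w' (x i))" using xn w' by simp
    finally show ?thesis using complete[OF E(1)] xn E(2) r unfolding complete_for_def by metis
  qed
  have enum: "\<exists>x. bij_betw x {..<h} (verts K) \<and> x 0 = u \<and> (u \<noteq> v \<longrightarrow> x 1 = v)"
    if "occurs ind H G K" "u \<in> verts K" "v \<in> verts K" for K u v
    using enumerate_from[of "verts K" h u v] card_occurs[OF that(1) H(2)] that H(3) G(2) by (metis finite_lessThan)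
  show "all_pairs_max_induced H n G w W" if all ind
    unfolding all_pairs_max_induced_def H(2)
  proof (intro allI impI)
    fix u v assume uv: "u < n" "v < n"
    show "reports_heaviest h w (\<lambda>K. induced_H_subgraph H G K \<and> u \<in> verts K \<and> v \<in> verts K) W (u * n + v)"
    proof (rule reports_heaviest_records[OF rec])
      fix E x assume Ex: "(E, x, u * n + v) \<in> S"
      have x: "0 < h" "1 < h" "x 0 < n" "x 1 < n" using S[OF Ex] H(3) by auto
      \<comment> \<open>The record number determines the pair. The second alternative comes from
        \<open>key2\<close> and serves the diagonal records \<open>u = v\<close>.\<close>
      have "(u = x 0 \<and> v = x 1) \<or> (u = x 0 \<and> v = x 0)"
        using S[OF Ex] block_index_eq[OF uv(2) x(3)] block_index_eq[OF uv(2) x(4)] that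
        by (simp add: key1_def key2_def)
      hence "u \<in> x ` {..<h}" "v \<in> x ` {..<h}" using x by auto
      thus "E \<subseteq> {..<h} \<times> {..<h} \<and> (induced_H_subgraph H G (pattern_graph h E x) \<and>
         u \<in> verts (pattern_graph h E x) \<and> v \<in> verts (pattern_graph h E x)) \<and>
         weight w (pattern_graph h E x) = (\<Sum>i<h. w' (x i))"
        using S[OF Ex] that by (simp add: pattern_graph_def occurs_def)
    next
      fix K assume K: "induced_H_subgraph H G K \<and> u \<in> verts K \<and> v \<in> verts K"
      hence occ: "occurs ind H G K" using that by (simp add: occurs_def)
      obtain x where x: "bij_betw x {..<h} (verts K)" "x 0 = u" "u \<noteq> v \<longrightarrow> x 1 = v" using enum[OF occ] K by blast
      show "\<exists>E x. (E, x, u * n + v) \<in> S \<and> weight w K \<le> (\<Sum>i<h. w' (x i))"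
        by (rule C[OF occ x(1)]) (use x that in \<open>auto simp: key1_def key2_def\<close>)
    qed
  qed
  have max: "reports_heaviest h w (occurs ind H G) W 0" if "\<not> all"
  proof (rule reports_heaviest_records[OF rec])
    fix K assume K: "occurs ind H G K"
    have "card (verts K) = h" using card_occurs[OF K H(2)] G(2) by simp
    then obtain u where "u \<in> verts K" using H(3) by fastforce
    then obtain x where "bij_betw x {..<h} (verts K)" using enum[OF K] by blast
    from C[OF K this, of 0] that show "\<exists>E x. (E, x, 0) \<in> S \<and> weight w K \<le> (\<Sum>i<h. w' (x i))"
      by (simp add: key1_def)
  qed (use S in blast)
  show "max_H_subgraph H n G w W" if "\<not> all" "\<not> ind"
  proof -
    have "occurs ind H G = H_subgraph H G" using that by (auto simp: occurs_def fun_eq_iff)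
    with max[OF that(1)] show ?thesis by (simp add: max_H_subgraph_def H(2))
  qed
  show "max_induced_H_subgraph H n G w W" if "\<not> all" "ind"
  proof -
    have "occurs ind H G = induced_H_subgraph H G" using that by (auto simp: occurs_def fun_eq_iff)
    with max[OF that(1)] show ?thesis by (simp add: max_induced_H_subgraph_def H(2))
  qed
qed

section \<open>Running time\<close>

lemma tiles_le:
  assumes "0 < D" "D \<le> n ^ k" shows "real (tiles n D k) \<le> 2 * real n ^ k / real D"
proof -
  have "real (n ^ k div D) \<le> real (n ^ k) / real D" by (rule of_nat_div_le_of_nat)
  moreover have "1 \<le> real (n ^ k) / real D" using assms by (simp add: le_divide_eq flip: of_nat_power)
  ultimately show ?thesis by (simp add: tiles_def)
qed

context matrix_program begin

text \<open>Two facts on the final \<open>D\<close> suffice. It is at most a constant times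
  \<open>n powr \<beta>\<close>, which bounds the scan. And either the tile products are no more
  expensive than the scan or the cap was reached, so that \<open>D\<close> is at least
  \<open>n powr \<beta> / 2\<close>.\<close>

lemma solver_time_bound:
  fixes \<omega> \<beta> \<tau> C :: real and a b c e :: nat
  assumes j: "\<And>D. 0 < D \<Longrightarrow> real (j D) \<le> C * real D powr \<omega>" and C: "1 \<le> C"
    and \<omega>: "2 \<le> \<omega>" "\<omega> \<le> 3" and a: "1 \<le> a" "a \<le> c"
    and \<beta>: "0 \<le> \<beta>" "\<beta> \<le> real a" "\<beta> \<le> real b"
    and \<tau>: "real a + real c + \<beta> \<le> \<tau>" "real a + real c + real b - (3 - \<omega>) * \<beta> \<le> \<tau>"
    and balanced: "\<beta> = real a \<or> \<beta> * (4 - \<omega>) = real b"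
  shows "\<exists>K\<ge>0. \<forall>n l. 0 < n \<longrightarrow> 2 ^ l \<le> n ^ a \<longrightarrow> \<not> continue n a b (2 ^ l) \<longrightarrow> (\<forall>i<l. continue n a b (2 ^ i)) \<longrightarrow>
     real (solver_time e n l a c b) \<le> K * real n powr \<tau>"
proof -
  define C1 where "C1 = 2 * C"
  define h where "h = a + c + b"
  define k where "k = 2 * h * h + 3 * h + 14"
  define K where "K = 12 + 15 * real b + 18 * C * C1 ^ 3 +
    real e * (20 * (4 * (1 + C1)) * (C1 + 2 * C) + 4 * C1 * real k + 4)"
  have C1: "1 \<le> C1" "C \<le> C1" using C by (auto simp: C1_def)
  have "0 \<le> K" unfolding K_def using C C1 by simp
  moreover have "real (solver_time e n l a c b) \<le> K * real n powr \<tau>"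
    if n: "0 < n" and D: "2 ^ l \<le> n ^ a" "\<not> continue n a b (2 ^ l)" and cont: "\<forall>i<l. continue n a b (2 ^ i)" for n l
  proof -
    define D where "D = (2::nat) ^ l"
    define N where "N = real n"
    define P where "P = N powr \<tau>"
    have N: "1 \<le> N" using n by (simp add: N_def)
    have D1: "1 \<le> real D" "0 < D" by (simp_all add: D_def)
    have Na: "real D \<le> N powr real a" using D(1) N by (simp add: D_def N_def powr_realpow flip: of_nat_power)
    have mono: "N powr x \<le> N powr y" if "x \<le> y" for x y using that N by (rule powr_mono)
    have pos: "0 < N powr x" for x using N by simp
    have ge1: "1 \<le> N powr x" if "0 \<le> x" for x using mono[OF that] N by simp
    have jD: "real (j D) \<le> C * real D powr \<omega>" "real D * real D \<le> real (j D)"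
      using j[OF D1(2)] square_le[of D] by (simp_all flip: of_nat_mult)
    \<comment> \<open>If \<beta> is \<open>a\<close>, this is the cap. Otherwise the previous value
      \<open>D' = D / 2\<close> still passed the test, so
      \<open>D' powr (4 - \<omega>) < C * n ^ b\<close>; the halving is the factor 2 in
      \<open>C1\<close>.\<close>
    have DC1: "real D \<le> C1 * N powr \<beta>"
    proof (cases "\<beta> = real a")
      case True
      have "N powr \<beta> \<le> C1 * N powr \<beta>" using C1 pos[of \<beta>] by simp
      with Na show ?thesis unfolding True by linarith
    next
      case False
      hence bal: "\<beta> * (4 - \<omega>) = real b" using balanced by simp
      show ?thesis
      proof (cases l)
        case 0
        hence "real D = 1" by (simp add: D_def)
        also have "1 \<le> C1 * N powr \<beta>" using mult_mono[OF C1(1) ge1[OF \<beta>(1)]] C1 by simp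
        finally show ?thesis .
      next
        case (Suc l')
        define D' where "D' = (2::nat) ^ l'"
        have D': "D = 2 * D'" "0 < D'" "1 \<le> real D'" using Suc by (simp_all add: D_def D'_def)
        have "continue n a b D'" using cont Suc by (simp add: D'_def)
        hence "D' ^ 4 < n ^ b * j D'" by (simp add: continue_def)
        hence "real (D' ^ 4) < real (n ^ b * j D')" by (rule of_nat_less_iff[THEN iffD2])
        moreover have "real D' powr 4 = real (D' ^ 4)" using D'(2) by (simp add: powr_numeral)
        moreover have "N powr real b = real (n ^ b)" using N by (simp add: N_def powr_realpow)
        ultimately have "real D' powr 4 < N powr real b * real (j D')" by simp
        also have "\<dots> \<le> N powr real b * (C * real D' powr \<omega>)"
          using j[OF D'(2)] pos by (intro mult_left_mono) auto
        finally have *: "real D' powr 4 < C * N powr real b * real D' powr \<omega>" by (simp add: mult_ac)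
        have "real D' powr 4 = real D' powr (4 - \<omega>) * real D' powr \<omega>" by (simp flip: powr_add)
        with * have **: "real D' powr (4 - \<omega>) < C * N powr real b"
          using D' by (simp add: mult_less_cancel_right)
        have "real D' \<le> C * N powr \<beta>"
        proof (rule ccontr)
          assume "\<not> ?thesis"
          hence "(C * N powr \<beta>) powr (4 - \<omega>) \<le> real D' powr (4 - \<omega>)"
            using C \<omega> pos[of \<beta>] by (intro powr_mono2) auto
          moreover have "(C * N powr \<beta>) powr (4 - \<omega>) = C powr (4 - \<omega>) * N powr real b"
            using C pos[of \<beta>] by (simp add: powr_mult powr_powr bal)
          \<comment> \<open>The exponent \<open>4 - \<omega>\<close> is at least 1 and
            \<open>C \<ge> 1\<close>, so taking the root does not enlarge the constant.\<close>
          moreover have "C powr 1 * N powr real b \<le> C powr (4 - \<omega>) * N powr real b"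
            using C \<omega> by (intro mult_right_mono powr_mono) auto
          ultimately show False using ** C by simp
        qed
        thus ?thesis by (simp add: D' C1_def)
      qed
    qed
    have P: "0 < P" "1 \<le> P" "N powr (real a + real c + \<beta>) \<le> P"
      "N powr (real a + real c + real b - (3 - \<omega>) * \<beta>) \<le> P"
      using pos mono \<tau> \<beta> ge1[of \<tau>] by (auto simp: P_def)
    have CP: "0 \<le> C * P" "0 \<le> C1 * P" using C C1 P by simp_all
    have cost1: "N powr (real a + real c) * real D \<le> C1 * P"
    proof -
      have "N powr (real a + real c) * real D \<le> N powr (real a + real c) * (C1 * N powr \<beta>)"
        using DC1 pos by (intro mult_left_mono) auto
      also have "\<dots> = C1 * N powr (real a + real c + \<beta>)" by (simp add: powr_add)
      also have "\<dots> \<le> C1 * P" using P C1 by (intro mult_left_mono) auto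
      finally show ?thesis .
    qed
    \<comment> \<open>The two ways in which the search can stop. If the first condition failed, the
      tile products are dominated by the scan. If the cap was hit, \<open>D\<close> is large and the
      decreasing function \<open>D powr (\<omega> - 3)\<close> is small.\<close>
    have cost2: "N powr (real a + real c + real b) * (real (j D) / real D ^ 3) \<le> (C1 + 2 * C) * P"
    proof (cases "n ^ b * j D \<le> D ^ 4")
      case True
      hence "real (n ^ b * j D) \<le> real (D ^ 4)" by (rule of_nat_mono)
      hence "N powr real b * real (j D) \<le> real D * real D ^ 3"
        using N by (simp add: N_def powr_realpow flip: power_Suc)
      hence "N powr real b * (real (j D) / real D ^ 3) \<le> real D"
        using D1 by (simp add: divide_le_eq)
      hence "N powr (real a + real c) * (N powr real b * (real (j D) / real D ^ 3)) \<le> N powr (real a + real c) * real D"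
        using pos by (intro mult_left_mono) auto
      also have "N powr (real a + real c) * (N powr real b * (real (j D) / real D ^ 3))
        = N powr (real a + real c + real b) * (real (j D) / real D ^ 3)" by (simp add: powr_add)
      finally show ?thesis using cost1 CP by (simp add: distrib_right)
    next
      case False
      hence "n ^ a < 2 * D" using D(2) by (simp add: continue_def D_def not_le)
      hence "real (n ^ a) < real (2 * D)" by (rule of_nat_less_iff[THEN iffD2])
      hence Da: "N powr real a / 2 \<le> real D" using N by (simp add: N_def powr_realpow)
      have D2: "N powr \<beta> / 2 \<le> real D" using Da mono[OF \<beta>(2)] by linarith
      have "real (j D) / real D ^ 3 \<le> C * real D powr \<omega> / real D powr 3"
        using jD(1) D1 by (simp add: divide_right_mono powr_numeral)
      also have "\<dots> = C * real D powr (\<omega> - 3)" by (simp add: powr_diff)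
      also have "\<dots> \<le> C * (N powr \<beta> / 2) powr (\<omega> - 3)"
        using C D2 pos[of \<beta>] \<omega> by (intro mult_left_mono powr_mono2') auto
      also have "(N powr \<beta> / 2) powr (\<omega> - 3) = N powr (- (3 - \<omega>) * \<beta>) * 2 powr (3 - \<omega>)"
      proof -
        have "(N powr \<beta> / 2) powr (\<omega> - 3) = N powr (\<beta> * (\<omega> - 3)) / 2 powr (\<omega> - 3)"
          using N by (simp add: powr_divide powr_powr)
        also have "2 powr (\<omega> - 3) = inverse (2 powr (3 - \<omega>))" by (simp flip: powr_minus)
        also have "\<beta> * (\<omega> - 3) = - (3 - \<omega>) * \<beta>" by (simp add: algebra_simps)
        finally show ?thesis unfolding divide_inverse inverse_inverse_eq .
      qed
      also have "C * (N powr (- (3 - \<omega>) * \<beta>) * 2 powr (3 - \<omega>)) \<le> C * (N powr (- (3 - \<omega>) * \<beta>) * 2)"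
        using C \<omega> powr_mono[of "3 - \<omega>" 1 2] by (intro mult_left_mono) auto
      finally have "real (j D) / real D ^ 3 \<le> 2 * C * N powr (- (3 - \<omega>) * \<beta>)" by simp
      hence "N powr (real a + real c + real b) * (real (j D) / real D ^ 3)
         \<le> N powr (real a + real c + real b) * (2 * C * N powr (- (3 - \<omega>) * \<beta>))"
        using pos by (intro mult_left_mono) auto
      also have "\<dots> = 2 * C * N powr (real a + real c + real b - (3 - \<omega>) * \<beta>)"
        unfolding minus_mult_left[symmetric] by (simp only: diff_conv_add_uminus powr_add mult_ac)
      also have "\<dots> \<le> 2 * C * P" using P C by (intro mult_left_mono) auto
      finally show ?thesis using CP by (simp add: distrib_right)
    qed
    have Dpow: "D \<le> n ^ a" "D \<le> n ^ c"
      using D(1) power_increasing[OF a(2), of n] n by (auto simp: D_def)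
    have ta: "real (tiles n D a) \<le> 2 * N powr real a / real D" and tc: "real (tiles n D c) \<le> 2 * N powr real c / real D"
      using tiles_le[OF D1(2) Dpow(1)] tiles_le[OF D1(2) Dpow(2)] N by (simp_all add: N_def powr_realpow)
    \<comment> \<open>\<open>D\<close> may exceed \<open>n ^ b\<close>, so \<open>tiles_le\<close>
      does not apply. Instead, \<beta> \<le> \<open>b\<close> bounds \<open>D\<close> by
      \<open>C1 * n ^ b\<close>, which pays for the rounding.\<close>
    have tb: "real (tiles n D b) \<le> (1 + C1) * N powr real b / real D"
    proof -
      have "real (n ^ b div D) \<le> real (n ^ b) / real D" by (rule of_nat_div_le_of_nat)
      also have "real (n ^ b) = N powr real b" using N by (simp add: N_def powr_realpow)
      finally have 1: "real (tiles n D b) \<le> N powr real b / real D + 1" by (simp add: tiles_def)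
      have "real D \<le> C1 * N powr real b" using DC1 mono[OF \<beta>(3)] C1 by (smt (verit) mult_left_mono)
      hence "1 \<le> C1 * N powr real b / real D" using D1 by (simp add: le_divide_eq)
      with 1 show ?thesis by (simp add: add_divide_distrib distrib_right)
    qed
    define Q where "Q = tiles n D b * tiles n D a * tiles n D c"
    have Q: "real Q \<le> 4 * (1 + C1) * N powr (real a + real c + real b) / real D ^ 3"
    proof -
      have "real Q \<le> ((1 + C1) * N powr real b / real D) * (2 * N powr real a / real D) * (2 * N powr real c / real D)"
        unfolding Q_def of_nat_mult using C1 by (intro mult_mono ta tb tc) auto
      also have "\<dots> = 4 * (1 + C1) * N powr (real a + real c + real b) / real D ^ 3"
        by (simp add: powr_add power3_eq_cube mult_ac)
      finally show ?thesis .
    qed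
    have find: "real (Q * (8 * (D * D) + 3 * j D + 9)) \<le> 20 * (4 * (1 + C1)) * (C1 + 2 * C) * P"
    proof -
      have "1 \<le> real D * real D" using mult_mono[OF D1(1) D1(1)] by simp
      \<comment> \<open>\<open>D * D\<close> and 1 are both at most \<open>j D\<close>, and
        \<open>8 + 3 + 9 = 20\<close>.\<close>
      hence "real (8 * (D * D) + 3 * j D + 9) \<le> 20 * real (j D)" using jD(2) by simp
      hence "real Q * real (8 * (D * D) + 3 * j D + 9) \<le>
         (4 * (1 + C1) * N powr (real a + real c + real b) / real D ^ 3) * (20 * real (j D))"
        using Q C1 pos by (intro mult_mono) auto
      also have "\<dots> = 20 * (4 * (1 + C1)) * (N powr (real a + real c + real b) * (real (j D) / real D ^ 3))" by simp
      also have "\<dots> \<le> 20 * (4 * (1 + C1)) * ((C1 + 2 * C) * P)" using cost2 C1 by (intro mult_left_mono) auto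
      finally show ?thesis by (simp add: mult_ac)
    qed
    have scan: "real (tiles n D a * D * (tiles n D c * D) * D * k) \<le> 4 * C1 * real k * P"
    proof -
      have "real (tiles n D a) * real D \<le> 2 * N powr real a" "real (tiles n D c) * real D \<le> 2 * N powr real c"
        using ta tc D1 by (simp_all add: le_divide_eq)
      hence "real (tiles n D a) * real D * (real (tiles n D c) * real D) * real D
         \<le> 2 * N powr real a * (2 * N powr real c) * real D"
        by (intro mult_right_mono[OF mult_mono]) auto
      also have "\<dots> = 4 * (N powr (real a + real c) * real D)" by (simp add: powr_add)
      also have "\<dots> \<le> 4 * (C1 * P)" using cost1 by simp
      finally have "real (tiles n D a) * real D * (real (tiles n D c) * real D) * real D * real k \<le> 4 * (C1 * P) * real k"
        by (intro mult_right_mono) auto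
      thus ?thesis by (simp add: mult_ac)
    qed
    have stage: "real (stage_time n D a c b) \<le> (20 * (4 * (1 + C1)) * (C1 + 2 * C) + 4 * C1 * real k + 4) * P"
    proof -
      have "stage_time n D a c b = Q * (8 * (D * D) + 3 * j D + 9) + tiles n D a * D * (tiles n D c * D) * D * k + 4"
        by (simp add: stage_time_def Q_def k_def h_def)
      with find scan P(2) show ?thesis by (simp add: distrib_right)
    qed
    \<comment> \<open>Splitting off one factor \<open>2 ^ i\<close> makes the costs of the
      measurements a geometric sum, dominated by the last one: in total of order
      \<open>D powr \<omega>\<close>.\<close>
    have measure: "real (\<Sum>i\<le>l. 3 * j (2 ^ i) + 6) \<le> 18 * C * C1 ^ 3 * P"
    proof -
      have "real (3 * j (2 ^ i) + 6) \<le> 9 * C * real D powr (\<omega> - 1) * 2 ^ i" if "i \<le> l" for i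
      proof -
        have "1 \<le> j (2 ^ i)" using square_le[of "2 ^ i"] by (metis One_nat_def Suc_leI le_trans mult_pos_pos zero_less_power pos2)
        hence "real (3 * j (2 ^ i) + 6) \<le> 9 * real (j (2 ^ i))" by simp
        also have "\<dots> \<le> 9 * (C * real (2 ^ i) powr \<omega>)" using j[of "2 ^ i"] by simp
        also have "real (2 ^ i) powr \<omega> = real (2 ^ i) powr (\<omega> - 1) * 2 ^ i" by (simp add: powr_diff)
        also have "real (2 ^ i) powr (\<omega> - 1) \<le> real D powr (\<omega> - 1)"
          using that \<omega> by (intro powr_mono2) (auto simp: D_def intro: power_increasing)
        finally show ?thesis using C by (simp add: mult_ac mult_left_mono)
      qed
      hence "real (\<Sum>i\<le>l. 3 * j (2 ^ i) + 6) \<le> (\<Sum>i\<le>l. 9 * C * real D powr (\<omega> - 1) * 2 ^ i)"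
        unfolding of_nat_sum by (intro sum_mono) auto
      also have "\<dots> = 9 * C * real D powr (\<omega> - 1) * (\<Sum>i\<le>l. 2 ^ i)" by (simp add: sum_distrib_left)
      also have "(\<Sum>i\<le>l. (2::real) ^ i) = 2 * real D - 1" unfolding D_def by (induction l) auto
      also have "9 * C * real D powr (\<omega> - 1) * (2 * real D - 1) \<le> 9 * C * real D powr (\<omega> - 1) * (2 * real D)"
        using C by (intro mult_left_mono) auto
      also have "\<dots> = 18 * C * real D powr \<omega>" using D1 by (simp add: powr_diff)
      also have "\<dots> \<le> 18 * C * (C1 * N powr \<beta>) powr \<omega>"
        using C \<omega> DC1 by (intro mult_left_mono powr_mono2) auto
      also have "(C1 * N powr \<beta>) powr \<omega> = C1 powr \<omega> * N powr (\<beta> * \<omega>)"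
        using C1 pos[of \<beta>] by (simp add: powr_mult powr_powr)
      also have "\<dots> \<le> C1 powr 3 * P"
      proof (intro mult_mono powr_mono)
        \<comment> \<open>The claim amounts to \<open>3 * \<beta> \<le> a + b + c\<close>, and
          \<beta> is at most each of the three.\<close>
        have "\<beta> \<le> real c" using \<beta> a by linarith
        hence "\<beta> * \<omega> \<le> real a + real c + real b - (3 - \<omega>) * \<beta>" using \<beta> by (simp add: algebra_simps)
        thus "N powr (\<beta> * \<omega>) \<le> P" using mono P(4) order_trans by blast
      qed (use C1 \<omega> in auto)
      also have "C1 powr 3 = C1 ^ 3" using C1 by (simp add: powr_numeral)
      finally show ?thesis using C by (simp add: mult_ac)
    qed
    have sort: "real (b * (n ^ b * (6 * n + 7) + 2)) \<le> 15 * real b * P"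
    proof -
      \<comment> \<open>Sorting costs \<open>n ^ (b + 1)\<close>. This is affordable since
        \<open>(3 - \<omega>) * \<beta> \<le> a\<close> leaves at least
        \<open>c + b\<close>.\<close>
      have "real b + 1 \<le> real a + real c + real b - (3 - \<omega>) * \<beta>"
      proof -
        have "(3 - \<omega>) * \<beta> \<le> 1 * real a" using \<omega> \<beta> by (intro mult_mono) auto
        moreover have "1 \<le> real c" using a by linarith
        ultimately show ?thesis by linarith
      qed
      hence le: "N powr (real b + 1) \<le> P" using mono P(4) order_trans by blast
      have "real (n ^ b * (6 * n + 7)) = N powr real b * (6 * N + 7)" using N by (simp add: N_def powr_realpow)
      also have "\<dots> \<le> N powr real b * (13 * N)" using N pos by (intro mult_left_mono) auto
      also have "\<dots> = 13 * N powr (real b + 1)" using N by (simp add: powr_add)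
      finally have "real (n ^ b * (6 * n + 7) + 2) \<le> 15 * P" using le P(2) by simp
      hence "real b * real (n ^ b * (6 * n + 7) + 2) \<le> real b * (15 * P)" by (intro mult_left_mono) auto
      thus ?thesis by (subst of_nat_mult) (simp only: mult_ac)
    qed
    have "real (solver_time e n l a c b) = 12 + real (b * (n ^ b * (6 * n + 7) + 2)) +
        real (\<Sum>i\<le>l. 3 * j (2 ^ i) + 6) + real e * real (stage_time n D a c b)"
      unfolding solver_time_def D_def[symmetric] of_nat_add of_nat_mult by simp
    also have "\<dots> \<le> 12 * P + 15 * real b * P + 18 * C * C1 ^ 3 * P +
        real e * ((20 * (4 * (1 + C1)) * (C1 + 2 * C) + 4 * C1 * real k + 4) * P)"
      using P(2) sort measure stage by (intro add_mono mult_left_mono) auto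
    also have "\<dots> = K * P" by (simp add: K_def algebra_simps)
    finally show ?thesis by (simp add: P_def N_def)
  qed
  ultimately show ?thesis by blast
qed

end

section \<open>The exponent\<close>

text \<open>Uniform in all block sizes up to the cap, because the search tries several of them and
  the last one is not known in advance.\<close>

definition poly_bounded :: "nat \<Rightarrow> (nat \<Rightarrow> nat \<Rightarrow> nat) \<Rightarrow> bool" where
  "poly_bounded a f \<longleftrightarrow> (\<exists>e. \<forall>n D. 0 < n \<longrightarrow> 0 < D \<longrightarrow> D \<le> n ^ a \<longrightarrow> f n D \<le> (n + 2) ^ e)"

lemma poly_bounded_const: "poly_bounded a (\<lambda>n D. k)"
proof -
  have "k \<le> (n + 2) ^ k" for n
    using less_imp_le[OF less_exp[of k]] power_mono[of 2 "n + 2" k] by linarith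
  thus ?thesis unfolding poly_bounded_def by blast
qed

lemma poly_bounded_n: "poly_bounded a (\<lambda>n D. n)"
  unfolding poly_bounded_def by (rule exI[of _ 1]) simp

lemma poly_bounded_D: "poly_bounded a (\<lambda>n D. D)"
proof -
  have "D \<le> (n + 2) ^ a" if "D \<le> n ^ a" for n D :: nat using that power_mono[of n "n + 2" a] by linarith
  thus ?thesis unfolding poly_bounded_def by blast
qed

lemma poly_bounded_mult:
  assumes "poly_bounded a f" "poly_bounded a g" shows "poly_bounded a (\<lambda>n D. f n D * g n D)"
proof -
  obtain e1 e2 where "\<forall>n D. 0 < n \<longrightarrow> 0 < D \<longrightarrow> D \<le> n ^ a \<longrightarrow> f n D \<le> (n + 2) ^ e1"
    "\<forall>n D. 0 < n \<longrightarrow> 0 < D \<longrightarrow> D \<le> n ^ a \<longrightarrow> g n D \<le> (n + 2) ^ e2" using assms unfolding poly_bounded_def by blast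
  thus ?thesis unfolding poly_bounded_def by (intro exI[of _ "e1 + e2"]) (simp add: power_add mult_le_mono)
qed

lemma poly_bounded_mono:
  "poly_bounded a g \<Longrightarrow> (\<And>n D. 0 < n \<Longrightarrow> 0 < D \<Longrightarrow> D \<le> n ^ a \<Longrightarrow> f n D \<le> g n D) \<Longrightarrow> poly_bounded a f"
  unfolding poly_bounded_def by (meson order_trans)

lemma poly_bounded_add:
  assumes "poly_bounded a f" "poly_bounded a g" shows "poly_bounded a (\<lambda>n D. f n D + g n D)"
proof -
  obtain e1 e2 where e: "\<forall>n D. 0 < n \<longrightarrow> 0 < D \<longrightarrow> D \<le> n ^ a \<longrightarrow> f n D \<le> (n + 2) ^ e1"
    "\<forall>n D. 0 < n \<longrightarrow> 0 < D \<longrightarrow> D \<le> n ^ a \<longrightarrow> g n D \<le> (n + 2) ^ e2" using assms unfolding poly_bounded_def by blast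
  have "f n D + g n D \<le> (n + 2) ^ (1 + e1 + e2)" if "0 < n" "0 < D" "D \<le> n ^ a" for n D
  proof -
    have "f n D \<le> (n + 2) ^ e1" "g n D \<le> (n + 2) ^ e2" using e that by blast+
    moreover have "(n + 2) ^ e1 \<le> (n + 2) ^ (e1 + e2)" "(n + 2) ^ e2 \<le> (n + 2) ^ (e1 + e2)"
      by (intro power_increasing; simp)+
    ultimately have "f n D \<le> (n + 2) ^ (e1 + e2)" "g n D \<le> (n + 2) ^ (e1 + e2)" by linarith+
    hence "f n D + g n D \<le> 2 * (n + 2) ^ (e1 + e2)" by linarith
    also have "\<dots> \<le> (n + 2) * (n + 2) ^ (e1 + e2)" by (intro mult_le_mono) auto
    finally show ?thesis by (simp only: power_add power_one_right mult.assoc)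
  qed
  thus ?thesis unfolding poly_bounded_def by blast
qed

lemma poly_bounded_power: "poly_bounded a f \<Longrightarrow> poly_bounded a (\<lambda>n D. f n D ^ k)"
  by (induction k) (simp_all add: poly_bounded_const poly_bounded_mult)

lemma poly_bounded_tiles: "poly_bounded a (\<lambda>n D. tiles n D k)"
  by (rule poly_bounded_mono[where g = "\<lambda>n D. n ^ k + 1"])
    (intro poly_bounded_add poly_bounded_power poly_bounded_n poly_bounded_const, simp add: tiles_def)

lemmas poly_bounded_intros = poly_bounded_add poly_bounded_mult poly_bounded_power poly_bounded_tiles
  poly_bounded_n poly_bounded_D poly_bounded_const

lemma addition_comparison_basic [simp]:
  "addition_comparison skip" "addition_comparison (For v N q) = addition_comparison q"
  "addition_comparison (fill d e f m)"
  by (simp_all add: skip_def For_def, induction m, simp_all add: skip_def)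

context matrix_program begin

lemma addition_comparison_stages: "addition_comparison (stages all ind a c b s Es)"
  by (induction Es arbitrary: s)
    (simp_all add: stage_def find_blocks_def scan_def check_tuple_def update_record_def write_record_def
      mark_tile_def product_call_def entries_def addition_comparison_sim)

lemma addition_comparison_solver: "addition_comparison (solver all ind a c b Es)"
proof -
  have "addition_comparison (sort_codes b)"
    by (induction b) (simp_all add: merge_def select_head_def try_head_def output_head_def del: vsum.simps)
  thus ?thesis by (simp add: solver_def search_def search_test_def measure_def addition_comparison_sim addition_comparison_stages)
qed

end

section \<open>Consequences of the time bound for matrix programs\<close>

text \<open>The finitely many exceptions below the threshold are absorbed by adding their ratios to
  the constant. Zero must be excluded, as \<open>0 powr \<omega> = 0\<close>.\<close>

lemma bigo_powr_bound:
  fixes T :: "nat \<Rightarrow> nat" and \<omega> :: real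
  assumes "(\<lambda>n. real (T n)) \<in> O(\<lambda>n. real n powr \<omega>)"
  obtains C where "1 \<le> C" "\<And>n. 0 < n \<Longrightarrow> real (T n) \<le> C * real n powr \<omega>"
proof -
  obtain C where C: "0 < C" "\<forall>\<^sub>F n in sequentially. norm (real (T n)) \<le> C * norm (real n powr \<omega>)"
    using landau_o.bigE[OF assms] by blast
  then obtain n0 where n0: "\<And>n. n0 \<le> n \<Longrightarrow> real (T n) \<le> C * real n powr \<omega>"
    by (auto simp: eventually_sequentially)
  define S where "S = (\<Sum>n<n0. real (T n) / real n powr \<omega>)"
  have S: "0 \<le> S" unfolding S_def by (intro sum_nonneg) auto
  have "real (T n) \<le> (1 + C + S) * real n powr \<omega>" if "0 < n" for n
  proof (cases "n < n0")
    case True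
    have "real (T n) / real n powr \<omega> \<le> S"
      unfolding S_def using True by (intro member_le_sum) auto
    also have "\<dots> \<le> 1 + C + S" using C by simp
    finally show ?thesis using that by (simp add: divide_le_eq)
  next
    case False
    hence "real (T n) \<le> C * real n powr \<omega>" using n0 by simp
    also have "\<dots> \<le> (1 + C + S) * real n powr \<omega>" using S by (intro mult_right_mono) auto
    finally show ?thesis .
  qed
  with C S show ?thesis by (intro that[of "1 + C + S"]) auto
qed

text \<open>Otherwise \<open>D powr (2 - \<omega>)\<close> would be unbounded in \<open>D\<close>
  and yet at most \<open>C\<close>. Applied to \<open>square_le\<close>, this gives \<omega> \<ge>
  2.\<close>

lemma powr_growth_exponent:
  assumes "\<And>D :: nat. 0 < D \<Longrightarrow> real D * real D \<le> C * real D powr \<omega>"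
  shows "2 \<le> \<omega>"
proof (rule ccontr)
  assume "\<not> 2 \<le> \<omega>"
  hence \<delta>: "0 < 2 - \<omega>" by simp
  \<comment> \<open>Chosen such that
    \<open>r powr (2 - \<omega>) = \<bar>C\<bar> + 1\<close>.\<close>
  define r where "r = (\<bar>C\<bar> + 1) powr (1 / (2 - \<omega>))"
  define n where "n = nat \<lceil>r\<rceil> + 1"
  have "r < real n" unfolding n_def by linarith
  hence "r powr (2 - \<omega>) < real n powr (2 - \<omega>)" using \<delta> by (intro powr_less_mono2) (auto simp: r_def)
  hence n: "C < real n powr (2 - \<omega>)" "0 < n" using \<delta> by (simp_all add: r_def powr_powr n_def)
  have "C * real n powr \<omega> < real n powr (2 - \<omega>) * real n powr \<omega>"
    using n by (intro mult_strict_right_mono) auto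
  also have "\<dots> = real n * real n" using n by (simp flip: powr_add) (simp add: powr_numeral power2_eq_square)
  finally show False using assms[OF n(2)] by simp
qed

section \<open>From the solver to the graph problems\<close>

lemma graph_problem_solvable:
  fixes H :: "'a graph" and \<omega> \<beta> \<tau> :: real and a b c :: nat
    and spec :: "nat \<Rightarrow> nat graph \<Rightarrow> (nat \<Rightarrow> real) \<Rightarrow> words \<Rightarrow> bool"
  defines "h \<equiv> a + c + b"
  assumes \<omega>: "matmul_in_time \<omega>" "\<omega> \<le> 3" and a: "1 \<le> a" "a \<le> c"
    and \<beta>: "0 \<le> \<beta>" "\<beta> \<le> real a" "\<beta> \<le> real b"
    and \<tau>: "real a + real c + \<beta> \<le> \<tau>" "real a + real c + real b - (3 - \<omega>) * \<beta> \<le> \<tau>"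
    and balanced: "\<beta> = real a \<or> \<beta> * (4 - \<omega>) = real b"
    and spec: "\<And>n G w w' W. simple_graph G \<Longrightarrow> verts G = {..<n} \<Longrightarrow> (\<And>v. v < n \<Longrightarrow> w' v = w v) \<Longrightarrow>
      solved w' all ind (labellings H h) n h (adjacency n G) {} W \<Longrightarrow> spec n G w W"
  shows "graph_problem_in_time spec \<tau>"
proof -
  obtain p c0 T where p: "arithmetic p" and T: "(\<lambda>n. real (T n)) \<in> O(\<lambda>n. real n powr \<omega>)"
    and ex: "\<And>n M N. \<exists>k W X. exec (word_bound c0 n) p (matrix_input n M N) k (W, X) \<and> k \<le> T n \<and>
        (\<forall>i<n. \<forall>j<n. X 2 (i * n + j) = (\<Sum>l<n. M i l * N l j))"
    using \<omega>(1) unfolding matmul_in_time_def by blast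
  obtain j where mp: "matrix_program p (word_bound c0) j" and jT: "\<And>n. j n \<le> T n"
    using matrix_program_exists[where B = "word_bound c0" and T = T, OF p ex] by blast
  interpret matrix_program p "word_bound c0" j by (rule mp)
  obtain C where C: "1 \<le> C" "\<And>n. 0 < n \<Longrightarrow> real (T n) \<le> C * real n powr \<omega>" using bigo_powr_bound[OF T] by blast
  have jC: "real (j D) \<le> C * real D powr \<omega>" if "0 < D" for D
    using C(2)[OF that] jT[of D] by (meson of_nat_mono order_trans)
  have \<omega>2: "2 \<le> \<omega>"
  proof (rule powr_growth_exponent)
    fix D :: nat assume "0 < D"
    thus "real D * real D \<le> C * real D powr \<omega>"
      using jC[of D] square_le[of D] by (metis of_nat_le_iff of_nat_mult order_trans)
  qed
  obtain Es where Es: "set Es = labellings H h" using finite_list[OF finite_labellings] by blast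
  obtain K where K: "0 \<le> K" "\<And>n l. 0 < n \<Longrightarrow> 2 ^ l \<le> n ^ a \<Longrightarrow> \<not> continue n a b (2 ^ l) \<Longrightarrow> (\<forall>i<l. continue n a b (2 ^ i)) \<Longrightarrow>
     real (solver_time (length Es) n l a c b) \<le> K * real n powr \<tau>"
    using solver_time_bound[where C = C and e = "length Es", OF jC C(1) \<omega>2 \<omega>(2) a \<beta> \<tau> balanced] by blast
  \<comment> \<open>A word bound needs a natural exponent, so \<omega> is replaced by 3.\<close>
  have j3: "j D \<le> nat \<lceil>C\<rceil> * D ^ 3" if "0 < D" for D
  proof -
    have "real (j D) \<le> C * real D powr \<omega>" by (rule jC[OF that])
    also have "\<dots> \<le> C * real D powr 3"
      using \<omega>(2) C(1) that by (intro mult_left_mono powr_mono) auto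
    also have "\<dots> \<le> real (nat \<lceil>C\<rceil>) * real D ^ 3"
      using that by (simp add: powr_numeral mult_right_mono real_nat_ceiling_ge)
    finally have "real (j D) \<le> real (nat \<lceil>C\<rceil> * D ^ 3)" by simp
    thus ?thesis by (rule of_nat_le_iff[THEN iffD1])
  qed
  let ?Q = "\<lambda>n D. tiles n D b * tiles n D a * tiles n D c"
  let ?N = "\<lambda>n D. tiles n D a * D * (tiles n D c * D) * D"
  have "poly_bounded a (\<lambda>n D. n ^ b + n + 2 + (D + 2) ^ c0 + nat \<lceil>C\<rceil> * D ^ 3 + (D + 1 + length Es * ?Q n D) + ?N n D)"
    by (intro poly_bounded_intros)
  then obtain e where e: "\<And>n D. 0 < n \<Longrightarrow> 0 < D \<Longrightarrow> D \<le> n ^ a \<Longrightarrow>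
     n ^ b + n + 2 + (D + 2) ^ c0 + nat \<lceil>C\<rceil> * D ^ 3 + (D + 1 + length Es * ?Q n D) + ?N n D \<le> (n + 2) ^ e"
    unfolding poly_bounded_def by blast
  let ?p = "solver all ind a c b Es"
  define S where "S = csize ?p"
  \<comment> \<open>For \<open>n = 0\<close> the program makes two steps of \<open>run\<close>, the
    test and \<open>skip\<close>, each costing at most \<open>S\<close>.\<close>
  define T' where "T' n = (if n = 0 then 2 * S else nat \<lfloor>real S * K * real n powr \<tau>\<rfloor>)" for n :: nat
  have bigo: "(\<lambda>n. real (T' n)) \<in> O(\<lambda>n. real n powr \<tau>)"
  proof (rule landau_o.bigI[of "real S * K + 1"])
    show "\<forall>\<^sub>F n in sequentially. norm (real (T' n)) \<le> (real S * K + 1) * norm (real n powr \<tau>)"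
      using eventually_gt_at_top[of 0]
    proof eventually_elim
      case (elim n)
      have "real (T' n) = of_int \<lfloor>real S * K * real n powr \<tau>\<rfloor>" using elim K(1) by (simp add: T'_def)
      also have "\<dots> \<le> real S * K * real n powr \<tau>" by (rule of_int_floor_le)
      also have "\<dots> \<le> (real S * K + 1) * real n powr \<tau>" by (intro mult_right_mono) auto
      finally show ?case by simp
    qed
  qed (use K(1) in \<open>simp add: add_nonneg_pos\<close>)
  have "\<exists>k W X. exec (word_bound (e * S) n) ?p (graph_input n G w) k (W, X) \<and> k \<le> T' n \<and> spec n G w W"
    if G: "simple_graph G" "verts G = {..<n}" for n G w
  proof -
    define W where "W = fst (graph_input n G w)"
    define X where "X = snd (graph_input n G w)"
    have WX: "graph_input n G w = (W, X)" by (simp add: W_def X_def)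
    have W0: "W 0 0 = n" "W 1 = adjacency n G" "\<And>v i. 2 \<le> v \<Longrightarrow> W v i = 0"
      by (auto simp: W_def graph_input_def adjacency_def fun_eq_iff)
    have A1: "adjacency n G i \<le> 1" for i by (simp add: adjacency_def)
    have X: "X 1 0 = 0" "\<And>v. v < n \<Longrightarrow> X 0 v = w v" by (auto simp: X_def graph_input_def)
    \<comment> \<open>\<open>M\<close> bounds the stored words; intermediate results are bounded by
      \<open>M ^ S\<close>, which is the word bound with exponent \<open>e * S\<close>.\<close>
    define M where "M = (n + 2) ^ e"
    have e1: "1 \<le> e" using e[of 1 1] by (cases e) auto
    have nM: "n + 2 \<le> M" using power_increasing[OF e1, of "n + 2"] by (simp add: M_def)
    have bnd: "W v i \<le> M" for v i
      using nM by (auto simp: W_def graph_input_def)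
    have MS: "M ^ S = word_bound (e * S) n" by (simp add: M_def word_bound_def power_mult)
    have fin: ?thesis if r: "run M X ?p W k W'" and k: "S * k \<le> T' n" and sp: "spec n G w W'" for k W'
    proof -
      obtain k' where "k' \<le> S * k" "exec (M ^ S) ?p (W, X) k' (W', X)"
        using run_exec[OF r bnd, of S] nM by (auto simp: S_def)
      with k sp show ?thesis unfolding WX MS by (meson order_trans)
    qed
    show ?thesis
    proof (cases "n = 0")
      case True
      let ?W = "W(15 := (W 15)(0 := 0))"
      have "run M X skip W 1 ?W" unfolding skip_def using run.SetW[of W "Const 0" M X 15 "Const 0"] by simp
      hence "run M X ?p W (1 + 1) ?W" unfolding solver_def using True W0 by (intro run.IfFalse) auto
      moreover have "spec n G w ?W"
      proof (rule spec[OF G])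
        have "records h w ?W {}" using W0(3) by (simp add: records_def record_ok_def)
        \<comment> \<open>Without vertices there is no tuple to be dominated, so the empty set of
          candidates is complete.\<close>
        moreover have "complete_for w all ind E n h (adjacency n G) {}" for E
        proof -
          have "\<not> (\<forall>i<h. x i < n)" for x :: "nat \<Rightarrow> nat" using True a by (auto simp: h_def intro!: exI[of _ 0])
          thus ?thesis unfolding complete_for_def by blast
        qed
        ultimately show "solved w all ind (labellings H h) n h (adjacency n G) {} ?W"
          unfolding solved_def by (intro exI[of _ "{}"]) (simp add: sound_for_def)
      qed simp
      ultimately show ?thesis using True by (intro fin) (auto simp: T'_def)
    next
      case False
      hence n: "0 < n" by simp
      have bounds: "n ^ b \<le> M" "n \<le> M" "\<And>D. 0 < D \<Longrightarrow> D \<le> n ^ a \<Longrightarrow> word_bound c0 D \<le> M \<and> j D \<le> M \<and>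
        D + 1 + length Es * ?Q n D \<le> M \<and> ?N n D \<le> M"
      proof -
        show "n ^ b \<le> M" "n \<le> M" using e[OF n, of 1] n by (simp_all add: M_def)
        fix D :: nat assume D: "0 < D" "D \<le> n ^ a"
        from e[OF n D] j3[OF D(1)]
        have "(D + 2) ^ c0 \<le> M" "j D \<le> M" "D + 1 + length Es * ?Q n D \<le> M" "?N n D \<le> M" unfolding M_def by linarith+
        thus "word_bound c0 D \<le> M \<and> j D \<le> M \<and> D + 1 + length Es * ?Q n D \<le> M \<and> ?N n D \<le> M"
          by (simp add: word_bound_def)
      qed
      obtain l where l: "2 ^ l \<le> n ^ a" "\<not> continue n a b (2 ^ l)" "\<And>i. i < l \<Longrightarrow> continue n a b (2 ^ i)"
        "tc M X ?p W (solver_time (length Es) n l a c b) (solved (X 0) all ind (set Es) n (a + c + b) (W 1) {})"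
      proof (rule solver[where M = M and W = W and X = X and n = n and Es = Es])
        show "0 < n" by (rule n)
        show "W 0 0 = n" by (rule W0)
        show "W 1 i \<le> 1" for i unfolding W0 by (rule A1)
        show "2 \<le> a + c" using a by linarith
        show "X 1 0 = 0" by (rule X)
        show "W v i = 0" if "2 \<le> v" for v i using that by (rule W0)
      qed (use bounds in auto)
      then obtain k W' where r: "run M X ?p W k W'" "k \<le> solver_time (length Es) n l a c b"
        and W': "solved (X 0) all ind (labellings H h) n h (adjacency n G) {} W'"
        unfolding tc_def h_def[symmetric] Es W0(2) by blast
      have "real k \<le> K * real n powr \<tau>"
        using r(2) K(2)[OF n l(1,2)] l(3) by (meson of_nat_mono order_trans)
      hence "real S * real k \<le> real S * (K * real n powr \<tau>)" by (intro mult_left_mono) auto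
      hence "real (S * k) \<le> real S * K * real n powr \<tau>" by (simp add: mult.assoc)
      hence "S * k \<le> T' n" using False by (simp add: T'_def le_nat_floor)
      thus ?thesis using spec[OF G X(2) W'] by (intro fin[OF r(1)])
    qed
  qed
  thus ?thesis unfolding graph_problem_in_time_def
    using addition_comparison_solver bigo by blast
qed

section \<open>Parameters that realise the exponent\<close>

text \<open>In both cases \<open>a\<close> is the floor of \<open>(h - b) / 2\<close>, so that
  \<open>a \<le> c\<close>. For \<open>s1\<close>, \<beta> is the balance point
  \<open>b / (4 - \<omega>)\<close>, where the two cost exponents coincide; the condition in
  \<open>b1\<close> says that it is at most \<open>a\<close>. For \<open>s2\<close>, \<beta> is the
  cap \<open>a\<close>, and the two cost exponents are the arguments of the maximum.\<close>

lemma t_exponent_parameters: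
  fixes \<omega> :: real and h :: nat
  assumes h: "3 \<le> h" and \<omega>: "\<omega> \<le> 3"
  obtains a c b \<beta> where "h = a + c + b" "1 \<le> a" "a \<le> c" "0 \<le> \<beta>" "\<beta> \<le> real a" "\<beta> \<le> real b"
    "real a + real c + \<beta> \<le> t_exponent \<omega> h" "real a + real c + real b - (3 - \<omega>) * \<beta> \<le> t_exponent \<omega> h"
    "\<beta> = real a \<or> \<beta> * (4 - \<omega>) = real b"
proof (cases "s1 \<omega> h \<le> s2 \<omega> h")
  case True
  define A where "A = {b. real b / (4 - \<omega>) \<le> real_of_int (half_rest h (int b))}"
  define b where "b = b1 \<omega> h"
  have "b \<le> h" if "b \<in> A" for b
  proof -
    have "0 \<le> real b / (4 - \<omega>)" using \<omega> by simp
    also have "\<dots> \<le> real_of_int (half_rest h (int b))" using that by (simp add: A_def)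
    finally have "0 \<le> half_rest h (int b)" by simp
    thus ?thesis by (simp add: half_rest_def)
  qed
  hence "A \<subseteq> {..h}" by blast
  hence fin: "finite A" by (rule finite_subset) simp
  \<comment> \<open>\<open>b = 1\<close> is admissible as \<open>h \<ge> 3\<close> and
    \<open>4 - \<omega> \<ge> 1\<close>. Hence the maximum is positive, and so are \<beta> and
    \<open>a\<close>.\<close>
  have "1 \<le> half_rest h 1" using h by (simp add: half_rest_def)
  moreover have "1 / (4 - \<omega>) \<le> 1" using \<omega> by simp
  ultimately have "1 \<in> A" unfolding A_def by (simp add: order_trans)
  hence "b \<in> A" "1 \<le> b" using Max_in[OF fin] Max_ge[OF fin] by (auto simp: b_def b1_def A_def[symmetric])
  define a where "a = nat (half_rest h (int b))"
  define c where "c = h - b - a"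
  define \<beta> where "\<beta> = real b / (4 - \<omega>)"
  have \<beta>0: "0 < \<beta>" using \<omega> \<open>1 \<le> b\<close> by (simp add: \<beta>_def)
  have "\<beta> \<le> real_of_int (half_rest h (int b))" using \<open>b \<in> A\<close> by (simp add: A_def \<beta>_def)
  hence hr: "0 < half_rest h (int b)" "\<beta> \<le> real a" using \<beta>0 by (auto simp: a_def)
  hence abc: "1 \<le> a" "h = a + c + b" "a \<le> c" by (auto simp: a_def c_def half_rest_def)
  have bal: "\<beta> * (4 - \<omega>) = real b" using \<omega> by (simp add: \<beta>_def)
  have "\<beta> \<le> real b" using \<omega> by (simp add: \<beta>_def divide_le_eq mult_le_cancel_left1)
  moreover have "t_exponent \<omega> h = real a + real c + \<beta>"
  proof -
    have "t_exponent \<omega> h = real h - real b + \<beta>" using True by (simp add: t_exponent_def s1_def \<beta>_def b_def)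
    moreover have "real h = real a + real c + real b" using abc(2) by (metis of_nat_add)
    ultimately show ?thesis by simp
  qed
  moreover have "real a + real c + real b - (3 - \<omega>) * \<beta> = real a + real c + \<beta>"
    using bal by (simp add: algebra_simps)
  ultimately show ?thesis using abc \<beta>0 hr bal by (intro that[of a c b \<beta>]) auto
next
  case False
  define A where "A = {s2_at \<omega> h b | b. half_rest h b \<le> b \<and> b \<le> int h - 2}"
  have "A \<subseteq> s2_at \<omega> h ` {0..int h}" using h by (auto simp: A_def half_rest_def)
  hence fin: "finite A" by (rule finite_subset) simp
  \<comment> \<open>\<open>b = h - 2\<close> is admissible: its \<open>half_rest\<close> is 1, and
    \<open>h \<ge> 3\<close>.\<close>
  have "s2_at \<omega> h (int h - 2) \<in> A" using h by (auto simp: A_def half_rest_def)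
  hence "s2 \<omega> h \<in> A" unfolding s2_def A_def[symmetric] using Min_in[OF fin] by blast
  then obtain bi where bi: "s2 \<omega> h = s2_at \<omega> h bi" "half_rest h bi \<le> bi" "bi \<le> int h - 2" unfolding A_def by blast
  have hr: "1 \<le> half_rest h bi" using bi by (simp add: half_rest_def)
  define a where "a = nat (half_rest h bi)"
  define b where "b = nat bi"
  define c where "c = h - b - a"
  have ab: "int a = half_rest h bi" "int b = bi" using hr bi by (auto simp: a_def b_def)
  have abc: "1 \<le> a" "h = a + c + b" "a \<le> c" "a \<le> b" using hr bi ab by (auto simp: c_def half_rest_def)
  have r: "real_of_int (half_rest h bi) = real a" "real_of_int bi = real b" using ab by (metis of_int_of_nat_eq)+
  have "t_exponent \<omega> h = max (real a + real c + real a) (real a + real c + real b - (3 - \<omega>) * real a)"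
  proof -
    have "t_exponent \<omega> h = s2_at \<omega> h bi" using False bi(1) by (simp add: t_exponent_def)
    moreover have "real h = real a + real c + real b" using abc(2) by (metis of_nat_add)
    ultimately show ?thesis unfolding s2_at_def r by simp
  qed
  then show ?thesis using abc by (intro that[of a c b "real a"]) auto
qed

theorem theorem1p1:
  fixes H :: "'a graph" and h :: nat and \<omega> :: real
  assumes "h \<ge> 3"
    and "simple_graph H" and "card (verts H) = h"
    and "matmul_in_time \<omega>" and "\<omega> \<le> 3"
  shows "graph_problem_in_time (all_pairs_max_induced H) (t_exponent \<omega> h)
    \<and> graph_problem_in_time (max_H_subgraph H) (t_exponent \<omega> h)
    \<and> graph_problem_in_time (max_induced_H_subgraph H) (t_exponent \<omega> h)"
proof -
  obtain a c b \<beta> where h: "h = a + c + b" and par: "1 \<le> a" "a \<le> c" "0 \<le> \<beta>" "\<beta> \<le> real a" "\<beta> \<le> real b"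
    "real a + real c + \<beta> \<le> t_exponent \<omega> h" "real a + real c + real b - (3 - \<omega>) * \<beta> \<le> t_exponent \<omega> h"
    "\<beta> = real a \<or> \<beta> * (4 - \<omega>) = real b" using t_exponent_parameters[OF assms(1,5)] by metis
  have H: "simple_graph H" "card (verts H) = a + c + b" "2 \<le> a + c + b" using assms h by auto
  \<comment> \<open>One solver covers all three problems. \<open>all\<close> asks for a record for
    every pair and \<open>ind\<close> for induced copies.\<close>
  have "graph_problem_in_time (if all then all_pairs_max_induced H
      else if ind then max_induced_H_subgraph H else max_H_subgraph H) (t_exponent \<omega> h)" if "all \<longrightarrow> ind" for all ind
  proof (rule graph_problem_solvable[OF assms(4,5) par, where H = H and all = all and ind = ind])
    fix n G w w' W
    assume *: "simple_graph G" "verts G = {..<n}" "\<And>v. v < n \<Longrightarrow> w' v = w v"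
      "solved w' all ind (labellings H (a + c + b)) n (a + c + b) (adjacency n G) {} W"
    from solution_reports[OF H *] that
    show "(if all then all_pairs_max_induced H
      else if ind then max_induced_H_subgraph H else max_H_subgraph H) n G w W" by auto
  qed
  from this[of True True] this[of False False] this[of False True] show ?thesis by simp
qed

end
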